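(* Let $(A,D)$ be an inclusion. (The unital case.) If $A$ is unital, then $(A,D)$ satisfies Kumjian's conditions if and only if $(A,D)$ is a Cartan inclusion and every pure state on $D$ uniquely extends to a state on $A$. (The non-unital case.) Suppose $A$ is not unital. The following are equivalent. (1) $(A,D)$ satisfies Kumjian's conditions. (2) $(A,D)$ is a Cartan inclusion such that every pure state of $D$ has a unique extension to a state on $A$. (3) $(A,D)$ is a Cartan inclusion such that every pure state of $D$ has a unique extension to a state on $A$ and no pure state of $A$ annihilates $D$. (4) $(\tilde A,\tilde D)$ is a Cartan inclusion such that every pure state of $\tilde D$ extends uniquely to a state on $\tilde A$. (5) $(\tilde A,\tilde D)$ satisfies Kumjian's conditions.
   Context: An inclusion is a pair $(A,D)$ where $A$ and $D$ are $C^*$-algebras (not assumed unital), $D$ is abelian, and $D\subseteq A$ is a $C^*$-subalgebra. The set of normalizers is $N(A,D):=\{n\in A: nDn^*\cup n^*Dn\subseteq D\}$, and the set of free normalizers is $N_f(A,D):=\{n\in N(A,D): n^2=0\}$. The inclusion $(A,D)$ is regular if the linear span of $N(A,D)$ is norm-dense in $A$; it is a MASA inclusion if $D$ is maximal abelian in $A$; it is a Cartan inclusion if it is a regular MASA inclusion and there exists a faithful conditional expectation $P:A\to D$. An inclusion $(A,D)$ satisfies Kumjian's conditions if (I) there is a faithful conditional expectation $P:A\to D$; and (II) the linear span of $N_f(A,D)$ is norm-dense in $\ker P$. When $A$ is not unital, $\tilde A$ denotes its unitization, with elements written $(a,\lambda)$, $a\in A$, $\lambda\in\mathbb C$, and unit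 $(0,1)$; $\tilde D:=\{(d,\lambda): d\in D,\ \lambda\in\mathbb C\}\subseteq\tilde A$. The inclusion $(\tilde A,\tilde D)$ is the unitization of $(A,D)$. *)

theory Defs
  imports "HOL-Analysis.Analysis"
begin

section \<open>C*-algebras\<close>

text \<open>
  C*-algebras are complex and not assumed unital.  The real scalar multiplication that
  \<^class>\<open>real_normed_algebra\<close> supplies is tied to the complex one by \<open>scaleR_scaleC\<close>.
\<close>

class scaleC =
  fixes scaleC :: "complex \<Rightarrow> 'a \<Rightarrow> 'a"  (infixr "*\<^sub>C" 75)

class star =
  fixes star :: "'a \<Rightarrow> 'a"

class cstar_algebra = banach + real_normed_algebra + scaleC + star +
  assumes scaleC_add_right: "c *\<^sub>C (x + y) = c *\<^sub>C x + c *\<^sub>C y"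
    and scaleC_add_left: "(c + d) *\<^sub>C x = c *\<^sub>C x + d *\<^sub>C x"
    and scaleC_scaleC: "c *\<^sub>C d *\<^sub>C x = (c * d) *\<^sub>C x"
    and scaleC_one: "1 *\<^sub>C x = x"
    and scaleR_scaleC: "r *\<^sub>R x = complex_of_real r *\<^sub>C x"
    and norm_scaleC: "norm (c *\<^sub>C x) = cmod c * norm x"
    and mult_scaleC_left: "(c *\<^sub>C x) * y = c *\<^sub>C (x * y)"
    and mult_scaleC_right: "x * (c *\<^sub>C y) = c *\<^sub>C (x * y)"
    and star_add: "star (x + y) = star x + star y"
    and star_scaleC: "star (c *\<^sub>C x) = cnj c *\<^sub>C star x"
    and star_mult: "star (x * y) = star y * star x"
    and star_star: "star (star x) = x"
    and cstar_identity: "norm (star x * x) = (norm x)\<^sup>2"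

global_interpretation complex_vector:
  vector_space "scaleC :: complex \<Rightarrow> 'a \<Rightarrow> 'a::cstar_algebra"
  by unfold_locales
    (rule scaleC_add_right scaleC_add_left scaleC_scaleC scaleC_one)+

definition unital_algebra :: "'a::cstar_algebra itself \<Rightarrow> bool" where
  "unital_algebra _ \<longleftrightarrow> (\<exists>e::'a. \<forall>a. e * a = a \<and> a * e = a)"

definition cstar_subalgebra :: "'a::cstar_algebra set \<Rightarrow> bool" where
  "cstar_subalgebra B \<longleftrightarrow>
     complex_vector.subspace B \<and> closed B \<and>
     (\<forall>x\<in>B. \<forall>y\<in>B. x * y \<in> B) \<and> (\<forall>x\<in>B. star x \<in> B)"

definition abelian :: "'a::cstar_algebra set \<Rightarrow> bool" where
  "abelian B \<longleftrightarrow> (\<forall>x\<in>B. \<forall>y\<in>B. x * y = y * x)"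


section \<open>Inclusions\<close>

text \<open>
  In an inclusion \<open>(A, D)\<close> the algebra \<open>A\<close> is the whole type \<open>'a\<close>, and \<open>D\<close> is a subset of it.
  The unit of \<open>A\<close>, if there is one, need not belong to \<open>D\<close>.
\<close>

definition inclusion :: "'a::cstar_algebra set \<Rightarrow> bool" where
  "inclusion D \<longleftrightarrow> cstar_subalgebra D \<and> abelian D"

definition normalizers :: "'a::cstar_algebra set \<Rightarrow> 'a set" where
  "normalizers D = {n. \<forall>d\<in>D. n * d * star n \<in> D \<and> star n * d * n \<in> D}"

definition free_normalizers :: "'a::cstar_algebra set \<Rightarrow> 'a set" where
  "free_normalizers D = {n \<in> normalizers D. n * n = 0}"

definition regular_inclusion :: "'a::cstar_algebra set \<Rightarrow> bool" where
  "regular_inclusion D \<longleftrightarrow>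
     inclusion D \<and> closure (complex_vector.span (normalizers D)) = UNIV"

definition masa_inclusion :: "'a::cstar_algebra set \<Rightarrow> bool" where
  "masa_inclusion D \<longleftrightarrow>
     inclusion D \<and> (\<forall>B. cstar_subalgebra B \<and> abelian B \<and> D \<subseteq> B \<longrightarrow> B = D)"

text \<open>
  Positivity of \<open>P\<close> is expressed by: \<open>P (a\<^sup>*a)\<close> has the form \<open>d\<^sup>*d\<close> with \<open>d \<in> D\<close>.
  Together with the bimodule property it yields complete positivity, since
  \<open>\<Sum>\<^sub>i\<^sub>j d\<^sub>i\<^sup>* P(a\<^sub>i\<^sup>* a\<^sub>j) d\<^sub>j = P (b\<^sup>*b)\<close> for \<open>b = \<Sum>\<^sub>i a\<^sub>i d\<^sub>i\<close>.
\<close>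

definition conditional_expectation ::
    "'a::cstar_algebra set \<Rightarrow> ('a \<Rightarrow> 'a) \<Rightarrow> bool" where
  "conditional_expectation D P \<longleftrightarrow>
     Vector_Spaces.linear scaleC scaleC P \<and>
     range P \<subseteq> D \<and> (\<forall>d\<in>D. P d = d) \<and>
     (\<forall>a. norm (P a) \<le> norm a) \<and>
     (\<forall>a. \<exists>d\<in>D. P (star a * a) = star d * d) \<and>
     (\<forall>d\<in>D. \<forall>a. P (d * a) = d * P a \<and> P (a * d) = P a * d)"

definition faithful :: "('a::cstar_algebra \<Rightarrow> 'a) \<Rightarrow> bool" where
  "faithful P \<longleftrightarrow> (\<forall>a. P (star a * a) = 0 \<longrightarrow> a = 0)"

definition cartan_inclusion :: "'a::cstar_algebra set \<Rightarrow> bool" where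
  "cartan_inclusion D \<longleftrightarrow>
     regular_inclusion D \<and> masa_inclusion D \<and>
     (\<exists>P. conditional_expectation D P \<and> faithful P)"

text \<open>
  The kernel of \<open>P\<close> is closed, so the equation below says exactly that the span of the
  free normalizers is contained in the kernel and dense in it.
\<close>

definition kumjian_conditions :: "'a::cstar_algebra set \<Rightarrow> bool" where
  "kumjian_conditions D \<longleftrightarrow>
     (\<exists>P. conditional_expectation D P \<and> faithful P \<and>
          closure (complex_vector.span (free_normalizers D)) = {a. P a = 0})"


section \<open>States\<close>

text \<open>
  A functional on a C*-subalgebra \<open>B\<close> is represented by a function on the whole type of which
  only the values on \<open>B\<close> matter; functionals on \<open>B\<close> are therefore compared on \<open>B\<close> only.
  The states of the whole algebra are those with \<open>B = UNIV\<close>.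
\<close>

definition state_on :: "'a::cstar_algebra set \<Rightarrow> ('a \<Rightarrow> complex) \<Rightarrow> bool" where
  "state_on B f \<longleftrightarrow>
     (\<forall>x\<in>B. \<forall>y\<in>B. f (x + y) = f x + f y) \<and>
     (\<forall>c. \<forall>x\<in>B. f (c *\<^sub>C x) = c * f x) \<and>
     (\<forall>x\<in>B. f (star x * x) \<in> \<real>\<^sub>\<ge>\<^sub>0) \<and>
     bdd_above ((\<lambda>x. cmod (f x)) ` {x\<in>B. norm x \<le> 1}) \<and>
     (SUP x\<in>{x\<in>B. norm x \<le> 1}. cmod (f x)) = 1"

text \<open>Pure states are the extreme points of the convex set of states.\<close>

definition pure_state_on :: "'a::cstar_algebra set \<Rightarrow> ('a \<Rightarrow> complex) \<Rightarrow> bool" where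
  "pure_state_on B f \<longleftrightarrow>
     state_on B f \<and>
     (\<forall>g h t. state_on B g \<and> state_on B h \<and> 0 < t \<and> t < 1 \<and>
        (\<forall>x\<in>B. f x = complex_of_real t * g x + complex_of_real (1 - t) * h x) \<longrightarrow>
        (\<forall>x\<in>B. g x = f x \<and> h x = f x))"

definition pure_states_extend_uniquely :: "'a::cstar_algebra set \<Rightarrow> bool" where
  "pure_states_extend_uniquely D \<longleftrightarrow>
     (\<forall>f. pure_state_on D f \<longrightarrow> (\<exists>!g. state_on UNIV g \<and> (\<forall>d\<in>D. g d = f d)))"


section \<open>Elementary facts\<close>

lemma star_zero [simp]: "star (0::'a::cstar_algebra) = 0"
  using star_add[of 0 "0::'a"] by simp

lemma norm_star [simp]: "norm (star a) = norm (a::'a::cstar_algebra)"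
proof -
  have le: "norm x \<le> norm (star x)" for x :: 'a
  proof (cases "x = 0")
    case False
    have "norm x * norm x \<le> norm (star x) * norm x"
      using norm_mult_ineq[of "star x" x] by (simp add: cstar_identity power2_eq_square)
    with False show ?thesis by simp
  qed simp
  show ?thesis using le[of a] le[of "star a"] by (simp add: star_star)
qed

lemma norm_mult_star: "norm (a * star a) = (norm (a::'a::cstar_algebra))\<^sup>2"
  using cstar_identity[of "star a"] by (simp add: star_star)


section \<open>The unitization\<close>

datatype 'a unitization = Unitization (alg_part: 'a) (scal_part: complex)

definition unitization_set :: "'a set \<Rightarrow> 'a unitization set" where
  "unitization_set D = {Unitization d c | d c. d \<in> D}"

text \<open>Left multiplication by \<open>(a, c)\<close> on the ideal \<open>A\<close> of its unitization.\<close>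

definition left_mult :: "'a::cstar_algebra unitization \<Rightarrow> 'a \<Rightarrow> 'a" where
  "left_mult x b = alg_part x * b + scal_part x *\<^sub>C b"

lemma bounded_linear_left_mult: "bounded_linear (left_mult x)"
proof (rule bounded_linear_intro[where K = "norm (alg_part x) + cmod (scal_part x)"])
  show "left_mult x (a + b) = left_mult x a + left_mult x b" for a b
    by (simp add: left_mult_def distrib_left scaleC_add_right)
  show "left_mult x (r *\<^sub>R b) = r *\<^sub>R left_mult x b" for r b
    by (simp add: left_mult_def scaleR_scaleC mult_scaleC_right scaleC_add_right
        scaleC_scaleC mult.commute)
  show "norm (left_mult x b) \<le> norm b * (norm (alg_part x) + cmod (scal_part x))" for b
  proof -
    have "norm (left_mult x b) \<le> norm (alg_part x * b) + norm (scal_part x *\<^sub>C b)"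
      unfolding left_mult_def by (rule norm_triangle_ineq)
    also have "\<dots> \<le> norm (alg_part x) * norm b + cmod (scal_part x) * norm b"
      using norm_mult_ineq[of "alg_part x" b] by (simp add: norm_scaleC)
    finally show ?thesis by (simp add: algebra_simps)
  qed
qed

lemmas norm_left_mult = onorm[OF bounded_linear_left_mult]
lemmas onorm_left_mult_nonneg = onorm_pos_le[OF bounded_linear_left_mult]

text \<open>
  The norm below is the unique C*-norm on \<open>A \<oplus> \<complex>\<close>, for unital and for non-unital \<open>A\<close>.
  For non-unital \<open>A\<close> it is the operator norm of left multiplication on \<open>A\<close>: the term
  \<open>\<bar>c\<bar>\<close> is then redundant, see \<open>norm_unitization_nonunital\<close>.  For unital \<open>A\<close> the operator
  norm alone would only be a seminorm.
\<close>

instantiation unitization :: (cstar_algebra) "{real_normed_algebra, scaleC, star}"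
begin

definition "0 = Unitization 0 0"
definition "x + y = Unitization (alg_part x + alg_part y) (scal_part x + scal_part y)"
definition "- x = Unitization (- alg_part x) (- scal_part x)"
definition "x - y = Unitization (alg_part x - alg_part y) (scal_part x - scal_part y)"
definition "c *\<^sub>C x = Unitization (c *\<^sub>C alg_part x) (c * scal_part x)"
definition "r *\<^sub>R x = Unitization (r *\<^sub>R alg_part x) (r *\<^sub>R scal_part x)"
definition "x * y =
  Unitization (alg_part x * alg_part y + scal_part y *\<^sub>C alg_part x + scal_part x *\<^sub>C alg_part y)
    (scal_part x * scal_part y)"
definition "star x = Unitization (star (alg_part x)) (cnj (scal_part x))"
definition "norm x = max (cmod (scal_part x)) (onorm (left_mult x))"
definition "dist x y = norm (x - y)" for x y :: "'a unitization"
definition "sgn x = inverse (norm x) *\<^sub>R x" for x :: "'a unitization"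
definition "uniformity = (INF e\<in>{0<..}. principal {(x, y :: 'a unitization). dist x y < e})"
definition "open U \<longleftrightarrow>
  (\<forall>x\<in>U. \<forall>\<^sub>F (x', y) in uniformity. x' = x \<longrightarrow> y \<in> U)" for U :: "'a unitization set"

lemmas unitization_ops =
  zero_unitization_def plus_unitization_def uminus_unitization_def minus_unitization_def
  scaleC_unitization_def scaleR_unitization_def times_unitization_def star_unitization_def

lemma unitization_eqI:
  "alg_part x = alg_part y \<Longrightarrow> scal_part x = scal_part y \<Longrightarrow> x = y"
  by (cases x; cases y) simp

lemma left_mult_add: "left_mult (x + y) b = left_mult x b + left_mult y b"
  for x y :: "'a unitization"
  by (simp add: left_mult_def unitization_ops distrib_right scaleC_add_left)

lemma left_mult_scaleC: "left_mult (c *\<^sub>C x) b = c *\<^sub>C left_mult x b"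
  for x :: "'a unitization"
  by (simp add: left_mult_def unitization_ops mult_scaleC_left scaleC_add_right scaleC_scaleC)

lemma left_mult_mult: "left_mult (x * y) b = left_mult x (left_mult y b)"
  for x y :: "'a unitization"
  by (simp add: left_mult_def unitization_ops distrib_right distrib_left mult_scaleC_left
      mult_scaleC_right scaleC_add_right scaleC_scaleC mult.assoc algebra_simps)

lemma star_left_mult_mult: "star (left_mult x a) * b = star a * left_mult (star x) b"
  for x :: "'a unitization"
  by (simp add: left_mult_def unitization_ops distrib_right distrib_left mult_scaleC_left
      mult_scaleC_right star_add star_mult star_scaleC mult.assoc)

lemma norm_alg_part_le: "norm (alg_part x) \<le> 2 * norm x" for x :: "'a unitization"
proof (cases "alg_part x = 0")
  case False
  let ?a = "alg_part x"
  have "norm ?a * norm ?a = norm (?a * star ?a)"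
    by (simp add: norm_mult_star power2_eq_square)
  also have "?a * star ?a = left_mult x (star ?a) - scal_part x *\<^sub>C star ?a"
    by (simp add: left_mult_def)
  also have "norm \<dots> \<le> norm (left_mult x (star ?a)) + norm (scal_part x *\<^sub>C star ?a)"
    by (rule norm_triangle_ineq4)
  also have "\<dots> \<le> onorm (left_mult x) * norm ?a + cmod (scal_part x) * norm ?a"
    using norm_left_mult[of x "star ?a"] by (simp add: norm_scaleC)
  also have "\<dots> \<le> norm x * norm ?a + norm x * norm ?a"
    by (intro add_mono mult_right_mono) (auto simp: norm_unitization_def)
  also have "\<dots> = 2 * norm x * norm ?a" by simp
  finally show ?thesis using False by simp
qed (use onorm_left_mult_nonneg[of x] in \<open>simp add: norm_unitization_def max_def\<close>)

lemma norm_unitization_le: "norm x \<le> norm (alg_part x) + cmod (scal_part x)"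
  for x :: "'a unitization"
proof -
  have "onorm (left_mult x) \<le> norm (alg_part x) + cmod (scal_part x)"
  proof (rule onorm_bound)
    fix b
    have "norm (left_mult x b) \<le> norm (alg_part x * b) + norm (scal_part x *\<^sub>C b)"
      unfolding left_mult_def by (rule norm_triangle_ineq)
    also have "\<dots> \<le> norm (alg_part x) * norm b + cmod (scal_part x) * norm b"
      using norm_mult_ineq[of "alg_part x" b] by (simp add: norm_scaleC)
    finally show "norm (left_mult x b) \<le> (norm (alg_part x) + cmod (scal_part x)) * norm b"
      by (simp add: algebra_simps)
  qed simp
  then show ?thesis by (simp add: norm_unitization_def)
qed

lemma norm_unitization_nonneg: "0 \<le> norm x" for x :: "'a unitization"
  by (simp add: norm_unitization_def le_max_iff_disj)

lemma norm_left_mult_le: "norm (left_mult x b) \<le> norm x * norm b" for x :: "'a unitization"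
  using norm_left_mult[of x b]
  by (rule order_trans) (auto intro!: mult_right_mono simp: norm_unitization_def)

lemma norm_unitizationI:
  fixes x :: "'a unitization"
  assumes "cmod (scal_part x) \<le> r" and "\<And>b. norm (left_mult x b) \<le> r * norm b"
  shows "norm x \<le> r"
proof -
  have "0 \<le> r" using assms(1) norm_ge_zero order_trans by blast
  then show ?thesis
    using assms by (simp add: norm_unitization_def onorm_bound)
qed

lemma scal_part_le: "cmod (scal_part x) \<le> norm x" for x :: "'a unitization"
  by (simp add: norm_unitization_def)

lemma norm_unitization_eq_0: "norm x = 0 \<longleftrightarrow> x = 0" for x :: "'a unitization"
proof
  assume "norm x = 0"
  then show "x = 0"
    using norm_alg_part_le[of x] scal_part_le[of x]
    by (intro unitization_eqI) (simp_all add: unitization_ops)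
next
  assume "x = 0"
  then have "norm x \<le> 0"
    using norm_unitization_le[of x] by (simp add: unitization_ops)
  then show "norm x = 0" using norm_unitization_nonneg[of x] by simp
qed

lemma norm_unitization_triangle: "norm (x + y) \<le> norm x + norm y" for x y :: "'a unitization"
proof (rule norm_unitizationI)
  have "cmod (scal_part (x + y)) \<le> cmod (scal_part x) + cmod (scal_part y)"
    by (simp add: unitization_ops norm_triangle_ineq)
  then show "cmod (scal_part (x + y)) \<le> norm x + norm y"
    using scal_part_le[of x] scal_part_le[of y] by linarith
next
  fix b
  have "norm (left_mult (x + y) b) \<le> norm (left_mult x b) + norm (left_mult y b)"
    unfolding left_mult_add by (rule norm_triangle_ineq)
  then show "norm (left_mult (x + y) b) \<le> (norm x + norm y) * norm b"
    using norm_left_mult_le[of x b] norm_left_mult_le[of y b] by (simp add: distrib_right)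
qed

lemma norm_unitization_scaleC_le: "norm (c *\<^sub>C x) \<le> cmod c * norm x" for x :: "'a unitization"
proof (rule norm_unitizationI)
  show "cmod (scal_part (c *\<^sub>C x)) \<le> cmod c * norm x"
    using scal_part_le[of x] by (simp add: unitization_ops norm_mult mult_left_mono)
  show "norm (left_mult (c *\<^sub>C x) b) \<le> cmod c * norm x * norm b" for b
    using norm_left_mult_le[of x b]
    by (simp add: left_mult_scaleC norm_scaleC mult_left_mono mult.assoc)
qed

lemma norm_unitization_scaleC: "norm (c *\<^sub>C x) = cmod c * norm x" for x :: "'a unitization"
proof (cases "c = 0")
  case True
  then show ?thesis
    using norm_unitization_scaleC_le[of c x] norm_unitization_nonneg[of "c *\<^sub>C x"] by simp
next
  case False
  have "inverse c *\<^sub>C c *\<^sub>C x = x"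
    using False
    by (intro unitization_eqI) (simp_all add: unitization_ops scaleC_scaleC scaleC_one)
  then have "norm x \<le> cmod (inverse c) * norm (c *\<^sub>C x)"
    using norm_unitization_scaleC_le[of "inverse c" "c *\<^sub>C x"] by simp
  then have "cmod c * norm x \<le> norm (c *\<^sub>C x)"
    using False by (simp add: norm_inverse norm_divide field_simps)
  then show ?thesis using norm_unitization_scaleC_le[of c x] by simp
qed

lemma norm_unitization_mult: "norm (x * y) \<le> norm x * norm y" for x y :: "'a unitization"
proof (rule norm_unitizationI)
  show "cmod (scal_part (x * y)) \<le> norm x * norm y"
    using mult_mono[OF scal_part_le[of x] scal_part_le[of y] norm_unitization_nonneg]
    by (simp add: unitization_ops norm_mult)
next
  fix b
  have "norm (left_mult (x * y) b) \<le> norm x * norm (left_mult y b)"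
    unfolding left_mult_mult by (rule norm_left_mult_le)
  also have "\<dots> \<le> norm x * (norm y * norm b)"
    by (intro mult_left_mono norm_left_mult_le norm_unitization_nonneg)
  finally show "norm (left_mult (x * y) b) \<le> norm x * norm y * norm b"
    by (simp add: mult.assoc)
qed

lemma norm_unitization_cstar_ge: "(norm x)\<^sup>2 \<le> norm (star x * x)" for x :: "'a unitization"
proof -
  let ?r = "norm (star x * x)"
  have r: "0 \<le> ?r" by (rule norm_unitization_nonneg)
  have "norm x \<le> sqrt ?r"
  proof (rule norm_unitizationI)
    have "(cmod (scal_part x))\<^sup>2 = cmod (scal_part (star x * x))"
      by (simp add: unitization_ops norm_mult power2_eq_square)
    also have "\<dots> \<le> ?r" by (rule scal_part_le)
    finally show "cmod (scal_part x) \<le> sqrt ?r" by (rule real_le_rsqrt)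
  next
    fix b
    have "(norm (left_mult x b))\<^sup>2 = norm (star (left_mult x b) * left_mult x b)"
      by (simp add: cstar_identity)
    also have "\<dots> = norm (star b * left_mult (star x * x) b)"
      by (simp add: star_left_mult_mult left_mult_mult)
    also have "\<dots> \<le> norm b * norm (left_mult (star x * x) b)"
      using norm_mult_ineq[of "star b"] by simp
    also have "\<dots> \<le> norm b * (?r * norm b)"
      by (intro mult_left_mono norm_left_mult_le) simp
    also have "\<dots> = (sqrt ?r * norm b)\<^sup>2"
      using r by (simp add: power_mult_distrib power2_eq_square)
    finally show "norm (left_mult x b) \<le> sqrt ?r * norm b"
      by (rule power2_le_imp_le) (use r in simp)
  qed
  then have "(norm x)\<^sup>2 \<le> (sqrt ?r)\<^sup>2"
    by (rule power_mono) (rule norm_unitization_nonneg)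
  then show ?thesis using r by simp
qed

lemma norm_unitization_star: "norm (star x) = norm x" for x :: "'a unitization"
proof -
  have le: "norm y \<le> norm (star y)" for y :: "'a unitization"
  proof (cases "norm y = 0")
    case False
    then have "0 < norm y" using norm_unitization_nonneg[of y] by simp
    moreover have "norm y * norm y \<le> norm (star y) * norm y"
      using norm_unitization_cstar_ge[of y] norm_unitization_mult[of "star y" y]
      by (simp add: power2_eq_square)
    ultimately show ?thesis by simp
  qed (simp add: norm_unitization_nonneg)
  have "star (star x) = x"
    by (simp add: unitization_ops star_star)
  then show ?thesis using le[of x] le[of "star x"] by simp
qed

instance
proof
  fix x y z :: "'a unitization" and r s :: real
    and U :: "'a unitization set"
  show "x + y + z = x + (y + z)" "x + y = y + x" "0 + x = x" "- x + x = 0" "x - y = x + - y"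
    by (simp_all add: unitization_ops)
  show "r *\<^sub>R (x + y) = r *\<^sub>R x + r *\<^sub>R y" "(r + s) *\<^sub>R x = r *\<^sub>R x + s *\<^sub>R x"
    "r *\<^sub>R s *\<^sub>R x = (r * s) *\<^sub>R x" "1 *\<^sub>R x = x"
    by (simp_all add: unitization_ops algebra_simps)
  have R: "r *\<^sub>R x = complex_of_real r *\<^sub>C x" for r and x :: "'a unitization"
    by (simp add: unitization_ops scaleR_scaleC scaleR_conv_of_real)
  show "x * y * z = x * (y * z)"
    by (simp add: unitization_ops distrib_left distrib_right scaleC_add_right scaleC_scaleC
        mult_scaleC_left mult_scaleC_right mult.assoc algebra_simps)
  show "(x + y) * z = x * z + y * z" "x * (y + z) = x * y + x * z"
    by (simp_all add: unitization_ops distrib_left distrib_right scaleC_add_right scaleC_add_left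
        algebra_simps)
  have C: "(c *\<^sub>C x) * y = c *\<^sub>C (x * y)" "x * (c *\<^sub>C y) = c *\<^sub>C (x * y)" for c
    by (simp_all add: unitization_ops scaleC_add_right scaleC_scaleC mult_scaleC_left
        mult_scaleC_right ac_simps)
  show "(r *\<^sub>R x) * y = r *\<^sub>R (x * y)" "x * (r *\<^sub>R y) = r *\<^sub>R (x * y)"
    by (simp_all add: R C)
  show "dist x y = norm (x - y)" by (rule dist_unitization_def)
  show "sgn x = inverse (norm x) *\<^sub>R x" by (rule sgn_unitization_def)
  show "uniformity = (INF e\<in>{0<..}. principal {(x, y :: 'a unitization). dist x y < e})"
    by (rule uniformity_unitization_def)
  show "open U \<longleftrightarrow> (\<forall>x\<in>U. \<forall>\<^sub>F (x', y) in uniformity. x' = x \<longrightarrow> y \<in> U)"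
    by (rule open_unitization_def)
  show "norm x = 0 \<longleftrightarrow> x = 0" by (rule norm_unitization_eq_0)
  show "norm (x + y) \<le> norm x + norm y" by (rule norm_unitization_triangle)
  show "norm (r *\<^sub>R x) = \<bar>r\<bar> * norm x" by (simp add: R norm_unitization_scaleC)
  show "norm (x * y) \<le> norm x * norm y" by (rule norm_unitization_mult)
qed

end

instance unitization :: (cstar_algebra) banach
proof
  fix X :: "nat \<Rightarrow> 'a unitization"
  assume "Cauchy X"
  then have X: "\<exists>M. \<forall>m\<ge>M. \<forall>n\<ge>M. norm (X m - X n) < e" if "e > 0" for e
    using that by (simp add: Cauchy_def dist_norm)
  have "Cauchy (\<lambda>n. alg_part (X n))"
    unfolding Cauchy_def
  proof (intro allI impI)
    fix e :: real assume "e > 0"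
    then obtain M where M: "\<forall>m\<ge>M. \<forall>n\<ge>M. norm (X m - X n) < e / 2"
      using X[of "e / 2"] by auto
    have "dist (alg_part (X m)) (alg_part (X n)) < e" if "m \<ge> M" "n \<ge> M" for m n
    proof -
      have "norm (alg_part (X m - X n)) < e"
        using norm_alg_part_le[of "X m - X n"] M that by fastforce
      then show ?thesis by (simp add: dist_norm unitization_ops)
    qed
    then show "\<exists>M. \<forall>m\<ge>M. \<forall>n\<ge>M. dist (alg_part (X m)) (alg_part (X n)) < e" by blast
  qed
  then obtain a where a: "(\<lambda>n. alg_part (X n)) \<longlonglongrightarrow> a"
    using Cauchy_convergent convergent_def by blast
  have "Cauchy (\<lambda>n. scal_part (X n))"
    unfolding Cauchy_def
  proof (intro allI impI)
    fix e :: real assume "e > 0"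
    then obtain M where M: "\<forall>m\<ge>M. \<forall>n\<ge>M. norm (X m - X n) < e"
      using X[of e] by blast
    have "dist (scal_part (X m)) (scal_part (X n)) < e" if "m \<ge> M" "n \<ge> M" for m n
    proof -
      have "cmod (scal_part (X m - X n)) < e"
        using scal_part_le[of "X m - X n"] M that by (meson le_less_trans)
      then show ?thesis by (simp add: dist_norm unitization_ops)
    qed
    then show "\<exists>M. \<forall>m\<ge>M. \<forall>n\<ge>M. dist (scal_part (X m)) (scal_part (X n)) < e" by blast
  qed
  then obtain c where c: "(\<lambda>n. scal_part (X n)) \<longlonglongrightarrow> c"
    using Cauchy_convergent convergent_def by blast
  have lim: "(\<lambda>n. norm (alg_part (X n) - a) + cmod (scal_part (X n) - c)) \<longlonglongrightarrow> 0"
    using tendsto_add[OF tendsto_norm_zero[OF LIM_zero[OF a]] tendsto_norm_zero[OF LIM_zero[OF c]]]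
    by simp
  have "X \<longlonglongrightarrow> Unitization a c"
  proof (rule metric_LIMSEQ_I)
    fix e :: real assume "e > 0"
    then obtain N where N: "\<forall>n\<ge>N. norm (alg_part (X n) - a) + cmod (scal_part (X n) - c) < e"
      using LIMSEQ_D[OF lim] by fastforce
    have "dist (X n) (Unitization a c) < e" if "n \<ge> N" for n
      using norm_unitization_le[of "X n - Unitization a c"] N that
      by (fastforce simp: dist_norm unitization_ops)
    then show "\<exists>N. \<forall>n\<ge>N. dist (X n) (Unitization a c) < e" by blast
  qed
  then show "convergent X" by (auto simp: convergent_def)
qed

instance unitization :: (cstar_algebra) cstar_algebra
proof
  fix x y :: "'a unitization" and r :: real and c d :: complex
  show "c *\<^sub>C (x + y) = c *\<^sub>C x + c *\<^sub>C y" "(c + d) *\<^sub>C x = c *\<^sub>C x + d *\<^sub>C x"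
    "c *\<^sub>C d *\<^sub>C x = (c * d) *\<^sub>C x" "1 *\<^sub>C x = x"
    by (simp_all add: unitization_ops scaleC_add_right scaleC_add_left scaleC_scaleC scaleC_one
        algebra_simps)
  show "r *\<^sub>R x = complex_of_real r *\<^sub>C x"
    by (simp add: unitization_ops scaleR_scaleC scaleR_conv_of_real)
  show "norm (c *\<^sub>C x) = cmod c * norm x" by (rule norm_unitization_scaleC)
  show "(c *\<^sub>C x) * y = c *\<^sub>C (x * y)" "x * (c *\<^sub>C y) = c *\<^sub>C (x * y)"
    by (simp_all add: unitization_ops scaleC_add_right scaleC_scaleC mult_scaleC_left
        mult_scaleC_right ac_simps)
  show "star (x + y) = star x + star y" "star (c *\<^sub>C x) = cnj c *\<^sub>C star x" "star (star x) = x"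
    by (simp_all add: unitization_ops star_add star_scaleC star_star)
  show "star (x * y) = star y * star x"
    by (simp add: unitization_ops star_add star_scaleC star_mult ac_simps)
  show "norm (star x * x) = (norm x)\<^sup>2"
    using norm_unitization_cstar_ge[of x] norm_unitization_mult[of "star x" x]
    by (simp add: norm_unitization_star power2_eq_square)
qed

lemma norm_unitization_nonunital:
  fixes x :: "'a::cstar_algebra unitization"
  assumes "\<not> unital_algebra TYPE('a)"
  shows "norm x = onorm (left_mult x)"
proof (rule ccontr)
  assume "norm x \<noteq> onorm (left_mult x)"
  then have less: "onorm (left_mult x) < cmod (scal_part x)"
    by (auto simp: norm_unitization_def max_def split: if_splits)
  define l where "l = scal_part x"
  have l: "l \<noteq> 0" using less onorm_left_mult_nonneg[of x] by (auto simp: l_def)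
  define y where "y = inverse l *\<^sub>C x"
  define a where "a = - alg_part y"
  define k where "k = onorm (left_mult x) / cmod l"
  have k: "0 \<le> k" "k < 1"
    using less onorm_left_mult_nonneg[of x] l by (simp_all add: k_def l_def)
  have ly: "left_mult y b = b - a * b" for b
    using l by (simp add: left_mult_def a_def y_def scaleC_unitization_def l_def scaleC_one)
  have nb: "norm (b - a * b) \<le> k * norm b" for b
  proof -
    have "norm (left_mult y b) = norm (left_mult x b) / cmod l"
      by (simp add: y_def left_mult_scaleC norm_scaleC norm_inverse divide_inverse mult.commute)
    also have "\<dots> \<le> onorm (left_mult x) * norm b / cmod l"
      by (intro divide_right_mono norm_left_mult) simp
    finally show ?thesis by (simp add: ly k_def)
  qed
  have "\<exists>!b. a + (b - a * b) = b"
  proof (rule banach_fix_type[OF k])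
    show "\<forall>b c. dist (a + (b - a * b)) (a + (c - a * c)) \<le> k * dist b c"
    proof (intro allI)
      fix b c
      have "a + (b - a * b) - (a + (c - a * c)) = (b - c) - a * (b - c)"
        by (simp add: algebra_simps)
      then show "dist (a + (b - a * b)) (a + (c - a * c)) \<le> k * dist b c"
        unfolding dist_norm by (simp only: nb)
    qed
  qed
  then obtain e where "a + (e - a * e) = e" by blast
  then have e: "a * e = a" by (simp add: algebra_simps)
  have left: "e * b = b" for b
  proof -
    have "a * (e * b - b) = 0" by (simp add: right_diff_distrib e flip: mult.assoc)
    then have "norm (e * b - b) \<le> k * norm (e * b - b)" using nb[of "e * b - b"] by simp
    then have "norm (e * b - b) = 0"
      using k mult_left_le_one_le[of "norm (e * b - b)" k]
      by (smt (verit) mult_less_cancel_right2 norm_ge_zero)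
    then show ?thesis by simp
  qed
  have right: "b * star e = b" for b
    using left[of "star b"] by (metis star_mult star_star)
  have "e = star e" using left[of "star e"] right[of e] by simp
  then have "unital_algebra TYPE('a)"
    unfolding unital_algebra_def using left right by metis
  with assms show False by simp
qed

lemma unital_unitization: "unital_algebra TYPE('a::cstar_algebra unitization)"
  unfolding unital_algebra_def
  by (rule exI[of _ "Unitization 0 1"]) (simp add: times_unitization_def scaleC_one)

lemma inclusion_unitization_set:
  assumes "inclusion D"
  shows "inclusion (unitization_set D)"
proof -
  have D: "complex_vector.subspace D" "closed D"
    "\<And>x y. x \<in> D \<Longrightarrow> y \<in> D \<Longrightarrow> x * y \<in> D" "\<And>x. x \<in> D \<Longrightarrow> star x \<in> D"
    "\<And>x y. x \<in> D \<Longrightarrow> y \<in> D \<Longrightarrow> x * y = y * x"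
    using assms by (auto simp: inclusion_def cstar_subalgebra_def abelian_def)
  have eq: "unitization_set D = {x. alg_part x \<in> D}"
    by (force simp: unitization_set_def intro: unitization.collapse[symmetric])
  have lin: "bounded_linear (alg_part :: 'a unitization \<Rightarrow> 'a)"
    by (rule bounded_linear_intro[where K = 2])
      (simp_all add: unitization_ops norm_alg_part_le mult.commute[of _ 2])
  have "closed (unitization_set D)"
    unfolding eq using closed_vimage[OF D(2), of alg_part] lin
    by (simp add: vimage_def linear_continuous_on continuous_on_eq_continuous_within
        linear_continuous_within)
  moreover have "complex_vector.subspace (unitization_set D)"
    using D(1) by (simp add: eq complex_vector.subspace_def unitization_ops)
  ultimately show ?thesis
    using D(1,3-5)
    by (auto simp: inclusion_def cstar_subalgebra_def abelian_def eq unitization_ops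
        complex_vector.subspace_add complex_vector.subspace_scale ac_simps)
qed

end

theory Submission
  imports Defs
begin

text \<open>
  Characters of a commutative C*-algebra are obtained without Gelfand's theory, from maximal
  preorderings of the self-adjoint part of its unitization, and are identified with the pure
  states.  Positivity in the noncommutative algebra \<open>A\<close> is needed only for elements \<open>b\<^sup>*b\<close> that lie
  in \<open>D\<close>, where the expectation reduces it to positivity in \<open>D\<close>.

  For a normalizer \<open>n\<close> one has \<open>n\<^sup>*n D \<subseteq> D\<close>.  If \<open>n\<^sup>2 = 0\<close>, then \<open>n\<^sup>*n\<close> and \<open>n n\<^sup>*\<close> are orthogonal.
  Hence \<open>P (x n) = 0\<close> for all \<open>x\<close> commuting with \<open>D\<close>, and every state extending a character of \<open>D\<close>
  vanishes at \<open>n\<close>; by density, Kumjian's conditions give maximality of \<open>D\<close> and unique extension.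

  Conversely, for a normalizer \<open>n\<close> the elements \<open>e \<in> D\<close> with \<open>(n - P n) e\<close> in the closed span of the
  free normalizers form a closed ideal.  It contains \<open>n\<^sup>*n\<close>, since no character \<open>\<sigma>\<close> with
  \<open>\<sigma> (n\<^sup>*n) \<noteq> 0\<close> vanishes on it: if \<open>n\<close> moves \<open>\<sigma>\<close>, then \<open>n e\<close> is a free normalizer for some \<open>e\<close> with
  \<open>\<sigma> e \<noteq> 0\<close>; if \<open>n\<close> fixes \<open>\<sigma>\<close>, then unique extension yields \<open>\<bar>\<sigma> (P n)\<bar>\<^sup>2 = \<sigma> (n\<^sup>*n)\<close>, and
  \<open>(n - P n) P n = 0\<close> by faithfulness.
\<close>

section \<open>Elementary facts and square roots\<close>

declare star_star [simp] scaleC_one [simp]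

lemma star_minus: "star (- x) = - star (x::'a::cstar_algebra)"
  using star_scaleC[of "-1" x] by simp

lemma star_diff: "star (x - y) = star x - star (y::'a::cstar_algebra)"
  using star_add[of x "- y"] by (simp add: star_minus)

lemma star_scaleR: "star (r *\<^sub>R x) = r *\<^sub>R star (x::'a::cstar_algebra)"
  by (simp add: scaleR_scaleC star_scaleC)

lemma star_mult_self_eq_0: "star x * x = 0 \<longleftrightarrow> x = (0::'a::cstar_algebra)"
  using cstar_identity[of x] by auto

lemma mult_star_self_eq_0: "x * star x = 0 \<longleftrightarrow> x = (0::'a::cstar_algebra)"
  using norm_mult_star[of x] by auto

lemma bounded_linear_star: "bounded_linear (star :: 'a::cstar_algebra \<Rightarrow> 'a)"
  by (rule bounded_linear_intro[where K = 1]) (simp_all add: star_add star_scaleR)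

lemmas tendsto_star = bounded_linear.tendsto[OF bounded_linear_star]

lemma bounded_linear_scaleC: "bounded_linear (scaleC c :: 'a::cstar_algebra \<Rightarrow> 'a)"
  by (rule bounded_linear_intro[where K = "cmod c"])
    (simp_all add: scaleC_add_right norm_scaleC scaleR_scaleC scaleC_scaleC mult.commute)

lemmas tendsto_scaleC = bounded_linear.tendsto[OF bounded_linear_scaleC]

lemma closed_kernel: "bounded_linear f \<Longrightarrow> closed {x. f x = 0}"
  by (intro closed_Collect_eq linear_continuous_on continuous_on_const)

lemma complex_subspace_closure:
  fixes S :: "'a::cstar_algebra set"
  assumes S: "complex_vector.subspace S"
  shows "complex_vector.subspace (closure S)"
proof (rule complex_vector.subspaceI)
  show "0 \<in> closure S"
    using complex_vector.subspace_0[OF S] closure_subset by blast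
next
  fix x y assume "x \<in> closure S" "y \<in> closure S"
  then obtain f g where f: "\<And>n. f n \<in> S" "f \<longlonglongrightarrow> x" and g: "\<And>n. g n \<in> S" "g \<longlonglongrightarrow> y"
    unfolding closure_sequential by blast
  have "(\<lambda>n. f n + g n) \<longlonglongrightarrow> x + y" using f(2) g(2) by (rule tendsto_add)
  then show "x + y \<in> closure S"
    unfolding closure_sequential using complex_vector.subspace_add[OF S f(1) g(1)]
    by (intro exI[of _ "\<lambda>n. f n + g n"]) auto
next
  fix c x assume "x \<in> closure S"
  then obtain f where f: "\<And>n. f n \<in> S" "f \<longlonglongrightarrow> x"
    unfolding closure_sequential by blast
  have "(\<lambda>n. c *\<^sub>C f n) \<longlonglongrightarrow> c *\<^sub>C x" using f(2) by (rule tendsto_scaleC)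
  then show "c *\<^sub>C x \<in> closure S"
    unfolding closure_sequential using complex_vector.subspace_scale[OF S f(1)]
    by (intro exI[of _ "\<lambda>n. c *\<^sub>C f n"]) auto
qed

lemma closure_span_subset:
  fixes S :: "'a::cstar_algebra set"
  assumes "S \<subseteq> T" "complex_vector.subspace T" "closed T"
  shows "closure (complex_vector.span S) \<subseteq> T"
  using assms by (intro closure_minimal complex_vector.span_minimal)

lemma subset_closure_span: "S \<subseteq> closure (complex_vector.span (S :: 'a::cstar_algebra set))"
  using complex_vector.span_superset closure_subset by blast

lemma subspace_closure_span:
  "complex_vector.subspace (closure (complex_vector.span (S :: 'a::cstar_algebra set)))"
  by (intro complex_subspace_closure complex_vector.subspace_span)

text \<open>
  A fixed point of \<open>y \<mapsto> (x + y\<^sup>2) / 2\<close> satisfies \<open>(1 - y)\<^sup>2 = 1 - x\<close>; in this form square roots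
  need no unit.  The increments of the iteration are dominated by those of the scalar
  iteration for \<open>x = 1\<close>.
\<close>

primrec sqrt_iter :: "'a::cstar_algebra \<Rightarrow> nat \<Rightarrow> 'a" where
  "sqrt_iter x 0 = 0"
| "sqrt_iter x (Suc n) = (1/2) *\<^sub>R (x + sqrt_iter x n * sqrt_iter x n)"

primrec sqrt_iter_bound :: "nat \<Rightarrow> real" where
  "sqrt_iter_bound 0 = 0"
| "sqrt_iter_bound (Suc n) = (1 + (sqrt_iter_bound n)\<^sup>2) / 2"

lemma sqrt_iter_bound_range: "0 \<le> sqrt_iter_bound n \<and> sqrt_iter_bound n \<le> 1"
  by (induction n) (simp_all add: power_le_one)

lemma sqrt_iter_bound_Suc: "sqrt_iter_bound n \<le> sqrt_iter_bound (Suc n)"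
proof -
  have "0 \<le> (1 - sqrt_iter_bound n)\<^sup>2" by simp
  then show ?thesis by (simp add: power2_diff)
qed

lemma convergent_sqrt_iter_bound: "convergent sqrt_iter_bound"
proof (rule Bseq_mono_convergent)
  show "Bseq sqrt_iter_bound"
    using sqrt_iter_bound_range by (intro BseqI'[where K = 1]) simp
  show "\<forall>m n. m \<le> n \<longrightarrow> sqrt_iter_bound m \<le> sqrt_iter_bound n"
    using sqrt_iter_bound_Suc lift_Suc_mono_le by blast
qed

lemma sqrt_iter_commute: "z * x = x * z \<Longrightarrow> z * sqrt_iter x n = sqrt_iter x n * z"
proof (induction n)
  case (Suc n)
  have "z * (sqrt_iter x n * sqrt_iter x n) = sqrt_iter x n * sqrt_iter x n * z"
    using Suc by (metis mult.assoc)
  then show ?case using Suc.prems by (simp add: algebra_simps)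
qed simp

lemma sqrt_iter_commute_self: "sqrt_iter x m * sqrt_iter x n = sqrt_iter x n * sqrt_iter x m"
  by (intro sqrt_iter_commute sqrt_iter_commute[symmetric]) simp

lemma norm_sqrt_iter: "norm x \<le> 1 \<Longrightarrow> norm (sqrt_iter x n) \<le> sqrt_iter_bound n"
proof (induction n)
  case (Suc n)
  have "norm (x + sqrt_iter x n * sqrt_iter x n) \<le> norm x + norm (sqrt_iter x n) * norm (sqrt_iter x n)"
    by (intro norm_triangle_le add_left_mono norm_mult_ineq)
  also have "\<dots> \<le> 1 + sqrt_iter_bound n * sqrt_iter_bound n"
    using Suc sqrt_iter_bound_range by (intro add_mono mult_mono) auto
  finally show ?case by (simp add: power2_eq_square)
qed simp

lemma sqrt_iter_diff:
  assumes "norm x \<le> 1"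
  shows "norm (sqrt_iter x (Suc n) - sqrt_iter x n) \<le> sqrt_iter_bound (Suc n) - sqrt_iter_bound n"
proof (induction n)
  case 0
  then show ?case using assms by simp
next
  case (Suc n)
  let ?y = "sqrt_iter x" and ?s = sqrt_iter_bound
  have "?y (Suc (Suc n)) - ?y (Suc n) =
      (1/2) *\<^sub>R ((?y (Suc n) - ?y n) * (?y (Suc n) + ?y n))"
    using sqrt_iter_commute_self[of x "Suc n" n]
    by (simp add: algebra_simps del: sqrt_iter.simps)
      (simp only: sqrt_iter.simps scaleR_add_right, simp)
  also have "norm \<dots> \<le> (1/2) * (norm (?y (Suc n) - ?y n) * norm (?y (Suc n) + ?y n))"
    using norm_mult_ineq by simp
  also have "\<dots> \<le> (1/2) * ((?s (Suc n) - ?s n) * (?s (Suc n) + ?s n))"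
    using Suc sqrt_iter_bound_range sqrt_iter_bound_Suc[of n] assms
    by (intro mult_left_mono mult_mono norm_triangle_le add_mono norm_sqrt_iter) auto
  also have "\<dots> = ?s (Suc (Suc n)) - ?s (Suc n)"
    by (simp add: power2_eq_square field_simps)
  finally show ?case .
qed

lemma cstar_sqrt:
  fixes x :: "'a::cstar_algebra"
  assumes sx: "star x = x" and nx: "norm x \<le> 1"
  obtains y where "star y = y" "norm y \<le> 1" "y + y - y * y = x"
    "\<And>S. cstar_subalgebra S \<Longrightarrow> x \<in> S \<Longrightarrow> y \<in> S"
proof -
  let ?y = "sqrt_iter x" and ?s = sqrt_iter_bound
  have le: "norm (?y (n + k) - ?y n) \<le> ?s (n + k) - ?s n" for n k
  proof (induction k)
    case (Suc k)
    have "norm (?y (n + Suc k) - ?y n) \<le>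
        norm (?y (Suc (n + k)) - ?y (n + k)) + norm (?y (n + k) - ?y n)"
      using norm_triangle_ineq[of "?y (Suc (n + k)) - ?y (n + k)" "?y (n + k) - ?y n"]
      by (simp del: sqrt_iter.simps)
    also have "\<dots> \<le> ?s (n + Suc k) - ?s n"
      using Suc sqrt_iter_diff[OF nx, of "n + k"] by (simp del: sqrt_iter.simps sqrt_iter_bound.simps)
    finally show ?case .
  qed simp
  have "Cauchy ?y"
  proof (rule CauchyI')
    fix e :: real assume "e > 0"
    have "Cauchy ?s" using convergent_sqrt_iter_bound by (rule convergent_Cauchy)
    then obtain M where M: "\<forall>m\<ge>M. \<forall>n\<ge>M. norm (?s m - ?s n) < e"
      using \<open>e > 0\<close> CauchyD by blast
    have "norm (?y m - ?y n) < e" if "m \<ge> M" "n > m" for m n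
    proof -
      have "norm (?y n - ?y m) \<le> ?s n - ?s m"
        using le[of m "n - m"] that by simp
      also have "\<dots> < e" using M that by (metis abs_ge_self le_less_trans less_imp_le order_trans real_norm_def)
      finally show ?thesis by (simp add: norm_minus_commute)
    qed
    then show "\<exists>M. \<forall>m\<ge>M. \<forall>n>m. dist (?y m) (?y n) < e" unfolding dist_norm by blast
  qed
  then obtain y where y: "?y \<longlonglongrightarrow> y"
    using Cauchy_convergent convergent_def by blast
  have "(\<lambda>n. ?y (Suc n)) \<longlonglongrightarrow> (1/2) *\<^sub>R (x + y * y)"
    unfolding sqrt_iter.simps by (intro tendsto_intros y)
  moreover have "(\<lambda>n. ?y (Suc n)) \<longlonglongrightarrow> y" using y by (rule LIMSEQ_Suc)
  ultimately have "y = (1/2) *\<^sub>R (x + y * y)" by (metis LIMSEQ_unique)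
  then have "y + y = 2 *\<^sub>R ((1/2) *\<^sub>R (x + y * y))" by (metis scaleR_2)
  then have eq: "y + y - y * y = x" by (simp add: scaleR_2)
  have "star (?y n) = ?y n" for n
    by (induction n) (simp_all add: star_add star_scaleR star_mult sx)
  then have "star y = y"
    using tendsto_star[OF y] y LIMSEQ_unique by auto
  moreover have "norm y \<le> 1"
    using tendsto_norm[OF y] norm_sqrt_iter[OF nx] sqrt_iter_bound_range
    by (meson LIMSEQ_le_const2 order_trans)
  moreover have "y \<in> S" if S: "cstar_subalgebra S" "x \<in> S" for S
  proof -
    have "?y n \<in> S" for n
      using S by (induction n) (auto simp: cstar_subalgebra_def complex_vector.subspace_0
          scaleR_scaleC intro!: complex_vector.subspace_add complex_vector.subspace_scale)
    then show ?thesis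
      using S y unfolding cstar_subalgebra_def by (meson closed_sequentially)
  qed
  ultimately show ?thesis using that eq by blast
qed

section \<open>The cone of squares of a commutative C*-algebra\<close>

locale comm_cstar =
  fixes D :: "'a::cstar_algebra set"
  assumes inclusion: "inclusion D"
begin

lemma cstar_subalgebra: "cstar_subalgebra D"
  using inclusion by (simp add: inclusion_def)

lemma subspace: "complex_vector.subspace D"
  and closed: "closed D"
  using cstar_subalgebra by (simp_all add: cstar_subalgebra_def)

lemma mem_mult [simp]: "x \<in> D \<Longrightarrow> y \<in> D \<Longrightarrow> x * y \<in> D"
  and mem_star [simp]: "x \<in> D \<Longrightarrow> star x \<in> D"
  using cstar_subalgebra by (auto simp: cstar_subalgebra_def)

lemma mem_zero [simp]: "0 \<in> D"
  and mem_add [simp]: "x \<in> D \<Longrightarrow> y \<in> D \<Longrightarrow> x + y \<in> D"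
  and mem_diff [simp]: "x \<in> D \<Longrightarrow> y \<in> D \<Longrightarrow> x - y \<in> D"
  and mem_minus [simp]: "x \<in> D \<Longrightarrow> - x \<in> D"
  and mem_scaleC [simp]: "x \<in> D \<Longrightarrow> c *\<^sub>C x \<in> D"
  using subspace
  by (auto intro: complex_vector.subspace_0 complex_vector.subspace_add
      complex_vector.subspace_diff complex_vector.subspace_neg complex_vector.subspace_scale)

lemma mem_scaleR [simp]: "x \<in> D \<Longrightarrow> r *\<^sub>R x \<in> D"
  by (simp add: scaleR_scaleC)

lemma comm: "x \<in> D \<Longrightarrow> y \<in> D \<Longrightarrow> x * y = y * x"
  using inclusion by (auto simp: inclusion_def abelian_def)

lemma left_comm: "x \<in> D \<Longrightarrow> y \<in> D \<Longrightarrow> x * (y * z) = y * (x * z)"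
  by (metis comm mult.assoc)

lemmas comm_ac = comm left_comm mult.assoc

lemma mem_limit: "(\<And>n. f n \<in> D) \<Longrightarrow> f \<longlonglongrightarrow> x \<Longrightarrow> x \<in> D" for f :: "nat \<Rightarrow> 'a"
  using closed closed_sequentially by blast

lemma square_cartesian:
  assumes "c \<in> D" "d \<in> D" "star c = c" "star d = d"
  shows "star (c + \<i> *\<^sub>C d) = c - \<i> *\<^sub>C d"
    and "star (c + \<i> *\<^sub>C d) * (c + \<i> *\<^sub>C d) = c * c + d * d"
proof -
  show star: "star (c + \<i> *\<^sub>C d) = c - \<i> *\<^sub>C d"
    using assms by (simp add: star_add star_scaleC complex_vector.scale_minus_left)
  show "star (c + \<i> *\<^sub>C d) * (c + \<i> *\<^sub>C d) = c * c + d * d"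
    unfolding star using assms
    by (simp add: algebra_simps mult_scaleC_left mult_scaleC_right scaleC_scaleC comm
        complex_vector.scale_minus_left)
qed

lemma cartesian_decomposition:
  assumes x: "x \<in> D"
  obtains a b where "a \<in> D" "b \<in> D" "star a = a" "star b = b" "x = a + \<i> *\<^sub>C b" "norm b \<le> norm x"
proof -
  define a b where "a = (1/2) *\<^sub>C (x + star x)" and "b = (-\<i>/2) *\<^sub>C (x - star x)"
  have D: "a \<in> D" "b \<in> D" "star a = a" "star b = b"
    using x by (simp_all add: a_def b_def star_add star_scaleC star_diff
        add.commute complex_vector.scale_right_diff_distrib complex_vector.scale_minus_left)
  have "(1/2) *\<^sub>C z + (1/2) *\<^sub>C z = z" for z :: 'a by (simp flip: scaleC_add_left)
  then have "x = a + \<i> *\<^sub>C b"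
    by (simp add: a_def b_def scaleC_scaleC scaleC_add_right
        complex_vector.scale_right_diff_distrib algebra_simps)
  moreover have "norm b \<le> norm x"
    using norm_triangle_ineq4[of x "star x"] by (simp add: b_def norm_scaleC norm_divide)
  ultimately show ?thesis using D that by simp
qed

lemma norm_le_of_sum_squares:
  assumes D: "c \<in> D" "d \<in> D" and s: "star c = c" "star d = d" "star v = v"
    and eq: "c * c + d * d = v * v"
  shows "norm c \<le> norm v"
proof -
  define u where "u = c + \<i> *\<^sub>C d"
  note su = square_cartesian(1)[OF D s(1,2), folded u_def]
  have "star u * u = c * c + d * d" unfolding u_def by (rule square_cartesian(2)[OF D s(1,2)])
  then have "(norm u)\<^sup>2 = (norm v)\<^sup>2"
    using cstar_identity[of u] cstar_identity[of v] s eq by simp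
  then have "norm u = norm v" by simp
  have "c = (1/2) *\<^sub>R (u + star u)"
    unfolding su by (simp add: u_def flip: scaleR_2)
  also have "norm \<dots> \<le> (1/2) * (norm u + norm (star u))"
    using norm_triangle_ineq[of u "star u"] by simp
  finally show ?thesis using \<open>norm u = norm v\<close> by simp
qed

end

lemma star_one [simp]: "star 1 = (1 :: 'a::{cstar_algebra,real_normed_algebra_1})"
  by (metis mult_1 star_star star_mult mult_1_right)

lemma star_of_real [simp]: "star (of_real r) = (of_real r :: 'a::{cstar_algebra,real_normed_algebra_1})"
  by (simp add: of_real_def star_scaleR)

locale unital_comm_cstar = comm_cstar D
  for D :: "'b::{cstar_algebra,real_normed_algebra_1} set" +
  assumes mem_one [simp]: "1 \<in> D"
begin

lemma mem_of_real [simp]: "of_real r \<in> D"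
  by (simp add: of_real_def)

definition cone :: "'b set" where
  "cone = {star b * b | b. b \<in> D}"

lemma coneI [intro]: "b \<in> D \<Longrightarrow> star b * b \<in> cone"
  by (auto simp: cone_def)

lemma cone_subset: "p \<in> cone \<Longrightarrow> p \<in> D"
  and star_cone: "p \<in> cone \<Longrightarrow> star p = p"
  by (auto simp: cone_def star_mult)

lemma square_root:
  assumes "x \<in> D" "star x = x" "norm x \<le> r"
  obtains w where "w \<in> D" "star w = w" "of_real r - x = w * w"
proof (cases "r = 0")
  case True
  then show ?thesis using assms that[of 0] by simp
next
  case False
  then have r: "r > 0" using assms(3) norm_ge_zero[of x] by linarith
  have "star ((1/r) *\<^sub>R x) = (1/r) *\<^sub>R x" "norm ((1/r) *\<^sub>R x) \<le> 1"
    using assms r by (simp_all add: star_scaleR)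
  then obtain y where y: "star y = y" "y + y - y * y = (1/r) *\<^sub>R x"
    "\<And>S. cstar_subalgebra S \<Longrightarrow> (1/r) *\<^sub>R x \<in> S \<Longrightarrow> y \<in> S"
    by (rule cstar_sqrt) blast
  have yD: "y \<in> D" using y(3)[OF cstar_subalgebra] assms by simp
  have "of_real r - x = r *\<^sub>R (1 - (1/r) *\<^sub>R x)"
    using r by (simp add: of_real_def algebra_simps)
  also have "\<dots> = (sqrt r *\<^sub>R (1 - y)) * (sqrt r *\<^sub>R (1 - y))"
    using r by (simp add: algebra_simps flip: y(2))
  finally show ?thesis
    using that[of "sqrt r *\<^sub>R (1 - y)"] yD y(1) by (simp add: star_scaleR star_diff)
qed

lemma cone_of_norm_le:
  assumes "x \<in> D" "star x = x" "norm x \<le> r"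
  shows "of_real r - x \<in> cone"
  using square_root[OF assms] coneI by metis

lemma norm_diff_cone:
  assumes p: "p \<in> cone" and s: "norm p \<le> s"
  shows "norm (of_real s - p) \<le> s"
proof -
  obtain a where a: "a \<in> D" "p = star a * a" using p by (auto simp: cone_def)
  obtain a1 a2 where D: "a1 \<in> D" "a2 \<in> D" "star a1 = a1" "star a2 = a2"
    and a12: "a = a1 + \<i> *\<^sub>C a2" and na2: "norm a2 \<le> norm a"
    using cartesian_decomposition[OF a(1)] by metis
  have p_eq: "p = a1 * a1 + a2 * a2" unfolding a(2) a12 by (rule square_cartesian(2)[OF D])
  have s0: "0 \<le> s" using s norm_ge_zero order_trans by blast
  obtain w where w: "w \<in> D" "star w = w" "of_real s - p = w * w"
    using square_root[OF cone_subset[OF p] star_cone[OF p] s] by blast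
  have na: "norm a * norm a \<le> s"
    using s a cstar_identity[of a] by (simp add: power2_eq_square)
  have "norm (a2 * a2) \<le> s"
    using na na2 mult_mono[of "norm a2" "norm a" "norm a2" "norm a"] norm_mult_ineq[of a2 a2]
    by simp
  then obtain v where v: "v \<in> D" "star v = v" "of_real s - a2 * a2 = v * v"
    using square_root[of "a2 * a2" s] D by (auto simp: star_mult)
  have "norm v \<le> norm (of_real (sqrt s) :: 'b)"
  proof (rule norm_le_of_sum_squares)
    show "v * v + a2 * a2 = of_real (sqrt s) * of_real (sqrt s)"
      using s0 by (simp flip: v(3) of_real_mult)
  qed (use v D in simp_all)
  then have nv: "norm v \<le> sqrt s" using s0 by simp
  have "norm w \<le> norm v"
  proof (rule norm_le_of_sum_squares)
    show "w * w + a1 * a1 = v * v"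
      using w(3) v(3) p_eq by (simp add: algebra_simps)
  qed (use w v D in simp_all)
  then have "norm w * norm w \<le> sqrt s * sqrt s" using nv s0 by (intro mult_mono) auto
  then show ?thesis
    unfolding w(3) using norm_mult_ineq[of w w] s0 by simp
qed

lemma cone_add:
  assumes "p \<in> cone" "q \<in> cone" shows "p + q \<in> cone"
proof -
  have "of_real (norm p + norm q) - ((of_real (norm p) - p) + (of_real (norm q) - q)) \<in> cone"
    using assms norm_diff_cone[OF assms(1)] norm_diff_cone[OF assms(2)]
    by (intro cone_of_norm_le norm_triangle_le add_mono)
      (auto simp: star_diff star_add star_cone cone_subset)
  then show ?thesis by (simp add: add.commute)
qed

lemma cone_mult:
  assumes "p \<in> cone" "q \<in> cone" shows "p * q \<in> cone"
proof -
  obtain a b where "a \<in> D" "p = star a * a" "b \<in> D" "q = star b * b"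
    using assms by (auto simp: cone_def)
  then have "p * q = star (a * b) * (a * b)" "a * b \<in> D"
    by (simp_all add: star_mult comm_ac)
  then show ?thesis by auto
qed

lemma cone_of_real: "0 \<le> r \<Longrightarrow> of_real r \<in> cone"
  using coneI[of "of_real (sqrt r)"] by (simp flip: of_real_mult)

lemma cone_scaleR: "0 \<le> r \<Longrightarrow> p \<in> cone \<Longrightarrow> r *\<^sub>R p \<in> cone"
  using cone_mult[OF cone_of_real] by (simp add: scaleR_conv_of_real)

lemma cone_sqrt:
  assumes p: "p \<in> cone"
  obtains c where "c \<in> cone" "p = c * c"
proof (cases "p = 0")
  case True
  then show ?thesis using that[of 0] p by simp
next
  case False
  define r where "r = norm p"
  have r: "r > 0" using False by (simp add: r_def)
  define x where "x = (1/r) *\<^sub>R (of_real r - p)"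
  have x: "x \<in> D" "star x = x" "norm x \<le> 1"
    using p r norm_diff_cone[OF p, of r]
    by (simp_all add: x_def r_def star_scaleR star_diff star_cone cone_subset)
  obtain y where y: "star y = y" "norm y \<le> 1" "y + y - y * y = x"
    "\<And>S. cstar_subalgebra S \<Longrightarrow> x \<in> S \<Longrightarrow> y \<in> S"
    by (rule cstar_sqrt[OF x(2,3)]) (rule that)
  have "of_real 1 - y \<in> cone"
    using y(1,2) y(4)[OF cstar_subalgebra x(1)] by (intro cone_of_norm_le)
  then have "sqrt r *\<^sub>R (1 - y) \<in> cone" using r by (intro cone_scaleR) simp_all
  moreover have "r *\<^sub>R x = of_real r - p" using r by (simp add: x_def)
  then have "p = r *\<^sub>R (1 - x)" by (simp add: scaleR_right_diff_distrib of_real_def)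
  then have "p = (sqrt r *\<^sub>R (1 - y)) * (sqrt r *\<^sub>R (1 - y))"
    using r by (simp add: algebra_simps flip: y(3))
  ultimately show ?thesis by (rule that)
qed

lemma norm_le_of_cone_sum:
  assumes "p \<in> cone" "q \<in> cone" "p + q = of_real r" "0 \<le> r"
  shows "norm p \<le> r"
proof -
  obtain c d where c: "c \<in> cone" "p = c * c" and d: "d \<in> cone" "q = d * d"
    using assms cone_sqrt by metis
  have "norm c \<le> norm (of_real (sqrt r) :: 'b)"
    using c d assms by (intro norm_le_of_sum_squares[of c d])
      (simp_all add: cone_subset star_cone flip: of_real_mult)
  then have "norm c * norm c \<le> sqrt r * sqrt r" using assms by (intro mult_mono) auto
  then show ?thesis unfolding c(2) using norm_mult_ineq[of c c] assms by simp
qed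

lemma cone_inverse:
  assumes p: "p \<in> cone" and r: "0 < r"
  obtains w where "w \<in> cone" "(of_real r + p) * w = 1"
proof -
  define s where "s = r + norm p"
  have s: "s > 0" using r by (simp add: s_def add_pos_nonneg)
  define x where "x = (1/s) *\<^sub>R (of_real (norm p) - p)"
  have xD: "x \<in> D" using p cone_subset by (simp add: x_def)
  have "norm x \<le> norm p / s"
    using norm_diff_cone[OF p, of "norm p"] s by (simp add: x_def divide_right_mono)
  also have "\<dots> < 1" using s r by (simp add: s_def)
  finally have nx: "norm x < 1" .
  have "\<exists>!y\<in>D. 1 + x * y = y"
  proof (rule Banach_fix)
    show "complete D" using closed by (simp add: complete_eq_closed)
    show "D \<noteq> {}" using mem_zero by blast
    show "0 \<le> norm x" "norm x < 1" using nx by simp_all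
    show "(\<lambda>y. 1 + x * y) ` D \<subseteq> D" using xD by auto
    fix y z assume "y \<in> D" "z \<in> D"
    then show "dist (1 + x * y) (1 + x * z) \<le> norm x * dist y z"
      using norm_mult_ineq[of x "y - z"] by (simp add: dist_norm right_diff_distrib)
  qed
  then obtain y where y: "y \<in> D" "1 + x * y = y" by blast
  define w where "w = (1/s) *\<^sub>R y"
  have wD: "w \<in> D" using y by (simp add: w_def)
  have "s *\<^sub>R x = of_real (norm p) - p" using s by (simp add: x_def)
  then have eq: "of_real r + p = s *\<^sub>R (1 - x)"
    by (simp add: s_def of_real_def algebra_simps)
  have "(1 - x) * y = 1" using y(2) by (simp add: algebra_simps)
  then have w: "(of_real r + p) * w = 1"
    using s by (simp add: eq w_def)
  have q: "of_real r + p \<in> cone" using cone_add[OF cone_of_real p] r by simp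
  have sw: "star w * (of_real r + p) = 1"
    using arg_cong[OF w, of star] star_cone[OF q] by (simp add: star_mult)
  have "star w = w"
    using sw w by (metis mult.assoc mult_1 mult_1_right)
  then have "w = star w * w * (of_real r + p)"
    using w wD q comm[of w "of_real r + p"] cone_subset[of "of_real r + p"]
    by (simp add: mult.assoc)
  moreover have "star w * w * (of_real r + p) \<in> cone"
    using cone_mult[OF coneI[OF wD] q] .
  ultimately show ?thesis using that w by metis
qed

end

section \<open>Total preorderings and characters\<close>

context unital_comm_cstar
begin

definition preordering :: "'b set \<Rightarrow> bool" where
  "preordering T \<longleftrightarrow> T \<subseteq> {x \<in> D. star x = x} \<and> cone \<subseteq> T \<and>
     (\<forall>x\<in>T. \<forall>y\<in>T. x + y \<in> T \<and> x * y \<in> T) \<and> - 1 \<notin> T"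

lemma preordering_adjoin:
  assumes T: "preordering T" and max: "\<And>X. preordering X \<Longrightarrow> T \<subseteq> X \<Longrightarrow> X = T"
    and a: "a \<in> D" "star a = a" "a \<notin> T"
  obtains s t where "s \<in> T" "t \<in> T" "a * t = - (1 + s)"
proof -
  define X where "X = {s + a * t | s t. s \<in> T \<and> t \<in> T}"
  have TD: "x \<in> D" "star x = x" if "x \<in> T" for x using T that by (auto simp: preordering_def)
  have Tadd: "x + y \<in> T" and Tmult: "x * y \<in> T" if "x \<in> T" "y \<in> T" for x y
    using T that by (auto simp: preordering_def)
  have coneT: "x \<in> T" if "x \<in> cone" for x using T that by (auto simp: preordering_def)
  have 01: "0 \<in> T" "1 \<in> T" using coneT cone_of_real[of 0] cone_of_real[of 1] by simp_all
  have aa: "a * a \<in> T" using coneT[OF coneI[OF a(1)]] a by simp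
  have "X \<noteq> T"
    using a(3) 01 by (force simp: X_def)
  moreover have sub: "T \<subseteq> X" using 01 by (force simp: X_def)
  ultimately have "\<not> preordering X" using max by blast
  moreover have "X \<subseteq> {x \<in> D. star x = x}"
    using TD a by (auto simp: X_def star_add star_mult comm)
  moreover have "cone \<subseteq> X" using sub coneT by blast
  moreover have "x + y \<in> X \<and> x * y \<in> X" if xy: "x \<in> X" "y \<in> X" for x y
  proof -
    obtain s t s' t' where x: "s \<in> T" "t \<in> T" "x = s + a * t" and y: "s' \<in> T" "t' \<in> T" "y = s' + a * t'"
      using xy by (auto simp: X_def)
    have "x + y = (s + s') + a * (t + t')" using x y by (simp add: algebra_simps)
    moreover have "x * y = (s * s' + (a * a) * (t * t')) + a * (s * t' + t * s')"
      using x y TD a by (simp add: algebra_simps comm_ac)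
    moreover have "s'' + a * t'' \<in> X" if "s'' \<in> T" "t'' \<in> T" for s'' t''
      using that by (auto simp: X_def)
    ultimately show ?thesis using x y Tadd Tmult aa by metis
  qed
  ultimately have "- 1 \<in> X" by (auto simp: preordering_def)
  then obtain s t where st: "s \<in> T" "t \<in> T" "- 1 = s + a * t" by (auto simp: X_def)
  then have "a * t = - (1 + s)" by (simp add: eq_neg_iff_add_eq_0 algebra_simps)
  then show ?thesis using st that by blast
qed

lemma total_preordering_extension:
  assumes T0: "preordering T\<^sub>0"
  obtains T where "preordering T" "T\<^sub>0 \<subseteq> T"
    "\<And>a. a \<in> D \<Longrightarrow> star a = a \<Longrightarrow> a \<in> T \<or> - a \<in> T"
proof -
  let ?A = "{T. preordering T \<and> T\<^sub>0 \<subseteq> T}"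
  have "\<exists>M\<in>?A. \<forall>X\<in>?A. M \<subseteq> X \<longrightarrow> X = M"
  proof (rule subset_Zorn_nonempty)
    show "?A \<noteq> {}" using T0 by blast
    fix C assume ne: "C \<noteq> {}" and C: "subset.chain ?A C"
    have p: "preordering X" "T\<^sub>0 \<subseteq> X" if "X \<in> C" for X
      using C that by (auto simp: subset.chain_def)
    have ops: "\<forall>x\<in>\<Union>C. \<forall>y\<in>\<Union>C. x + y \<in> \<Union>C \<and> x * y \<in> \<Union>C"
    proof (intro ballI)
      fix x y assume xy: "x \<in> \<Union>C" "y \<in> \<Union>C"
      obtain X Y where XY: "X \<in> C" "x \<in> X" "Y \<in> C" "y \<in> Y" using xy by blast
      then have "X \<subseteq> Y \<or> Y \<subseteq> X" using C by (auto simp: subset_chain_def)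
      then obtain Z where "Z \<in> C" "x \<in> Z" "y \<in> Z" using XY by blast
      moreover have "x + y \<in> Z \<and> x * y \<in> Z"
        using p(1)[OF \<open>Z \<in> C\<close>] \<open>x \<in> Z\<close> \<open>y \<in> Z\<close> by (auto simp: preordering_def)
      ultimately show "x + y \<in> \<Union>C \<and> x * y \<in> \<Union>C" by blast
    qed
    obtain X where X: "X \<in> C" using ne by blast
    have "cone \<subseteq> X" "T\<^sub>0 \<subseteq> X"
      using p[OF X] by (auto simp: preordering_def)
    then have sup: "cone \<subseteq> \<Union>C" "T\<^sub>0 \<subseteq> \<Union>C" using X by (meson Union_upper order_trans)+
    have "Y \<subseteq> {x \<in> D. star x = x}" "- 1 \<notin> Y" if "Y \<in> C" for Y
      using p(1)[OF that] by (simp_all add: preordering_def)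
    then have sub: "\<Union>C \<subseteq> {x \<in> D. star x = x}" "- 1 \<notin> \<Union>C" by (meson Sup_least, meson UnionE)
    have "preordering (\<Union>C)" unfolding preordering_def by (intro conjI sub sup ops)
    then show "\<Union>C \<in> ?A" using sup(2) by (simp only: mem_Collect_eq)
  qed
  then obtain T where "T \<in> ?A" and max': "\<And>X. X \<in> ?A \<Longrightarrow> T \<subseteq> X \<Longrightarrow> X = T"
    by (elim bexE) simp
  then have T: "preordering T" "T\<^sub>0 \<subseteq> T" by simp_all
  have max: "X = T" if "preordering X" "T \<subseteq> X" for X
  proof (rule max'[OF _ that(2)])
    show "X \<in> ?A" using that T(2) by auto
  qed
  have TD: "x \<in> D" "star x = x" if "x \<in> T" for x using T that by (auto simp: preordering_def)
  have Tadd: "x + y \<in> T" and Tmult: "x * y \<in> T" if "x \<in> T" "y \<in> T" for x y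
    using T that by (auto simp: preordering_def)
  have "a \<in> T \<or> - a \<in> T" if a: "a \<in> D" "star a = a" for a
  proof (rule ccontr)
    assume n: "\<not> (a \<in> T \<or> - a \<in> T)"
    obtain s t where s: "s \<in> T" "t \<in> T" "a * t = - (1 + s)"
      using preordering_adjoin[OF T(1) max, of a] a n by blast
    obtain s' t' where s': "s' \<in> T" "t' \<in> T" "- a * t' = - (1 + s')"
      using preordering_adjoin[OF T(1) max, of "- a"] a n by (auto simp: star_minus)
    have "(1 + s) * (1 + s') = (a * t) * (- a * t')" unfolding s s' by (simp only: minus_mult_minus)
    also have "\<dots> = - ((a * a) * (t * t'))"
      using a s(1,2) s'(1,2) TD by (simp add: comm_ac)
    finally have e: "(1 + s) * (1 + s') = - ((a * a) * (t * t'))" .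
    have "1 + (s + s' + s * s' + (a * a) * (t * t')) = (1 + s) * (1 + s') + (a * a) * (t * t')"
      by (simp only: distrib_left distrib_right mult_1 mult_1_right ac_simps)
    also have "\<dots> = 0" unfolding e by (rule add.left_inverse)
    finally have "- 1 = s + s' + s * s' + (a * a) * (t * t')" by (rule minus_unique)
    moreover have "a * a \<in> T" using coneI[OF a(1)] a T by (auto simp: preordering_def)
    ultimately have "- 1 \<in> T" using s s' Tadd Tmult by simp
    then show False using T by (simp add: preordering_def)
  qed
  then show ?thesis using that T by blast
qed

text \<open>
  The elements \<open>x\<close> for which \<open>x\<^sup>*x\<close> is infinitesimal with respect to \<open>T\<close> form an ideal of
  codimension one, and \<open>\<phi>\<close> is the functional with this kernel and value 1 at the unit.
\<close>

lemma character_of_total_preordering: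
  assumes T: "preordering T" and total: "\<And>a. a \<in> D \<Longrightarrow> star a = a \<Longrightarrow> a \<in> T \<or> - a \<in> T"
  obtains \<phi> :: "'b \<Rightarrow> complex" where
    "\<And>x y. x \<in> D \<Longrightarrow> y \<in> D \<Longrightarrow> \<phi> (x + y) = \<phi> x + \<phi> y"
    "\<And>c x. x \<in> D \<Longrightarrow> \<phi> (c *\<^sub>C x) = c * \<phi> x"
    "\<And>x y. x \<in> D \<Longrightarrow> y \<in> D \<Longrightarrow> \<phi> (x * y) = \<phi> x * \<phi> y"
    "\<And>x. x \<in> D \<Longrightarrow> \<phi> (star x) = cnj (\<phi> x)"
    "\<And>x. x \<in> D \<Longrightarrow> \<phi> x = 0 \<longleftrightarrow> (\<forall>\<epsilon>>0. of_real \<epsilon> - star x * x \<in> T)"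
proof -
  have TD: "x \<in> D" "star x = x" if "x \<in> T" for x using T that by (auto simp: preordering_def)
  have Tadd: "x + y \<in> T" and Tmult: "x * y \<in> T" if "x \<in> T" "y \<in> T" for x y
    using T that by (auto simp: preordering_def)
  have coneT: "x \<in> T" if "x \<in> cone" for x using T that by (auto simp: preordering_def)
  have Treal: "of_real r \<in> T \<longleftrightarrow> 0 \<le> r" for r
  proof
    assume r: "of_real r \<in> T"
    show "0 \<le> r"
    proof (rule ccontr)
      assume "\<not> 0 \<le> r"
      then have "of_real (- 1 / r) \<in> T" by (intro coneT cone_of_real) (simp add: divide_le_0_iff)
      then have "of_real (- 1 / r) * of_real r \<in> T" using r by (rule Tmult)
      then show False using \<open>\<not> 0 \<le> r\<close> T by (simp add: preordering_def flip: of_real_mult)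
    qed
  qed (use coneT cone_of_real in blast)
  have Tscale: "r *\<^sub>R x \<in> T" if "0 \<le> r" "x \<in> T" for r x
    using Tmult[of "of_real r" x] that Treal by (simp add: scaleR_conv_of_real)
  define I where "I = {x \<in> D. \<forall>\<epsilon>>0. of_real \<epsilon> - star x * x \<in> T}"
  have ID: "x \<in> D" if "x \<in> I" for x using that by (simp add: I_def)
  have Iadd: "x + y \<in> I" if "x \<in> I" "y \<in> I" for x y
  proof -
    have D: "x \<in> D" "y \<in> D" using that ID by auto
    have "of_real \<epsilon> - star (x + y) * (x + y) \<in> T" if "\<epsilon> > 0" for \<epsilon>
    proof -
      let ?p = "of_real (\<epsilon>/4) - star x * x" and ?q = "of_real (\<epsilon>/4) - star y * y"
      have "?p \<in> T" "?q \<in> T" using \<open>x \<in> I\<close> \<open>y \<in> I\<close> that by (auto simp: I_def)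
      moreover have "star (x - y) * (x - y) \<in> T" using D by (intro coneT) auto
      ultimately have "2 *\<^sub>R (?p + ?q) + star (x - y) * (x - y) \<in> T"
        by (intro Tadd Tscale) auto
      moreover have eq: "2 *\<^sub>R (?p + ?q) =
          (of_real \<epsilon> :: 'b) - (star x * x + star x * x) - (star y * y + star y * y)"
        by (simp add: algebra_simps of_real_def scaleR_2 flip: scaleR_left_distrib)
      have "2 *\<^sub>R (?p + ?q) + star (x - y) * (x - y) = of_real \<epsilon> - star (x + y) * (x + y)"
        unfolding eq by (simp add: star_add star_diff algebra_simps)
      ultimately show ?thesis by simp
    qed
    then show ?thesis using D by (simp add: I_def)
  qed
  have Imult: "b * x \<in> I" if "b \<in> D" "x \<in> I" for b x
  proof -
    have x: "x \<in> D" using that ID by auto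
    have "of_real \<epsilon> - star (b * x) * (b * x) \<in> T" if \<epsilon>: "\<epsilon> > 0" for \<epsilon>
    proof -
      define r where "r = (norm b)\<^sup>2 + 1"
      have r: "r > 0" by (simp add: r_def add_nonneg_pos)
      have "of_real r - star b * b \<in> cone"
        using \<open>b \<in> D\<close> by (intro cone_of_norm_le) (auto simp: star_mult cstar_identity r_def)
      then have "(of_real r - star b * b) * (star x * x) \<in> T"
        using x by (intro Tmult coneT) auto
      moreover have "r *\<^sub>R (of_real (\<epsilon> / r) - star x * x) \<in> T"
        using \<open>x \<in> I\<close> \<epsilon> r by (intro Tscale) (auto simp: I_def)
      ultimately have "(of_real r - star b * b) * (star x * x) + r *\<^sub>R (of_real (\<epsilon> / r) - star x * x) \<in> T"
        by (rule Tadd)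
      moreover have "(of_real r - star b * b) * (star x * x) + r *\<^sub>R (of_real (\<epsilon> / r) - star x * x)
          = of_real \<epsilon> - star (b * x) * (b * x)"
      proof -
        have "star (b * x) * (b * x) = star b * b * (star x * x)"
          using x \<open>b \<in> D\<close> by (simp add: star_mult comm_ac)
        moreover have "r *\<^sub>R of_real (\<epsilon> / r) = (of_real \<epsilon> :: 'b)" using r by (simp add: of_real_def)
        ultimately show ?thesis by (simp add: algebra_simps scaleR_conv_of_real)
      qed
      ultimately show ?thesis by simp
    qed
    then show ?thesis using x \<open>b \<in> D\<close> by (simp add: I_def)
  qed
  have Istar: "star x \<in> I" if "x \<in> I" for x
    using that ID[OF that] by (simp add: I_def comm)
  have Iscale: "c *\<^sub>C x \<in> I" if "x \<in> I" for c x
    using Imult[OF mem_scaleC[OF mem_one, of c] that] by (simp add: mult_scaleC_left)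
  have Idiff: "x - y \<in> I" if "x \<in> I" "y \<in> I" for x y
    using Iadd[OF that(1) Iscale[OF that(2), of "-1"]] by simp
  have I1: "c *\<^sub>C 1 \<in> I \<longleftrightarrow> c = 0" for c
  proof
    assume c: "c *\<^sub>C 1 \<in> I"
    show "c = 0"
    proof (rule ccontr)
      assume "c \<noteq> 0"
      then have "1 \<in> I" using Iscale[OF c, of "inverse c"] by (simp add: scaleC_scaleC)
      then have "of_real (1/2) - 1 \<in> T" unfolding I_def
        by (metis (mono_tags, lifting) mem_Collect_eq half_gt_zero_iff mult_1 star_one zero_less_one)
      moreover have "(of_real (1/2) - 1 :: 'b) = of_real (1/2 - 1)" by (simp only: of_real_diff of_real_1)
      ultimately show False using Treal[of "1/2 - 1"] by simp
    qed
  next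
    assume "c = 0"
    then show "c *\<^sub>C 1 \<in> I" using coneT[OF cone_of_real] by (simp add: I_def)
  qed
  have real_part: "\<exists>s::real. a - of_real s \<in> I" if a: "a \<in> D" "star a = a" for a
  proof -
    define S where "S = {r. a - of_real r \<in> T}"
    define s where "s = Sup S"
    have up: "r \<le> norm a" if "r \<in> S" for r
    proof -
      have "of_real (norm a) - a \<in> T" using a by (intro coneT cone_of_norm_le) auto
      then have "(of_real (norm a) - a) + (a - of_real r) \<in> T" using that by (intro Tadd) (auto simp: S_def)
      then show ?thesis using Treal[of "norm a - r"] by simp
    qed
    have "of_real (norm a) - (- a) \<in> cone" using a by (intro cone_of_norm_le) (auto simp: star_minus)
    then have ne: "- norm a \<in> S" using coneT by (simp add: S_def add.commute)
    have bdd: "bdd_above S" unfolding bdd_above_def using up by blast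
    have lower: "of_real \<epsilon> + (a - of_real s) \<in> T" if "\<epsilon> > 0" for \<epsilon>
    proof -
      have "s - \<epsilon> < Sup S" using that by (simp add: s_def)
      then obtain r where r: "r \<in> S" "s - \<epsilon> < r"
        using less_cSupD[of S "s - \<epsilon>"] ne by blast
      have "(a - of_real r) + of_real (r - (s - \<epsilon>)) \<in> T"
        using r Treal by (intro Tadd) (auto simp: S_def simp del: of_real_diff)
      then show ?thesis by (simp add: algebra_simps)
    qed
    have upper: "of_real \<epsilon> - (a - of_real s) \<in> T" if "\<epsilon> > 0" for \<epsilon>
    proof -
      have "s + \<epsilon> \<notin> S" using cSup_upper[OF _ bdd, of "s + \<epsilon>"] that by (auto simp: s_def)
      then have "a - of_real (s + \<epsilon>) \<notin> T" by (simp add: S_def)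
      then have "- (a - of_real (s + \<epsilon>)) \<in> T" using total[of "a - of_real (s + \<epsilon>)"] a
        by (auto simp: star_diff simp del: of_real_add)
      then show ?thesis by (simp add: algebra_simps)
    qed
    let ?a = "a - of_real s"
    have "of_real \<epsilon> - star ?a * ?a \<in> T" if "\<epsilon> > 0" for \<epsilon>
    proof -
      have "(of_real (sqrt \<epsilon>) + ?a) * (of_real (sqrt \<epsilon>) - ?a) \<in> T"
        using that by (intro Tmult lower upper) auto
      moreover have "(of_real (sqrt \<epsilon>) + ?a) * (of_real (sqrt \<epsilon>) - ?a)
          = of_real (sqrt \<epsilon>) * of_real (sqrt \<epsilon>) - ?a * ?a"
        using comm[of a "of_real (sqrt \<epsilon>)"] comm[of a "of_real s"] a
        by (simp add: algebra_simps flip: of_real_mult)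
      moreover have "of_real (sqrt \<epsilon>) * of_real (sqrt \<epsilon>) = (of_real \<epsilon> :: 'b)"
        using that by (simp flip: of_real_mult)
      ultimately show ?thesis using a by (simp add: star_diff)
    qed
    then show ?thesis using a by (intro exI[of _ s]) (simp add: I_def)
  qed
  have ex: "\<exists>c. x - c *\<^sub>C 1 \<in> I" if x: "x \<in> D" for x
  proof -
    obtain a b where D: "a \<in> D" "b \<in> D" "star a = a" "star b = b" and xab: "x = a + \<i> *\<^sub>C b"
      using cartesian_decomposition[OF x] by metis
    obtain s t where st: "a - of_real s \<in> I" "b - of_real t \<in> I"
      using real_part D by blast
    have "(a - of_real s) + \<i> *\<^sub>C (b - of_real t) \<in> I"
      using st by (intro Iadd Iscale)
    moreover have "(a - of_real s) + \<i> *\<^sub>C (b - of_real t) = x - (of_real s + \<i> * of_real t) *\<^sub>C 1"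
      by (simp add: xab of_real_def scaleR_scaleC scaleC_add_left scaleC_scaleC
          complex_vector.scale_right_diff_distrib algebra_simps)
    ultimately show ?thesis by metis
  qed
  define \<phi> where "\<phi> x = (THE c. x - c *\<^sub>C 1 \<in> I)" for x
  have eqI: "\<phi> x = c" if "x - c *\<^sub>C 1 \<in> I" for x c
    unfolding \<phi>_def
  proof (rule the_equality)
    fix d assume "x - d *\<^sub>C 1 \<in> I"
    then have "(x - c *\<^sub>C 1) - (x - d *\<^sub>C 1) \<in> I" using that Idiff by blast
    then have "(d - c) *\<^sub>C 1 \<in> I" by (simp add: complex_vector.scale_left_diff_distrib)
    then show "d = c" using I1[of "d - c"] by simp
  qed (rule that)
  have \<phi>: "x - \<phi> x *\<^sub>C 1 \<in> I" if "x \<in> D" for x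
    using ex[OF that] eqI by metis
  show ?thesis
  proof (rule that)
    fix x y assume xy: "x \<in> D" "y \<in> D"
    have "(x - \<phi> x *\<^sub>C 1) + (y - \<phi> y *\<^sub>C 1) \<in> I" using xy by (intro Iadd \<phi>)
    then show "\<phi> (x + y) = \<phi> x + \<phi> y"
      by (intro eqI) (simp add: scaleC_add_left algebra_simps)
    have "y * (x - \<phi> x *\<^sub>C 1) + \<phi> x *\<^sub>C (y - \<phi> y *\<^sub>C 1) \<in> I"
      using xy by (intro Iadd Imult Iscale \<phi>)
    then show "\<phi> (x * y) = \<phi> x * \<phi> y"
      using xy by (intro eqI)
        (simp add: comm[of x y] algebra_simps complex_vector.scale_right_diff_distrib mult_scaleC_right
          scaleC_scaleC)
  next
    fix c x assume x: "x \<in> D"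
    have "c *\<^sub>C (x - \<phi> x *\<^sub>C 1) \<in> I" using x by (intro Iscale \<phi>)
    then show "\<phi> (c *\<^sub>C x) = c * \<phi> x"
      by (intro eqI) (simp add: complex_vector.scale_right_diff_distrib scaleC_scaleC)
    have "star (x - \<phi> x *\<^sub>C 1) \<in> I" using x by (intro Istar \<phi>)
    then show "\<phi> (star x) = cnj (\<phi> x)"
      by (intro eqI) (simp add: star_diff star_scaleC)
    have "\<phi> x = 0 \<longleftrightarrow> x \<in> I"
      using \<phi>[OF x] eqI[of x 0] by auto
    then show "\<phi> x = 0 \<longleftrightarrow> (\<forall>\<epsilon>>0. of_real \<epsilon> - star x * x \<in> T)"
      using x by (simp add: I_def)
  qed
qed

end

section \<open>Approximate units and existence of characters\<close>

instantiation unitization :: (cstar_algebra) one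
begin
definition "1 = Unitization 0 1"
instance ..
end

instance unitization :: (cstar_algebra) real_normed_algebra_1
proof
  fix x :: "'a unitization"
  show "1 * x = x" "x * 1 = x" "(0 :: 'a unitization) \<noteq> 1"
    by (simp_all add: one_unitization_def unitization_ops)
  have "norm (1 :: 'a unitization) \<le> 1"
    by (rule norm_unitizationI) (simp_all add: one_unitization_def left_mult_def)
  then show "norm (1 :: 'a unitization) = 1"
    using scal_part_le[of "1 :: 'a unitization"] by (simp add: one_unitization_def)
qed

definition emb :: "'a::cstar_algebra \<Rightarrow> 'a unitization" where
  "emb a = Unitization a 0"

lemma alg_part_emb [simp]: "alg_part (emb a) = a"
  and scal_part_emb [simp]: "scal_part (emb a) = 0"
  by (simp_all add: emb_def)

lemma emb_zero: "emb 0 = 0"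
  and emb_add: "emb (a + b) = emb a + emb b"
  and emb_minus: "emb (- a) = - emb a"
  and emb_mult: "emb (a * b) = emb a * emb b"
  and emb_star: "emb (star a) = star (emb a)"
  and emb_scaleC: "emb (c *\<^sub>C a) = c *\<^sub>C emb a"
  and emb_scaleR: "emb (r *\<^sub>R a) = r *\<^sub>R emb a"
  by (simp_all add: emb_def unitization_ops)

lemma emb_eq_iff [simp]: "emb a = emb b \<longleftrightarrow> a = b"
  by (simp add: emb_def)

lemma emb_alg_part: "scal_part x = 0 \<Longrightarrow> emb (alg_part x) = x"
  by (simp add: emb_def unitization_eqI)

lemma alg_part_ops [simp]:
  fixes x y :: "'a::cstar_algebra unitization"
  shows "alg_part 0 = (0 :: 'a)" "alg_part 1 = (0 :: 'a)"
    "alg_part (x + y) = alg_part x + alg_part y" "alg_part (x - y) = alg_part x - alg_part y"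
    "alg_part (c *\<^sub>C x) = c *\<^sub>C alg_part x" "alg_part (r *\<^sub>R x) = r *\<^sub>R alg_part x"
    "alg_part (star x) = star (alg_part x)" "alg_part (- x) = - alg_part x"
    "alg_part (x * y) =
      alg_part x * alg_part y + scal_part y *\<^sub>C alg_part x + scal_part x *\<^sub>C alg_part y"
    "alg_part (of_real r) = (0 :: 'a)"
  by (simp_all add: unitization_ops one_unitization_def of_real_def)

lemma scal_part_ops [simp]:
  fixes x y :: "'a::cstar_algebra unitization"
  shows "scal_part (0 :: 'a unitization) = 0" "scal_part (1 :: 'a unitization) = 1"
    "scal_part (x + y) = scal_part x + scal_part y" "scal_part (x - y) = scal_part x - scal_part y"
    "scal_part (c *\<^sub>C x) = c * scal_part x" "scal_part (r *\<^sub>R x) = r *\<^sub>R scal_part x"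
    "scal_part (star x) = cnj (scal_part x)" "scal_part (- x) = - scal_part x"
    "scal_part (x * y) = scal_part x * scal_part y"
    "scal_part (of_real r :: 'a unitization) = of_real r"
  by (simp_all add: unitization_ops one_unitization_def of_real_def)

lemma norm_emb [simp]: "norm (emb a) = norm a"
proof (rule antisym)
  show "norm (emb a) \<le> norm a" using norm_unitization_le[of "emb a"] by simp
  show "norm a \<le> norm (emb a)"
  proof (cases "a = 0")
    case False
    have "norm a * norm a \<le> norm (emb a) * norm a"
      using norm_left_mult_le[of "emb a" "star a"]
      by (simp add: left_mult_def norm_mult_star power2_eq_square)
    with False show ?thesis by simp
  qed simp
qed

lemma bounded_linear_emb: "bounded_linear emb"
  by (rule bounded_linear_intro[where K = 1]) (simp_all add: emb_add emb_scaleR)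

lemma bounded_linear_alg_part: "bounded_linear (alg_part :: 'a::cstar_algebra unitization \<Rightarrow> 'a)"
  by (rule bounded_linear_intro[where K = 2]) (simp_all add: norm_alg_part_le mult.commute[of _ 2])

lemma bounded_linear_scal_part: "bounded_linear (scal_part :: 'a::cstar_algebra unitization \<Rightarrow> complex)"
  by (rule bounded_linear_intro[where K = 1]) (simp_all add: scal_part_le)

lemma unitization_set_iff [simp]: "x \<in> unitization_set D \<longleftrightarrow> alg_part x \<in> D"
  by (cases x) (auto simp: unitization_set_def)

context comm_cstar
begin

lemma unital_comm_cstar_unitization: "unital_comm_cstar (unitization_set D)"
  by unfold_locales (use inclusion in \<open>simp_all add: inclusion_unitization_set\<close>)

interpretation unit: unital_comm_cstar "unitization_set D"
  by (rule unital_comm_cstar_unitization)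

lemma approx_unit_exists:
  assumes c: "c \<in> D" and h: "h = star c * c" and \<delta>: "0 < \<delta>"
  obtains e where "e \<in> D" "star e = e" "norm e \<le> 1" "e * h + \<delta> *\<^sub>R e = h"
    "\<exists>s d. d \<in> D \<and> e = s *\<^sub>C h + h * d"
proof -
  have hD: "h \<in> D" using c h by simp
  have "star (emb c) * emb c \<in> unit.cone" using c by (intro unit.coneI) simp
  then have H: "emb h \<in> unit.cone" by (simp add: h emb_mult emb_star)
  obtain w where w: "w \<in> unit.cone" "(of_real \<delta> + emb h) * w = 1"
    using unit.cone_inverse[OF H \<delta>] by blast
  define E where "E = emb h * w"
  define e where "e = alg_part E"
  have wD: "alg_part w \<in> D" using unit.cone_subset[OF w(1)] by simp
  have E: "emb e = E" unfolding e_def by (rule emb_alg_part) (simp add: E_def)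
  have Ec: "E \<in> unit.cone" unfolding E_def using H w(1) by (rule unit.cone_mult)
  have e_eq: "e = scal_part w *\<^sub>C h + h * alg_part w" by (simp add: e_def E_def)
  have eD: "e \<in> D" using wD hD by (simp add: e_eq)
  have "emb (star e) = emb e" using unit.star_cone[OF Ec] by (simp add: emb_star E)
  then have "star e = e" by simp
  have "\<delta> *\<^sub>R w + E = of_real 1" using w(2) by (simp add: E_def distrib_right scaleR_conv_of_real)
  then have "norm E \<le> 1"
    using \<delta> Ec w(1) unit.cone_scaleR[of \<delta> w]
    by (intro unit.norm_le_of_cone_sum[of E "\<delta> *\<^sub>R w"]) (simp_all add: add.commute)
  then have "norm e \<le> 1" by (simp flip: E)
  have w1: "\<delta> *\<^sub>R w + emb h * w = 1"
    using w(2) by (simp add: distrib_right scaleR_conv_of_real)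
  have "w * emb h = emb h * w" using wD hD by (intro unit.comm) simp_all
  then have "E * emb h + \<delta> *\<^sub>R E = emb h * (\<delta> *\<^sub>R w + emb h * w)"
    by (simp add: E_def distrib_left mult.assoc add.commute)
  then have "emb (e * h + \<delta> *\<^sub>R e) = emb h" by (simp add: w1 emb_add emb_mult emb_scaleR E)
  then have "e * h + \<delta> *\<^sub>R e = h" by simp
  moreover have "\<exists>s d. d \<in> D \<and> e = s *\<^sub>C h + h * d" using e_eq wD by blast
  ultimately show ?thesis using that eD \<open>star e = e\<close> \<open>norm e \<le> 1\<close> by simp
qed

lemma approx_unit_sequence:
  assumes c: "c \<in> D" "star b * b = star c * c"
  obtains e where "\<And>n. e n \<in> D" "\<And>n. star (e n) = e n" "\<And>n. norm (e n) \<le> 1"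
    "\<And>n. \<exists>s d. d \<in> D \<and> e n = s *\<^sub>C (star b * b) + star b * b * d"
    "(\<lambda>n::nat. b * e n) \<longlonglongrightarrow> b"
proof -
  define h where "h = star b * b"
  have hD: "h \<in> D" using c by (simp add: h_def)
  have "\<exists>e. e \<in> D \<and> star e = e \<and> norm e \<le> 1 \<and> e * h + (1 / Suc n) *\<^sub>R e = h \<and>
      (\<exists>s d. d \<in> D \<and> e = s *\<^sub>C h + h * d)" for n :: nat
  proof -
    have "h = star c * c" using c(2) by (simp only: h_def)
    then show ?thesis
    proof (rule approx_unit_exists[OF c(1), of h "1 / Suc n"])
      show "0 < 1 / real (Suc n)" by simp
    qed (rule exI, intro conjI)
  qed
  then have "\<forall>n. \<exists>e. e \<in> D \<and> star e = e \<and> norm e \<le> 1 \<and> e * h + (1 / Suc n) *\<^sub>R e = h \<and>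
      (\<exists>s d. d \<in> D \<and> e = s *\<^sub>C h + h * d)" ..
  then obtain e where "\<forall>n. e n \<in> D \<and> star (e n) = e n \<and> norm (e n) \<le> 1 \<and>
      e n * h + (1 / Suc n) *\<^sub>R e n = h \<and> (\<exists>s d. d \<in> D \<and> e n = s *\<^sub>C h + h * d)"
    by (rule choice[THEN exE])
  then have e: "\<And>n. e n \<in> D" "\<And>n. star (e n) = e n" "\<And>n. norm (e n) \<le> 1"
    "\<And>n. e n * h + (1 / Suc n) *\<^sub>R e n = h" "\<And>n. \<exists>s d. d \<in> D \<and> e n = s *\<^sub>C h + h * d"
    by simp_all
  have bound: "norm (b * e n - b) \<le> sqrt (2 / Suc n)" for n
  proof -
    let ?r = "1 / Suc n"
    have eh: "e n * h = h - ?r *\<^sub>R e n" using e(4)[of n] by (simp only: eq_diff_eq)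
    have he: "h * e n = h - ?r *\<^sub>R e n" using eh comm[OF hD e(1)] by (rule trans[rotated])
    have "star (b * e n - b) * (b * e n - b) = e n * (h * e n) - e n * h - (h * e n - h)"
      by (simp add: star_diff star_mult e(2) h_def left_diff_distrib right_diff_distrib mult.assoc)
    also have "\<dots> = ?r *\<^sub>R (e n - e n * e n)"
      by (simp only: he eh right_diff_distrib mult_scaleR_right) (simp add: scaleR_right_diff_distrib)
    finally have "norm (star (b * e n - b) * (b * e n - b)) = ?r * norm (e n - e n * e n)"
      by simp
    then have "(norm (b * e n - b))\<^sup>2 = ?r * norm (e n - e n * e n)"
      by (simp only: cstar_identity)
    moreover have "norm (e n - e n * e n) \<le> 2"
    proof -
      have "norm (e n - e n * e n) \<le> norm (e n) + norm (e n) * norm (e n)"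
        using norm_triangle_ineq4[of "e n" "e n * e n"] norm_mult_ineq[of "e n" "e n"] by linarith
      also have "\<dots> \<le> 1 + 1 * 1" using e(3) by (intro add_mono mult_mono) auto
      finally show ?thesis by simp
    qed
    then have "?r * norm (e n - e n * e n) \<le> ?r * 2" by (intro mult_left_mono) auto
    ultimately have "(norm (b * e n - b))\<^sup>2 \<le> 2 / Suc n" by simp
    then show ?thesis by (rule real_le_rsqrt)
  qed
  have "(\<lambda>n. sqrt (2 / real (Suc n))) \<longlonglongrightarrow> sqrt 0"
    using LIMSEQ_Suc[OF lim_const_over_n[of "2::real"]] by (intro tendsto_real_sqrt)
  then have lim: "(\<lambda>n. sqrt (2 / real (Suc n))) \<longlonglongrightarrow> 0" by simp
  have "(\<lambda>n. b * e n - b) \<longlonglongrightarrow> 0"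
  proof (rule Lim_null_comparison[OF _ lim])
    show "\<forall>\<^sub>F n in sequentially. norm (b * e n - b) \<le> sqrt (2 / real (Suc n))"
      using bound by (intro always_eventually allI)
  qed
  then have "(\<lambda>n. b * e n) \<longlonglongrightarrow> b" by (simp only: LIM_zero_iff)
  with e(1-3) e(5)[unfolded h_def] show ?thesis by (rule that)
qed

definition character :: "('a \<Rightarrow> complex) \<Rightarrow> bool" where
  "character \<phi> \<longleftrightarrow> (\<forall>x\<in>D. \<forall>y\<in>D. \<phi> (x + y) = \<phi> x + \<phi> y) \<and> (\<forall>c. \<forall>x\<in>D. \<phi> (c *\<^sub>C x) = c * \<phi> x) \<and>
     (\<forall>x\<in>D. \<forall>y\<in>D. \<phi> (x * y) = \<phi> x * \<phi> y) \<and> (\<forall>x\<in>D. \<phi> (star x) = cnj (\<phi> x))"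

text \<open>
  If \<open>k\<close> is not within \<open>\<epsilon>\<close> of the ideal \<open>J\<close>, then the squares, the elements of \<open>J\<close> and
  \<open>k - \<epsilon>\<close> generate a preordering: an identity \<open>- 1 = p + (k - \<epsilon>) q + j\<close> with \<open>p, q \<ge> 0\<close>
  can be solved for \<open>k\<close> after dividing by \<open>1 + p + k q\<close>.
\<close>

lemma character_exists:
  assumes J: "J \<subseteq> D" "complex_vector.subspace J" "\<And>j d. j \<in> J \<Longrightarrow> d \<in> D \<Longrightarrow> j * d \<in> J"
    and c: "c \<in> D" "k = star c * c" and k: "k \<notin> closure J"
  obtains \<phi> where "character \<phi>" "\<And>j. j \<in> J \<Longrightarrow> \<phi> j = 0" "\<phi> k \<noteq> 0"
proof -
  obtain \<epsilon> where \<epsilon>: "\<epsilon> > 0" "\<And>j. j \<in> J \<Longrightarrow> \<epsilon> < norm (k - j)"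
  proof -
    obtain e where "e > 0" "\<And>j. j \<in> J \<Longrightarrow> \<not> dist j k < e"
      using k by (auto simp: closure_approachable)
    then show ?thesis using that[of "e/2"] by (force simp: dist_norm norm_minus_commute)
  qed
  let ?k = "emb k - of_real \<epsilon>"
  have Jd: "j \<in> D" if "j \<in> J" for j using J that by blast
  have J_add: "x + y \<in> J" if "x \<in> J" "y \<in> J" for x y
    using J(2) that by (rule complex_vector.subspace_add)
  have J_scale: "c *\<^sub>C x \<in> J" if "x \<in> J" for x c
    using J(2) that by (rule complex_vector.subspace_scale)
  have J0: "0 \<in> J" using J(2) by (rule complex_vector.subspace_0)
  have kD: "k \<in> D" "star k = k" using c by (simp_all add: star_mult)
  have "star (emb c) * emb c \<in> unit.cone" using c by (intro unit.coneI) simp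
  then have Kc: "emb k \<in> unit.cone" by (simp add: c emb_mult emb_star)
  define T0 where "T0 = {p + ?k * q + emb j | p q j. p \<in> unit.cone \<and> q \<in> unit.cone \<and> j \<in> J \<and> star j = j}"
  have T0I: "p + ?k * q + emb j \<in> T0" if "p \<in> unit.cone" "q \<in> unit.cone" "j \<in> J" "star j = j" for p q j
    using that by (auto simp: T0_def)
  have Emb_ideal: "\<exists>j'\<in>J. star j' = j' \<and> emb j * x = emb j'"
    if "j \<in> J" "star j = j" "x \<in> unitization_set D" "star x = x" for j x
  proof (intro bexI conjI)
    let ?j = "alg_part (emb j * x)"
    have "j * alg_part x \<in> J" "scal_part x *\<^sub>C j \<in> J" using that J(3) J_scale by simp_all
    then show "?j \<in> J" using J_add by simp
    show eq: "emb j * x = emb ?j" by (subst emb_alg_part) simp_all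
    have "star (emb j * x) = emb j * x"
      using that unit.comm[of "emb j" x] Jd by (simp add: star_mult flip: emb_star)
    then have "emb (star ?j) = emb ?j" unfolding emb_star eq[symmetric] .
    then show "star ?j = ?j" by (simp only: emb_eq_iff)
  qed
  have expand: "(p + K * q) * (p' + K * q') = (p * p' + (K * K) * (q * q')) + K * (p * q' + q * p')"
    if "p \<in> unitization_set D" "q \<in> unitization_set D" "K \<in> unitization_set D"
      "p' \<in> unitization_set D" "q' \<in> unitization_set D" for p q K p' q'
    using that by (simp add: algebra_simps unit.comm_ac del: unitization_set_iff)
  have 0: "0 \<in> unit.cone" using unit.cone_of_real[of 0] by simp
  have "unit.preordering T0"
    unfolding unit.preordering_def
  proof (intro conjI ballI)
    show "T0 \<subseteq> {x \<in> unitization_set D. star x = x}"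
    proof
      fix x assume "x \<in> T0"
      then obtain p q j where x: "p \<in> unit.cone" "q \<in> unit.cone" "j \<in> J" "star j = j" "x = p + ?k * q + emb j"
        by (auto simp: T0_def)
      have D: "p \<in> unitization_set D" "q \<in> unitization_set D" "?k \<in> unitization_set D" "emb j \<in> unitization_set D"
        using x unit.cone_subset Jd kD by simp_all
      then have "x \<in> unitization_set D"
        unfolding x(5) by (intro unit.mem_add unit.mem_mult)
      moreover have "star x = x"
        unfolding x(5) using x D unit.comm[of q ?k] kD
        by (simp only: star_add star_mult star_diff star_of_real unit.star_cone emb_star[symmetric])
      ultimately show "x \<in> {x \<in> unitization_set D. star x = x}" by simp
    qed
    show "unit.cone \<subseteq> T0" using T0I[OF _ 0 J0] by (auto simp: emb_zero)
    show "- 1 \<notin> T0"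
    proof
      assume "- 1 \<in> T0"
      then obtain p q j where pq: "p \<in> unit.cone" "q \<in> unit.cone" "j \<in> J" "star j = j" "- 1 = p + ?k * q + emb j"
        by (auto simp: T0_def)
      define v where "v = p + emb k * q"
      have v: "v \<in> unit.cone" unfolding v_def using pq Kc by (intro unit.cone_add unit.cone_mult)
      obtain w where w: "w \<in> unit.cone" "(of_real 1 + v) * w = 1"
        using unit.cone_inverse[OF v, of 1] by auto
      have wD: "w \<in> unitization_set D" using w unit.cone_subset by blast
      have D: "p \<in> unitization_set D" "q \<in> unitization_set D" "emb k \<in> unitization_set D" "emb j \<in> unitization_set D"
          "v \<in> unitization_set D"
        using pq unit.cone_subset Jd kD v by simp_all
      have v1: "1 + v = \<epsilon> *\<^sub>R q - emb j"
        using pq(5) by (simp add: v_def algebra_simps scaleR_conv_of_real)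
      have "emb k = emb k * ((1 + v) * w)" using w by simp
      also have "\<dots> = \<epsilon> *\<^sub>R (emb k * q * w) - emb k * (emb j * w)"
        unfolding v1 by (simp add: algebra_simps)
      finally have k_eq: "emb k + emb k * (emb j * w) = \<epsilon> *\<^sub>R (emb k * q * w)" by (simp add: algebra_simps)
      have sum: "emb k * q * w + (1 + p) * w = of_real 1"
        using w(2) by (simp add: v_def algebra_simps)
      have "norm (emb k * q * w) \<le> 1"
      proof (rule unit.norm_le_of_cone_sum[OF _ _ sum])
        show "emb k * q * w \<in> unit.cone" using Kc pq w by (intro unit.cone_mult)
        show "(1 + p) * w \<in> unit.cone"
          using pq w unit.cone_of_real[of 1] by (intro unit.cone_mult unit.cone_add) simp_all
      qed simp
      then have "norm (emb k + emb k * (emb j * w)) \<le> \<epsilon>" unfolding k_eq using \<epsilon>(1) by simp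
      moreover obtain j' where j': "j' \<in> J" "emb j * w = emb j'"
        using Emb_ideal[of j w] pq w wD unit.star_cone by blast
      ultimately have "norm (k + k * j') \<le> \<epsilon>"
        by (simp flip: emb_mult emb_add)
      moreover have "- (k * j') \<in> J"
        using J(3)[OF j'(1) kD(1)] J_scale[of "k * j'" "-1"] comm[OF kD(1) Jd[OF j'(1)]] by simp
      ultimately show False using \<epsilon>(2)[of "- (k * j')"] by simp
    qed
    fix x y assume "x \<in> T0" "y \<in> T0"
    then obtain p q j p' q' j' where x: "p \<in> unit.cone" "q \<in> unit.cone" "j \<in> J" "star j = j" "x = p + ?k * q + emb j"
      and y: "p' \<in> unit.cone" "q' \<in> unit.cone" "j' \<in> J" "star j' = j'" "y = p' + ?k * q' + emb j'"
      by (auto simp: T0_def)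
    have "x + y = (p + p') + ?k * (q + q') + emb (j + j')"
      unfolding x(5) y(5) by (simp add: algebra_simps emb_add)
    moreover have "\<dots> \<in> T0"
      using x y J_add by (intro T0I unit.cone_add) (simp_all add: star_add)
    ultimately show "x + y \<in> T0" by simp
    have D: "p \<in> unitization_set D" "q \<in> unitization_set D" "?k \<in> unitization_set D" "emb j \<in> unitization_set D"
        "p' \<in> unitization_set D" "q' \<in> unitization_set D" "emb j' \<in> unitization_set D"
      using x y unit.cone_subset Jd kD by simp_all
    have Dx: "p + ?k * q \<in> unitization_set D" "y \<in> unitization_set D"
      unfolding y(5) using D by (intro unit.mem_add unit.mem_mult; blast)+
    have S: "star (p + ?k * q) = p + ?k * q" "star y = y"
      unfolding y(5) using x y D unit.comm[of q ?k] unit.comm[of q' ?k] kD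
      by (simp_all only: star_add star_mult star_diff star_of_real unit.star_cone emb_star[symmetric])
    obtain j1 j2 where j12: "j1 \<in> J" "star j1 = j1" "emb j * y = emb j1"
        "j2 \<in> J" "star j2 = j2" "emb j' * (p + ?k * q) = emb j2"
      using Emb_ideal[OF x(3,4) Dx(2) S(2)] Emb_ideal[OF y(3,4) Dx(1) S(1)] by blast
    have "x * y = (p + ?k * q) * (p' + ?k * q') + (p + ?k * q) * emb j' + emb j * y"
      unfolding x(5) y(5) by (simp only: distrib_left distrib_right add.assoc add.left_commute)
    also have "(p + ?k * q) * emb j' = emb j2"
      using j12 unit.comm[OF Dx(1) D(7)] by simp
    also have "(p + ?k * q) * (p' + ?k * q') = (p * p' + (?k * ?k) * (q * q')) + ?k * (p * q' + q * p')"
      by (rule expand) (use D in blast)+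
    finally have "x * y = (p * p' + (?k * ?k) * (q * q')) + ?k * (p * q' + q * p') + emb (j2 + j1)"
      by (simp add: j12 emb_add add.assoc)
    moreover have "?k * ?k \<in> unit.cone"
      using unit.coneI[OF D(3)] kD by (simp add: star_diff flip: emb_star)
    ultimately show "x * y \<in> T0"
      using x y j12 J_add by (auto intro!: T0I unit.cone_add unit.cone_mult simp: star_add)
  qed
  then obtain T where T: "unit.preordering T" "T0 \<subseteq> T"
    "\<And>a. a \<in> unitization_set D \<Longrightarrow> star a = a \<Longrightarrow> a \<in> T \<or> - a \<in> T"
    by (rule unit.total_preordering_extension) blast
  obtain \<phi> where \<phi>:
    "\<And>x y. x \<in> unitization_set D \<Longrightarrow> y \<in> unitization_set D \<Longrightarrow> \<phi> (x + y) = \<phi> x + \<phi> y"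
    "\<And>c x. x \<in> unitization_set D \<Longrightarrow> \<phi> (c *\<^sub>C x) = c * \<phi> x"
    "\<And>x y. x \<in> unitization_set D \<Longrightarrow> y \<in> unitization_set D \<Longrightarrow> \<phi> (x * y) = \<phi> x * \<phi> y"
    "\<And>x. x \<in> unitization_set D \<Longrightarrow> \<phi> (star x) = cnj (\<phi> x)"
    "\<And>x. x \<in> unitization_set D \<Longrightarrow> \<phi> x = 0 \<longleftrightarrow> (\<forall>\<epsilon>>0. of_real \<epsilon> - star x * x \<in> T)"
    by (rule unit.character_of_total_preordering[OF T(1) T(3)]) blast+
  have Tadd: "x + y \<in> T" and Tmult: "x * y \<in> T" if "x \<in> T" "y \<in> T" for x y
    using T that by (auto simp: unit.preordering_def)
  have coneT: "x \<in> T" if "x \<in> unit.cone" for x using T that by (auto simp: unit.preordering_def)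
  show ?thesis
  proof (rule that[of "\<lambda>x. \<phi> (emb x)"])
    show "character (\<lambda>x. \<phi> (emb x))"
      by (simp add: character_def emb_add emb_mult emb_scaleC emb_star \<phi>)
    fix j assume j: "j \<in> J"
    have "- (star j * j) \<in> J"
      using J(3)[OF j, of "star j"] J_scale[of "j * star j" "-1"] J0 Jd[OF j] comm[of j "star j"] by simp
    then have neg: "emb (- (star j * j)) \<in> T"
      using T0I[OF 0 0, of "- (star j * j)"] T(2) by (auto simp: star_minus star_mult)
    have "of_real \<epsilon> - star (emb j) * emb j \<in> T" if "\<epsilon> > 0" for \<epsilon>
      using Tadd[OF coneT[OF unit.cone_of_real[of \<epsilon>]] neg] that
      by (simp add: emb_minus emb_mult emb_star)
    then show "\<phi> (emb j) = 0" using \<phi>(5)[of "emb j"] Jd[OF j] by simp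
  next
    show "\<phi> (emb k) \<noteq> 0"
    proof
      assume "\<phi> (emb k) = 0"
      then have "of_real (\<epsilon>\<^sup>2 / 2) - star (emb k) * emb k \<in> T"
        using \<phi>(5)[of "emb k"] kD \<epsilon> by (simp del: of_real_divide of_real_power)
      moreover have "?k * (emb k + of_real \<epsilon>) \<in> T"
      proof (rule Tmult)
        have "?k = 0 + ?k * 1 + emb 0" by (simp add: emb_zero)
        moreover have "\<dots> \<in> T0" using T0I[OF 0 _ J0, of 1] unit.cone_of_real[of 1] by simp
        ultimately show "?k \<in> T" using T(2) by auto
        show "emb k + of_real \<epsilon> \<in> T"
          using Kc \<epsilon> by (intro coneT unit.cone_add unit.cone_of_real) auto
      qed
      ultimately have "of_real (\<epsilon>\<^sup>2 / 2) - star (emb k) * emb k + ?k * (emb k + of_real \<epsilon>) \<in> T" by (rule Tadd)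
      also have "of_real (\<epsilon>\<^sup>2 / 2) - star (emb k) * emb k + ?k * (emb k + of_real \<epsilon>) =
          of_real (\<epsilon>\<^sup>2 / 2) - of_real \<epsilon> * of_real \<epsilon>"
        using kD unit.comm[of "of_real \<epsilon>" "emb k"] by (simp add: algebra_simps flip: emb_star)
      also have "\<dots> = of_real (- (\<epsilon>\<^sup>2 / 2))"
        by (simp only: of_real_mult[symmetric] of_real_diff[symmetric]) (simp add: power2_eq_square)
      finally have neg: "of_real (- (\<epsilon>\<^sup>2 / 2)) \<in> T" .
      have "of_real (2 / \<epsilon>\<^sup>2) * of_real (- (\<epsilon>\<^sup>2 / 2)) \<in> T"
        by (rule Tmult[OF coneT[OF unit.cone_of_real] neg]) simp
      moreover have "of_real (2 / \<epsilon>\<^sup>2) * of_real (- (\<epsilon>\<^sup>2 / 2)) = (- 1 :: 'a unitization)"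
        using \<epsilon> by (simp only: of_real_mult[symmetric]) simp
      ultimately show False using T(1) by (simp add: unit.preordering_def)
    qed
  qed
qed

end

section \<open>Positive functionals and states\<close>

definition positive_functional :: "'a::cstar_algebra set \<Rightarrow> ('a \<Rightarrow> complex) \<Rightarrow> bool" where
  "positive_functional B f \<longleftrightarrow> (\<forall>x\<in>B. \<forall>y\<in>B. f (x + y) = f x + f y) \<and>
     (\<forall>c. \<forall>x\<in>B. f (c *\<^sub>C x) = c * f x) \<and> (\<forall>x\<in>B. f (star x * x) \<in> \<real>\<^sub>\<ge>\<^sub>0)"

lemma cstar_subalgebra_UNIV: "cstar_subalgebra UNIV"
  by (simp add: cstar_subalgebra_def)

locale positive_functional_on =
  fixes B :: "'a::cstar_algebra set" and f :: "'a \<Rightarrow> complex"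
  assumes B: "cstar_subalgebra B" and f: "positive_functional B f"
begin

lemma mem [simp]:
  "0 \<in> B" "x \<in> B \<Longrightarrow> y \<in> B \<Longrightarrow> x + y \<in> B" "x \<in> B \<Longrightarrow> y \<in> B \<Longrightarrow> x - y \<in> B"
  "x \<in> B \<Longrightarrow> c *\<^sub>C x \<in> B" "x \<in> B \<Longrightarrow> y \<in> B \<Longrightarrow> x * y \<in> B" "x \<in> B \<Longrightarrow> star x \<in> B"
  using B unfolding cstar_subalgebra_def
  by (auto intro: complex_vector.subspace_0 complex_vector.subspace_add
      complex_vector.subspace_diff complex_vector.subspace_scale)

lemma add: "x \<in> B \<Longrightarrow> y \<in> B \<Longrightarrow> f (x + y) = f x + f y"
  and scale: "x \<in> B \<Longrightarrow> f (c *\<^sub>C x) = c * f x"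
  using f by (simp_all add: positive_functional_def)

lemma zero: "f 0 = 0"
  using scale[of 0 0] by simp

lemma diff: "x \<in> B \<Longrightarrow> y \<in> B \<Longrightarrow> f (x - y) = f x - f y"
  using add[of x "(- 1) *\<^sub>C y"] scale[of y "- 1"] mem(4)[of y "- 1"] by simp

lemma square: "x \<in> B \<Longrightarrow> f (star x * x) = of_real (Re (f (star x * x)))"
  and square_nonneg: "x \<in> B \<Longrightarrow> 0 \<le> Re (f (star x * x))"
proof -
  have "f (star x * x) \<in> \<real>\<^sub>\<ge>\<^sub>0" if "x \<in> B" for x using f that by (simp add: positive_functional_def)
  then show "x \<in> B \<Longrightarrow> f (star x * x) = of_real (Re (f (star x * x)))"
    "x \<in> B \<Longrightarrow> 0 \<le> Re (f (star x * x))"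
    by (auto simp: complex_nonneg_Reals_iff complex_eq_iff)
qed

lemma square_add:
  assumes "x \<in> B" "y \<in> B"
  shows "f (star (x + c *\<^sub>C y) * (x + c *\<^sub>C y)) =
    f (star x * x) + c * f (star x * y) + cnj c * f (star y * x) + cnj c * c * f (star y * y)"
proof -
  have "star (x + c *\<^sub>C y) * (x + c *\<^sub>C y) =
      star x * x + c *\<^sub>C (star x * y) + cnj c *\<^sub>C (star y * x) + (cnj c * c) *\<^sub>C (star y * y)"
    by (simp add: star_add star_scaleC distrib_left distrib_right mult_scaleC_left mult_scaleC_right
        scaleC_scaleC scaleC_add_right add.assoc mult.commute)
  then show ?thesis using assms by (simp add: add scale)
qed

lemma hermitian:
  assumes xy: "x \<in> B" "y \<in> B"
  shows "f (star y * x) = cnj (f (star x * y))"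
proof -
  have Im0: "Im (f (star z * z)) = 0" if "z \<in> B" for z
    using square[OF that] by (metis Im_complex_of_real)
  have "Im (c * f (star x * y) + cnj c * f (star y * x) + cnj c * c * f (star y * y)) = 0" for c
    using Im0[of "x + c *\<^sub>C y"] square_add[OF xy, of c] Im0[of x] xy by simp
  from this[of 1] this[of \<i>] show ?thesis
    using Im0[of y] xy by (simp add: complex_eq_iff)
qed

lemma Cauchy_Schwarz:
  assumes xy: "x \<in> B" "y \<in> B"
  shows "(cmod (f (star x * y)))\<^sup>2 \<le> Re (f (star x * x)) * Re (f (star y * y))"
proof -
  define s a b where "s = f (star x * y)" and "a = Re (f (star x * x))" and "b = Re (f (star y * y))"
  have ab: "a \<ge> 0" "b \<ge> 0" using square_nonneg xy by (auto simp: a_def b_def)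
  have main: "0 \<le> a - 2 * t * (cmod s)\<^sup>2 + t\<^sup>2 * (cmod s)\<^sup>2 * b" for t
  proof -
    have ss: "cnj s * s = of_real ((cmod s)\<^sup>2)" "s * cnj s = of_real ((cmod s)\<^sup>2)"
      by (simp_all only: complex_norm_square mult.commute)
    define c where "c = - of_real t * cnj s"
    have "0 \<le> Re (f (star (x + c *\<^sub>C y) * (x + c *\<^sub>C y)))"
      using xy by (intro square_nonneg) simp
    also have "\<dots> = Re (of_real a + c * s + cnj c * cnj s + cnj c * c * of_real b)"
      using square[OF xy(1)] square[OF xy(2)] hermitian[OF xy]
      by (simp add: square_add[OF xy] s_def a_def b_def)
    also have "c * s = - of_real (t * (cmod s)\<^sup>2)"
      by (simp add: c_def mult.assoc ss(1) del: of_real_power)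
    also have "cnj c * cnj s = - of_real (t * (cmod s)\<^sup>2)"
      by (simp add: c_def mult.assoc ss(2) del: of_real_power)
    also have "cnj c * c = of_real (t\<^sup>2) * (s * cnj s)"
      by (simp add: c_def power2_eq_square)
    finally show ?thesis by (simp add: ss(2) flip: of_real_mult del: of_real_power)
  qed
  show ?thesis
  proof (cases "b = 0")
    case True
    have "cmod s = 0"
    proof (rule ccontr)
      assume "cmod s \<noteq> 0"
      then have "((a + 1) / (cmod s)\<^sup>2) * (cmod s)\<^sup>2 = a + 1" by simp
      then show False using main[of "(a + 1) / (cmod s)\<^sup>2"] True ab \<open>cmod s \<noteq> 0\<close> by (simp add: mult.assoc)
    qed
    then show ?thesis using ab by (simp add: s_def a_def b_def)
  next
    case False
    have "0 \<le> a - (cmod s)\<^sup>2 / b"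
      using main[of "1 / b"] False by (simp add: power2_eq_square)
    then show ?thesis using False ab by (simp add: field_simps s_def a_def b_def)
  qed
qed

lemma Cauchy_Schwarz_eq_0:
  assumes "x \<in> B" "y \<in> B" "f (star x * x) = 0 \<or> f (star y * y) = 0"
  shows "f (star x * y) = 0"
  using Cauchy_Schwarz[OF assms(1,2)] assms(3) by auto

end

lemma state_on_positive: "state_on B f \<Longrightarrow> positive_functional B f"
  by (simp add: state_on_def positive_functional_def)

lemma state_on_norm_le:
  assumes st: "state_on B f" and B: "cstar_subalgebra B" and x: "x \<in> B"
  shows "cmod (f x) \<le> norm x"
proof (cases "x = 0")
  case True
  interpret positive_functional_on B f using B state_on_positive[OF st] by unfold_locales
  show ?thesis using True zero by simp
next
  case False
  interpret positive_functional_on B f using B state_on_positive[OF st] by unfold_locales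
  let ?y = "complex_of_real (1 / norm x) *\<^sub>C x"
  have "?y \<in> {x\<in>B. norm x \<le> 1}" using x False by (simp add: norm_scaleC norm_divide)
  then have "cmod (f ?y) \<le> (SUP x\<in>{x\<in>B. norm x \<le> 1}. cmod (f x))"
    using st by (intro cSUP_upper) (auto simp: state_on_def)
  then have "cmod (f ?y) \<le> 1" using st by (simp add: state_on_def)
  then show ?thesis using False x by (simp add: scale norm_mult norm_divide field_simps)
qed

lemma state_on_approx:
  assumes st: "state_on B f" and B: "cstar_subalgebra B" and s: "s < 1"
  obtains x where "x \<in> B" "norm x \<le> 1" "s < cmod (f x)"
proof -
  interpret positive_functional_on B f using B state_on_positive[OF st] by unfold_locales
  have "0 \<in> {x\<in>B. norm x \<le> 1}" by simp
  then have "{x\<in>B. norm x \<le> 1} \<noteq> {}" by blast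
  then have "\<exists>x\<in>{x\<in>B. norm x \<le> 1}. s < cmod (f x)"
    using less_cSUP_iff[of "{x\<in>B. norm x \<le> 1}" "\<lambda>x. cmod (f x)" s] st s
    unfolding state_on_def by simp
  then show ?thesis using that by blast
qed

lemma state_onI:
  assumes f: "positive_functional B f" and B: "cstar_subalgebra B"
    and le: "\<And>x. x \<in> B \<Longrightarrow> cmod (f x) \<le> norm x"
    and approx: "\<And>s. s < 1 \<Longrightarrow> \<exists>x\<in>B. norm x \<le> 1 \<and> s < cmod (f x)"
  shows "state_on B f"
proof -
  let ?S = "{x\<in>B. norm x \<le> 1}"
  have bdd: "bdd_above ((\<lambda>x. cmod (f x)) ` ?S)"
    using le by (intro bdd_aboveI2[where M = 1]) (auto intro: order_trans)
  have ne: "?S \<noteq> {}" using approx[of 0] by auto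
  have "(SUP x\<in>?S. cmod (f x)) = 1"
  proof (rule antisym)
    show "(SUP x\<in>?S. cmod (f x)) \<le> 1"
      using ne le by (intro cSUP_least) (auto intro: order_trans)
    show "1 \<le> (SUP x\<in>?S. cmod (f x))"
    proof (rule ccontr)
      assume "\<not> 1 \<le> (SUP x\<in>?S. cmod (f x))"
      then obtain x where "x \<in> ?S" "(SUP x\<in>?S. cmod (f x)) < cmod (f x)"
        using approx[of "SUP x\<in>?S. cmod (f x)"] by auto
      then show False using cSUP_upper[OF _ bdd, of x] by simp
    qed
  qed
  then show ?thesis using f bdd by (simp add: state_on_def positive_functional_def)
qed

context comm_cstar
begin

interpretation unit: unital_comm_cstar "unitization_set D"
  by (rule unital_comm_cstar_unitization)

lemma characterD:
  assumes "character \<phi>"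
  shows "x \<in> D \<Longrightarrow> y \<in> D \<Longrightarrow> \<phi> (x + y) = \<phi> x + \<phi> y" "x \<in> D \<Longrightarrow> \<phi> (c *\<^sub>C x) = c * \<phi> x"
    "x \<in> D \<Longrightarrow> y \<in> D \<Longrightarrow> \<phi> (x * y) = \<phi> x * \<phi> y" "x \<in> D \<Longrightarrow> \<phi> (star x) = cnj (\<phi> x)"
    "x \<in> D \<Longrightarrow> y \<in> D \<Longrightarrow> \<phi> (x - y) = \<phi> x - \<phi> y"
proof -
  show add: "\<phi> (x + y) = \<phi> x + \<phi> y" if "x \<in> D" "y \<in> D" for x y
    using assms that by (simp add: character_def)
  show scale: "\<phi> (c *\<^sub>C x) = c * \<phi> x" if "x \<in> D" for c x
    using assms that by (simp add: character_def)
  show "x \<in> D \<Longrightarrow> y \<in> D \<Longrightarrow> \<phi> (x * y) = \<phi> x * \<phi> y" "x \<in> D \<Longrightarrow> \<phi> (star x) = cnj (\<phi> x)"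
    using assms by (simp_all add: character_def)
  show "\<phi> (x - y) = \<phi> x - \<phi> y" if "x \<in> D" "y \<in> D"
    using add[of x "(- 1) *\<^sub>C y"] scale[of y "- 1"] that by simp
qed

lemma character_square: "character \<phi> \<Longrightarrow> x \<in> D \<Longrightarrow> \<phi> (star x * x) = of_real ((cmod (\<phi> x))\<^sup>2)"
  by (simp add: characterD complex_norm_square mult.commute del: of_real_power)

lemma character_positive: "character \<phi> \<Longrightarrow> positive_functional D \<phi>"
  by (auto simp: positive_functional_def characterD(1,2) character_square complex_nonneg_Reals_iff
      simp del: of_real_power)

lemma character_norm_le:
  assumes \<phi>: "character \<phi>" and x: "x \<in> D"
  shows "cmod (\<phi> x) \<le> norm x"
proof (cases "x = 0")
  case True
  then show ?thesis using characterD(2)[OF \<phi> mem_zero, of 0] by simp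
next
  case False
  define z where "z = (1 / (norm x)\<^sup>2) *\<^sub>R (star x * x)"
  have "star z = z" "norm z \<le> 1"
    using False by (simp_all add: z_def star_scaleR star_mult cstar_identity)
  then obtain y where y: "star y = y" "y + y - y * y = z"
    "\<And>S. cstar_subalgebra S \<Longrightarrow> z \<in> S \<Longrightarrow> y \<in> S"
    by (rule cstar_sqrt) blast
  have yD: "y \<in> D" using y(3)[OF cstar_subalgebra] x by (simp add: z_def)
  have "cnj (\<phi> y) = \<phi> y" using characterD(4)[OF \<phi> yD] y(1) by simp
  then have y_real: "\<phi> y = of_real (Re (\<phi> y))" by (simp add: complex_eq_iff)
  have "\<phi> z = of_real ((cmod (\<phi> x))\<^sup>2 / (norm x)\<^sup>2)"
    using x by (simp add: z_def scaleR_scaleC characterD(2)[OF \<phi>] character_square[OF \<phi>])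
  moreover have "\<phi> z = \<phi> y + \<phi> y - \<phi> y * \<phi> y"
    unfolding y(2)[symmetric] using yD by (simp add: characterD[OF \<phi>])
  moreover have "\<dots> = of_real (1 - (1 - Re (\<phi> y))\<^sup>2)"
    by (subst (1 2 3 4) y_real) (simp add: power2_eq_square algebra_simps)
  ultimately have "(cmod (\<phi> x))\<^sup>2 / (norm x)\<^sup>2 = 1 - (1 - Re (\<phi> y))\<^sup>2"
    by (simp only: of_real_eq_iff)
  then have "(cmod (\<phi> x))\<^sup>2 / (norm x)\<^sup>2 \<le> 1" by simp
  then have "(cmod (\<phi> x))\<^sup>2 \<le> (norm x)\<^sup>2" using False by (simp add: field_simps)
  then show ?thesis by (rule power2_le_imp_le) simp
qed

lemma tendsto_functional:
  assumes f: "positive_functional D f" and le: "\<And>x. x \<in> D \<Longrightarrow> cmod (f x) \<le> K * norm x"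
    and x: "\<And>n. x n \<in> D" "x \<longlonglongrightarrow> y"
  shows "(\<lambda>n. f (x n)) \<longlonglongrightarrow> f y"
proof -
  interpret f: positive_functional_on D f using cstar_subalgebra f by unfold_locales
  have y: "y \<in> D" using x by (rule mem_limit)
  have lim: "(\<lambda>n. K * norm (x n - y)) \<longlonglongrightarrow> 0"
    using tendsto_mult_left[OF tendsto_norm_zero[OF LIM_zero[OF x(2)]], of K] by simp
  have "(\<lambda>n. f (x n) - f y) \<longlonglongrightarrow> 0"
  proof (rule Lim_null_comparison[OF _ lim])
    show "\<forall>\<^sub>F n in sequentially. norm (f (x n) - f y) \<le> K * norm (x n - y)"
      using x(1) y le by (intro always_eventually allI) (simp flip: f.diff)
  qed
  then show ?thesis by (simp only: LIM_zero_iff)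
qed

lemma approx_unit_in:
  assumes "x \<in> D"
  obtains e where "\<And>n. e n \<in> D" "\<And>n. star (e n) = e n" "\<And>n. norm (e n) \<le> 1"
    "(\<lambda>n::nat. e n * x) \<longlonglongrightarrow> x"
proof -
  obtain e where e: "\<And>n. e n \<in> D" "\<And>n. star (e n) = e n" "\<And>n. norm (e n) \<le> 1"
    "\<And>n. \<exists>s d. d \<in> D \<and> e n = s *\<^sub>C (star x * x) + star x * x * d"
    "(\<lambda>n::nat. x * e n) \<longlonglongrightarrow> x"
    by (rule approx_unit_sequence[OF assms refl]) (rule that)
  have "(\<lambda>n. e n * x) = (\<lambda>n. x * e n)" using comm[OF assms e(1)] by auto
  then have "(\<lambda>n. e n * x) \<longlonglongrightarrow> x" using e(5) by simp
  with e(1-3) show ?thesis by (rule that)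
qed

lemma null_square_imp_zero:
  assumes f: "positive_functional D f" and le: "\<And>x. x \<in> D \<Longrightarrow> cmod (f x) \<le> K * norm x"
    and x: "x \<in> D" "f (star x * x) = 0"
  shows "f x = 0"
proof -
  interpret f: positive_functional_on D f using cstar_subalgebra f by unfold_locales
  obtain e where e: "\<And>n. e n \<in> D" "\<And>n. star (e n) = e n" "\<And>n. norm (e n) \<le> 1"
    "(\<lambda>n::nat. e n * x) \<longlonglongrightarrow> x"
    by (rule approx_unit_in[OF x(1)]) (rule that)
  have "f (e n * x) = 0" for n
    using f.Cauchy_Schwarz_eq_0[OF e(1)[of n] x(1)] x(2) e(2)[of n] by simp
  moreover have "(\<lambda>n. f (e n * x)) \<longlonglongrightarrow> f x"
  proof (rule tendsto_functional[OF f le])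
    show "e n * x \<in> D" for n using e(1) x(1) by simp
    show "(\<lambda>n. e n * x) \<longlonglongrightarrow> x" by (rule e(4))
  qed
  ultimately show ?thesis by (simp add: LIMSEQ_const_iff)
qed

lemma character_state:
  assumes \<phi>: "character \<phi>" and ne: "d \<in> D" "\<phi> d \<noteq> 0"
  shows "state_on D \<phi>"
proof (rule state_onI[OF character_positive[OF \<phi>] cstar_subalgebra character_norm_le[OF \<phi>]])
  fix s :: real assume s: "s < 1"
  define h where "h = star d * d"
  define t where "t = (cmod (\<phi> d))\<^sup>2"
  define r where "r = t * (1 - s)"
  have hD: "h \<in> D" using ne by (simp add: h_def)
  have t: "t > 0" "\<phi> h = of_real t"
    unfolding h_def using ne by (simp_all add: t_def character_square[OF \<phi>])
  then have r: "0 < r" using s by (simp add: r_def)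
  obtain e where e: "e \<in> D" "star e = e" "norm e \<le> 1" "e * h + r *\<^sub>R e = h"
    "\<exists>r b. b \<in> D \<and> e = r *\<^sub>C h + h * b"
    by (rule approx_unit_exists[OF ne(1) h_def r]) (rule that)
  have "\<phi> (e * h + r *\<^sub>R e) = \<phi> e * \<phi> h + of_real r * \<phi> e"
    using e(1) hD by (simp add: characterD(1-3)[OF \<phi>] scaleR_scaleC)
  then have "of_real t = \<phi> e * of_real t + of_real r * \<phi> e"
    unfolding e(4) t(2) .
  then have "\<phi> e * of_real (t + r) = of_real t" by (simp add: algebra_simps)
  moreover have "complex_of_real (t + r) \<noteq> 0" using t r by (simp only: of_real_eq_0_iff)
  ultimately have "\<phi> e = of_real t / of_real (t + r)" using nonzero_eq_divide_eq by metis
  then have "\<phi> e = of_real (t / (t + r))" by (simp only: of_real_divide)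
  then have "cmod (\<phi> e) = t / (t + r)" using t r by (simp only: norm_of_real) simp
  moreover have "s < t / (t + r)"
  proof -
    have "s * r < 1 * r" using s r by (intro mult_strict_right_mono)
    then have "s * (t + r) < t" by (simp add: r_def algebra_simps)
    then show ?thesis using t r by (simp add: pos_less_divide_eq)
  qed
  ultimately show "\<exists>x\<in>D. norm x \<le> 1 \<and> s < cmod (\<phi> x)" using e(1,3) by auto
qed

lemma character_pure_state:
  assumes \<phi>: "character \<phi>" and ne: "d \<in> D" "\<phi> d \<noteq> 0"
  shows "pure_state_on D \<phi>"
  unfolding pure_state_on_def
proof (intro conjI allI impI ballI)
  show st: "state_on D \<phi>" using assms by (rule character_state)
  define u where "u = (1 / \<phi> d) *\<^sub>C d"
  have u: "u \<in> D" "\<phi> u = 1" using ne by (simp_all add: u_def characterD[OF \<phi>])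
  have key: "g x = \<phi> x" if g: "state_on D g" and h: "state_on D h" and t: "0 < t"
    and eq: "\<forall>x\<in>D. \<phi> x = of_real t * g x + of_real r * h x" and r: "0 < r" and x: "x \<in> D" for g h t r x
  proof -
    interpret g: positive_functional_on D g using cstar_subalgebra state_on_positive[OF g] by unfold_locales
    interpret h: positive_functional_on D h using cstar_subalgebra state_on_positive[OF h] by unfold_locales
    have ker: "g z = 0" if z: "z \<in> D" "\<phi> z = 0" for z
    proof (rule null_square_imp_zero[of _ 1])
      have "Re (of_real t * g (star z * z) + of_real r * h (star z * z)) = 0"
        using eq z character_square[OF \<phi> z(1)] by (metis mem_mult mem_star norm_zero of_real_0 zero_complex.simps(1) zero_power2)
      then have "t * Re (g (star z * z)) + r * Re (h (star z * z)) = 0" by simp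
      moreover have "0 \<le> t * Re (g (star z * z))" "0 \<le> r * Re (h (star z * z))"
        using t r g.square_nonneg[OF z(1)] h.square_nonneg[OF z(1)] by simp_all
      ultimately have "t * Re (g (star z * z)) = 0" by linarith
      then show "g (star z * z) = 0" using t g.square[OF z(1)] by simp
    qed (use z state_on_positive[OF g] state_on_norm_le[OF g cstar_subalgebra] in auto)
    have prop_u: "g z = \<phi> z * g u" if z: "z \<in> D" for z
    proof -
      have "g (z - \<phi> z *\<^sub>C u) = 0" using z u by (intro ker) (simp_all add: characterD[OF \<phi>])
      then show ?thesis using z u by (simp add: g.diff g.scale)
    qed
    have "g (star u * u) = g u" using prop_u[of "star u * u"] u character_square[OF \<phi> u(1)] by simp
    then have gu: "g u = of_real (Re (g u))" "0 \<le> Re (g u)"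
      using g.square[OF u(1)] g.square_nonneg[OF u(1)] by simp_all
    then have cmod_gu: "cmod (g u) = Re (g u)" by (metis abs_of_nonneg norm_of_real)
    have "Re (g u) \<ge> 1"
    proof (rule ccontr)
      assume "\<not> 1 \<le> Re (g u)"
      then obtain z where z: "z \<in> D" "norm z \<le> 1" "Re (g u) < cmod (g z)"
        using state_on_approx[OF g cstar_subalgebra, of "Re (g u)"] by auto
      have "cmod (g z) \<le> 1 * Re (g u)"
        unfolding prop_u[OF z(1)] norm_mult cmod_gu
        using character_norm_le[OF \<phi> z(1)] z(2) gu(2) by (intro mult_right_mono) auto
      then show False using z(3) by simp
    qed
    moreover have "Re (g u) \<le> 1"
    proof (rule ccontr)
      assume n: "\<not> Re (g u) \<le> 1"
      then have "1 / Re (g u) < 1" by simp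
      then obtain z where z: "z \<in> D" "norm z \<le> 1" "1 / Re (g u) < cmod (\<phi> z)"
        using state_on_approx[OF st cstar_subalgebra] by blast
      have "1 < cmod (\<phi> z) * Re (g u)" using z(3) n by (simp add: field_simps)
      also have "\<dots> = cmod (g z)" unfolding prop_u[OF z(1)] norm_mult cmod_gu ..
      also have "\<dots> \<le> 1" using state_on_norm_le[OF g cstar_subalgebra z(1)] z(2) by simp
      finally show False by simp
    qed
    ultimately have "g u = 1" using gu(1) by simp
    then show ?thesis using prop_u[OF x] by simp
  qed
  fix g h :: "'a \<Rightarrow> complex" and t :: real and x
  assume conj: "state_on D g \<and> state_on D h \<and> 0 < t \<and> t < 1 \<and>
      (\<forall>x\<in>D. \<phi> x = complex_of_real t * g x + complex_of_real (1 - t) * h x)" and x: "x \<in> D"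
  then have gh: "state_on D g" "state_on D h" and t: "0 < t" "t < 1"
    and eq: "\<forall>x\<in>D. \<phi> x = complex_of_real t * g x + complex_of_real (1 - t) * h x"
    by simp_all
  show "g x = \<phi> x" using key[OF gh t(1) eq _ x] t by simp
  have eq': "\<forall>x\<in>D. \<phi> x = complex_of_real (1 - t) * h x + complex_of_real t * g x"
    using eq by (simp add: add.commute)
  show "h x = \<phi> x" using key[OF gh(2,1) _ eq' t(1) x] t by simp
qed

end

section \<open>Pure states of a commutative C*-algebra are characters\<close>

context comm_cstar
begin

interpretation unit: unital_comm_cstar "unitization_set D"
  by (rule unital_comm_cstar_unitization)

lemma state_square_le:
  assumes f: "state_on D f" and x: "x \<in> D"
  shows "(cmod (f x))\<^sup>2 \<le> Re (f (star x * x))"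
    and "f (star x) = cnj (f x)"
proof -
  note pos = state_on_positive[OF f] and le = state_on_norm_le[OF f cstar_subalgebra]
  interpret f: positive_functional_on D f using cstar_subalgebra pos by unfold_locales
  obtain e where e: "\<And>n. e n \<in> D" "\<And>n. star (e n) = e n" "\<And>n. norm (e n) \<le> 1"
    "(\<lambda>n::nat. e n * x) \<longlonglongrightarrow> x"
    by (rule approx_unit_in[OF x]) (rule that)
  have le1: "cmod (f y) \<le> 1 * norm y" if "y \<in> D" for y using le[OF that] by simp
  have mem: "e n * x \<in> D" for n using e(1) x by simp
  have lim: "(\<lambda>n. f (e n * x)) \<longlonglongrightarrow> f x"
    using pos le1 mem e(4) by (rule tendsto_functional)
  have bound: "(cmod (f (e n * x)))\<^sup>2 \<le> Re (f (star x * x))" for n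
  proof -
    have "Re (f (star (e n) * e n)) \<le> cmod (f (star (e n) * e n))" by (rule complex_Re_le_cmod)
    also have "\<dots> \<le> norm (star (e n) * e n)" using e(1) by (intro le) simp
    also have "\<dots> \<le> 1" using e(3)[of n] by (simp add: cstar_identity power_le_one)
    finally have e1: "Re (f (star (e n) * e n)) \<le> 1" .
    have "(cmod (f (star (e n) * x)))\<^sup>2 \<le> Re (f (star (e n) * e n)) * Re (f (star x * x))"
      using e(1) x by (rule f.Cauchy_Schwarz)
    also have "\<dots> \<le> 1 * Re (f (star x * x))"
      using e1 f.square_nonneg[OF x] by (rule mult_right_mono)
    finally show ?thesis unfolding e(2) mult_1 .
  qed
  have "(\<lambda>n. (cmod (f (e n * x)))\<^sup>2) \<longlonglongrightarrow> (cmod (f x))\<^sup>2"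
    using lim by (intro tendsto_power tendsto_norm)
  then show "(cmod (f x))\<^sup>2 \<le> Re (f (star x * x))"
    by (rule LIMSEQ_le_const2) (use bound in blast)
  have "(\<lambda>n. star (e n * x)) \<longlonglongrightarrow> star x" using e(4) by (rule tendsto_star)
  with pos le1 mem_star[OF mem] have "(\<lambda>n. f (star (e n * x))) \<longlonglongrightarrow> f (star x)"
    by (rule tendsto_functional)
  moreover have "f (star (e n * x)) = cnj (f (e n * x))" for n
    using f.hermitian[OF e(1) x, of n] by (simp only: star_mult e(2))
  moreover have "(\<lambda>n. cnj (f (e n * x))) \<longlonglongrightarrow> cnj (f x)" using lim by (rule tendsto_cnj)
  ultimately show "f (star x) = cnj (f x)" by (simp only: LIMSEQ_unique)
qed

lemma state_unitization_positive:
  assumes f: "state_on D f"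
  shows "positive_functional (unitization_set D) (\<lambda>z. f (alg_part z) + scal_part z)"
  unfolding positive_functional_def
proof (intro conjI ballI allI)
  interpret f: positive_functional_on D f
    using cstar_subalgebra state_on_positive[OF f] by unfold_locales
  let ?F = "\<lambda>z. f (alg_part z) + scal_part z"
  fix z assume z: "z \<in> unitization_set D"
  then have xD: "alg_part z \<in> D" by simp
  { fix w assume "w \<in> unitization_set D"
    then show "?F (z + w) = ?F z + ?F w" using z by (simp add: f.add) }
  show "?F (c *\<^sub>C z) = c * ?F z" for c using xD by (simp add: f.scale distrib_left)
  define x c where "x = alg_part z" and "c = scal_part z"
  have x: "x \<in> D" using z by (simp add: x_def)
  have "?F (star z * z) = f (star x * x) + c * f (star x) + cnj c * f x + cnj c * c"
    using x by (simp add: f.add f.scale x_def[symmetric] c_def[symmetric])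
  also have "\<dots> = f (star x * x) + (c * cnj (f x) + cnj c * f x) + cnj c * c"
    by (simp only: state_square_le(2)[OF f x] add.assoc)
  also have "c * cnj (f x) + cnj c * f x = of_real (2 * Re (cnj c * f x))"
    by (simp add: complex_eq_iff)
  also have "cnj c * c = of_real ((cmod c)\<^sup>2)"
    by (simp only: complex_norm_square mult.commute)
  also have "f (star x * x) = of_real (Re (f (star x * x)))" using x by (rule f.square)
  finally have eq: "?F (star z * z) = of_real (Re (f (star x * x)) + 2 * Re (cnj c * f x) + (cmod c)\<^sup>2)"
    by (simp only: of_real_add)
  have "0 \<le> (cmod (f x + c))\<^sup>2" by simp
  also have "\<dots> = (cmod (f x))\<^sup>2 + 2 * Re (cnj c * f x) + (cmod c)\<^sup>2"
    by (simp only: cmod_power2) (simp add: power2_eq_square algebra_simps)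
  also have "\<dots> \<le> Re (f (star x * x)) + 2 * Re (cnj c * f x) + (cmod c)\<^sup>2"
    using state_square_le(1)[OF f x] by simp
  finally show "?F (star z * z) \<in> \<real>\<^sub>\<ge>\<^sub>0"
    unfolding eq by (simp only: nonneg_Reals_of_real_iff)
qed

lemma pure_state_mult_cone:
  assumes pure: "pure_state_on D f" and a: "a \<in> unit.cone" "1 - a \<in> unit.cone" and x: "x \<in> D"
  defines "F \<equiv> \<lambda>z. f (alg_part z) + scal_part z"
  shows "F (a * emb x) = F a * f x"
proof -
  have st: "state_on D f" using pure by (simp add: pure_state_on_def)
  interpret f: positive_functional_on D f
    using cstar_subalgebra state_on_positive[OF st] by unfold_locales
  interpret F: positive_functional_on "unitization_set D" F
    using unit.cstar_subalgebra state_unitization_positive[OF st] unfolding F_def by unfold_locales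
  have Femb: "F (emb y) = f y" for y by (simp add: F_def)
  have Fone: "F 1 = 1" by (simp add: F_def f.zero)
  have F_real: "F p = of_real (Re (F p))" "0 \<le> Re (F p)" if p: "p \<in> unit.cone" for p
  proof -
    obtain b where "b \<in> unitization_set D" "p = star b * b" using p unfolding unit.cone_def by blast
    then show "F p = of_real (Re (F p))" "0 \<le> Re (F p)" using F.square F.square_nonneg by metis+
  qed
  have mono: "cmod (F (p * emb y)) \<le> Re (F p) * norm y"
    and nonneg: "F (p * emb (star y * y)) \<in> \<real>\<^sub>\<ge>\<^sub>0" if p: "p \<in> unit.cone" and y: "y \<in> D" for p y
  proof -
    obtain b where b: "b \<in> unitization_set D" "p = star b * b" using p unfolding unit.cone_def by blast
    have Y: "emb y \<in> unitization_set D" using y by simp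
    have by_eq: "star (b * emb y) * (b * emb y) = p * emb (star y * y)"
      unfolding b(2) emb_mult emb_star star_mult
      using b(1) Y by (simp add: unit.comm_ac del: unitization_set_iff)
    have "p * emb (star y * y) \<in> unit.cone" unfolding by_eq[symmetric]
      using b(1) Y by (intro unit.coneI unit.mem_mult)
    then show "F (p * emb (star y * y)) \<in> \<real>\<^sub>\<ge>\<^sub>0"
      using F_real[of "p * emb (star y * y)"] by (metis nonneg_Reals_of_real_iff)
    have D: "emb (star y * y) \<in> unitization_set D" "star (emb (star y * y)) = emb (star y * y)"
      using y by (simp_all add: star_mult flip: emb_star)
    have "norm (emb (star y * y)) \<le> (norm y)\<^sup>2" by (simp add: cstar_identity)
    from unit.cone_of_norm_le[OF D this]
    have "p * (of_real ((norm y)\<^sup>2) - emb (star y * y)) \<in> unit.cone"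
      by (rule unit.cone_mult[OF p])
    then have "0 \<le> Re (F (p * (of_real ((norm y)\<^sup>2) - emb (star y * y))))" by (rule F_real(2))
    also have "p * (of_real ((norm y)\<^sup>2) - emb (star y * y)) =
        complex_of_real ((norm y)\<^sup>2) *\<^sub>C p - p * emb (star y * y)"
      by (simp add: right_diff_distrib of_real_def scaleR_scaleC mult_scaleC_right)
    also have "F \<dots> = complex_of_real ((norm y)\<^sup>2) * F p - F (p * emb (star y * y))"
      using unit.cone_subset[OF p] D(1) by (subst F.diff) (simp_all only: F.scale unit.mem_scaleC unit.mem_mult)
    also have "Re \<dots> = (norm y)\<^sup>2 * Re (F p) - Re (F (p * emb (star y * y)))" by simp
    finally have q: "Re (F (p * emb (star y * y))) \<le> (norm y)\<^sup>2 * Re (F p)" by simp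
    have "(cmod (F (p * emb y)))\<^sup>2 = (cmod (F (star b * (b * emb y))))\<^sup>2"
      by (simp only: b(2) mult.assoc)
    also have "\<dots> \<le> Re (F (star b * b)) * Re (F (star (b * emb y) * (b * emb y)))"
      using b(1) unit.mem_mult[OF b(1) Y] by (rule F.Cauchy_Schwarz)
    also have "\<dots> \<le> Re (F p) * ((norm y)\<^sup>2 * Re (F p))"
      unfolding by_eq b(2)[symmetric] using q F_real(2)[OF p] by (rule mult_left_mono)
    finally have "(cmod (F (p * emb y)))\<^sup>2 \<le> (Re (F p) * norm y)\<^sup>2"
      by (simp add: power_mult_distrib power2_eq_square mult_ac)
    then show "cmod (F (p * emb y)) \<le> Re (F p) * norm y"
      using F_real(2)[OF p] by (intro power2_le_imp_le[of "cmod (F (p * emb y))"]) auto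
  qed
  define t where "t = Re (F a)"
  have Fa: "F a = of_real t" using F_real(1)[OF a(1)] by (simp add: t_def)
  have aD: "a \<in> unitization_set D" using unit.cone_subset[OF a(1)] .
  have F1a: "F (1 - a) = of_real (1 - t)" using aD by (simp add: F.diff Fone Fa)
  have t01: "0 \<le> t" "t \<le> 1" using F_real(2)[OF a(1)] F_real(2)[OF a(2)] by (simp_all add: F1a t_def)
  have split: "F ((1 - a) * emb y) = f y - F (a * emb y)" if "y \<in> D" for y
    using that aD by (simp add: left_diff_distrib F.diff Femb)
  consider "t = 0" | "t = 1" | "0 < t" "t < 1" using t01 by linarith
  then show ?thesis
  proof cases
    case 1
    then show ?thesis using mono[OF a(1) x] by (simp add: Fa)
  next
    case 2
    then show ?thesis using mono[OF a(2) x] by (simp add: Fa F1a split[OF x])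
  next
    case 3
    define g where "g p y = F (p * emb y) / F p" for p y
    have pos_g: "positive_functional D (g p)" if p: "p \<in> unit.cone" "0 < Re (F p)" for p
      unfolding positive_functional_def
    proof (intro conjI ballI allI)
      have pD: "p \<in> unitization_set D" using unit.cone_subset[OF p(1)] .
      fix y assume y: "y \<in> D"
      show "g p (y + z) = g p y + g p z" if "z \<in> D" for z
        using y that pD by (simp add: g_def emb_add distrib_left F.add add_divide_distrib del: unitization_set_iff)
          (simp add: F.add add_divide_distrib)
      show "g p (c *\<^sub>C y) = c * g p y" for c
        using y pD by (simp add: g_def emb_scaleC mult_scaleC_right F.scale)
      have "F (p * emb (star y * y)) \<in> \<real>\<^sub>\<ge>\<^sub>0" using p(1) y by (rule nonneg)
      then show "g p (star y * y) \<in> \<real>\<^sub>\<ge>\<^sub>0"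
        unfolding g_def using F_real[OF p(1)] by (metis nonneg_Reals_divide_I nonneg_Reals_of_real_iff)
    qed
    have le_g: "cmod (g p y) \<le> norm y" if p: "p \<in> unit.cone" "0 < Re (F p)" and y: "y \<in> D" for p y
    proof -
      have "cmod (F p) = Re (F p)" using F_real[OF p(1)] by (metis abs_of_nonneg norm_of_real)
      then show ?thesis using mono[OF p(1) y] p(2) by (simp add: g_def norm_divide field_simps)
    qed
    have ta: "0 < Re (F a)" "0 < Re (F (1 - a))" using 3 by (simp_all add: Fa F1a)
    have decomp: "f y = of_real t * g a y + of_real (1 - t) * g (1 - a) y" if "y \<in> D" for y
      using 3 split[OF that] by (simp add: g_def Fa F1a del: of_real_diff)
    have approx: "\<exists>y\<in>D. norm y \<le> 1 \<and> s < cmod (g a y)"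
        "\<exists>y\<in>D. norm y \<le> 1 \<and> s < cmod (g (1 - a) y)" if s: "s < 1" for s
    proof -
      define m where "m = min t (1 - t)"
      have m: "0 < m" "m \<le> t" "m \<le> 1 - t" using 3 by (auto simp: m_def)
      have "1 - m * (1 - s) < 1" using m s by simp
      then obtain y where y: "y \<in> D" "norm y \<le> 1" "1 - m * (1 - s) < cmod (f y)"
        using state_on_approx[OF st cstar_subalgebra] by blast
      have le: "cmod (f y) \<le> t * cmod (g a y) + (1 - t) * cmod (g (1 - a) y)"
        unfolding decomp[OF y(1)]
        using norm_triangle_ineq[of "of_real t * g a y" "of_real (1 - t) * g (1 - a) y"] 3
        by (simp add: norm_mult del: of_real_diff)
      have g1: "cmod (g a y) \<le> 1" "cmod (g (1 - a) y) \<le> 1"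
        using le_g[OF a(1) ta(1) y(1)] le_g[OF a(2) ta(2) y(1)] y(2) by simp_all
      have ms: "m * (1 - s) \<le> t * (1 - s)" "m * (1 - s) \<le> (1 - t) * (1 - s)"
        using m s by (simp_all add: mult_right_mono)
      have "s < cmod (g a y)"
      proof -
        have "(1 - t) * cmod (g (1 - a) y) \<le> (1 - t) * 1" using g1 3 by (intro mult_left_mono) auto
        then have "t * s < t * cmod (g a y)" using le y(3) ms(1) by (simp add: algebra_simps)
        then show ?thesis using 3 by simp
      qed
      moreover have "s < cmod (g (1 - a) y)"
      proof -
        have "t * cmod (g a y) \<le> t * 1" using g1 3 by (intro mult_left_mono) auto
        then have "(1 - t) * s < (1 - t) * cmod (g (1 - a) y)" using le y(3) ms(2) by (simp add: algebra_simps)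
        then show ?thesis using 3 by (simp only: mult_less_cancel_left_pos diff_gt_0_iff_gt)
      qed
      ultimately show "\<exists>y\<in>D. norm y \<le> 1 \<and> s < cmod (g a y)"
        "\<exists>y\<in>D. norm y \<le> 1 \<and> s < cmod (g (1 - a) y)" using y by blast+
    qed
    have "state_on D (g a)"
      by (rule state_onI[OF pos_g[OF a(1) ta(1)] cstar_subalgebra le_g[OF a(1) ta(1)] approx(1)])
    moreover have "state_on D (g (1 - a))"
      by (rule state_onI[OF pos_g[OF a(2) ta(2)] cstar_subalgebra le_g[OF a(2) ta(2)] approx(2)])
    ultimately have "g a x = f x"
      using pure 3 decomp x unfolding pure_state_on_def by blast
    then show ?thesis using 3 by (simp add: g_def Fa divide_eq_eq mult.commute)
  qed
qed

lemma pure_state_character: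
  assumes pure: "pure_state_on D f"
  shows "character f"
proof -
  have st: "state_on D f" using pure by (simp add: pure_state_on_def)
  interpret f: positive_functional_on D f
    using cstar_subalgebra state_on_positive[OF st] by unfold_locales
  have contr: "f (d * x) = f d * f x" if d: "d \<in> D" "star d = d" "norm d \<le> 1" and x: "x \<in> D" for d x
  proof -
    define a where "a = (1/2) *\<^sub>R (1 + emb d)"
    have "of_real 1 - emb (- d) \<in> unit.cone" "of_real 1 - emb d \<in> unit.cone"
      using d by (intro unit.cone_of_norm_le; simp add: star_minus flip: emb_star)+
    then have c: "1 + emb d \<in> unit.cone" "1 - emb d \<in> unit.cone" by (simp_all add: emb_minus)
    have "a \<in> unit.cone" unfolding a_def using c by (intro unit.cone_scaleR) auto
    moreover have "1 - a = (1/2) *\<^sub>R (1 - emb d)"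
      unfolding a_def by (rule unitization_eqI) (simp_all add: scaleR_conv_of_real field_simps)
    then have "1 - a \<in> unit.cone" using c unit.cone_scaleR[of "1/2"] by simp
    ultimately have "f (alg_part (a * emb x)) + scal_part (a * emb x) =
        (f (alg_part a) + scal_part a) * f x"
      using x by (rule pure_state_mult_cone[OF pure])
    moreover have eqs: "alg_part (a * emb x) = (1/2) *\<^sub>C (x + d * x)" "scal_part (a * emb x) = 0"
        "alg_part a = (1/2) *\<^sub>C d" "scal_part a = 1/2"
      by (simp_all add: a_def scaleR_scaleC scaleC_add_right mult_scaleC_left add.commute)
    moreover have "f ((1/2) *\<^sub>C (x + d * x)) = (1/2) * (f x + f (d * x))" "f ((1/2) *\<^sub>C d) = (1/2) * f d"
      using d x by (simp_all add: f.scale f.add)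
    ultimately have "(1/2) * (f x + f (d * x)) + 0 = ((1/2) * f d + 1/2) * f x" by metis
    then show ?thesis by (simp add: field_simps)
  qed
  have sa: "f (d * x) = f d * f x" if d: "d \<in> D" "star d = d" and x: "x \<in> D" for d x
  proof (cases "d = 0")
    case True
    then show ?thesis by (simp add: f.zero)
  next
    case False
    define r where "r = norm d"
    have r: "r > 0" using False by (simp add: r_def)
    define u where "u = complex_of_real (1 / r) *\<^sub>C d"
    have u: "u \<in> D" "star u = u" "norm u \<le> 1"
      using d r by (simp_all add: u_def star_scaleC norm_scaleC norm_divide r_def[symmetric])
    have du: "d = complex_of_real r *\<^sub>C u" using r by (simp add: u_def scaleC_scaleC)
    show ?thesis
      unfolding du mult_scaleC_left using contr[OF u x] u x by (simp add: f.scale)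
  qed
  have mult: "f (d * x) = f d * f x" if d: "d \<in> D" and x: "x \<in> D" for d x
  proof -
    obtain a b where D: "a \<in> D" "b \<in> D" "star a = a" "star b = b" and dab: "d = a + \<i> *\<^sub>C b"
      using cartesian_decomposition[OF d] by metis
    have "f (d * x) = f (a * x) + \<i> * f (b * x)"
      unfolding dab using D x by (simp add: distrib_right mult_scaleC_left f.add f.scale)
    also have "\<dots> = f d * f x"
      unfolding dab using D x sa by (simp add: f.add f.scale algebra_simps)
    finally show ?thesis .
  qed
  show ?thesis
    unfolding character_def using mult f.add f.scale state_square_le(2)[OF st] by blast
qed

end

section \<open>Normalizers and faithful expectations\<close>

definition commutant :: "'a::cstar_algebra set \<Rightarrow> 'a set" where
  "commutant S = {a. \<forall>s\<in>S. a * s = s * a}"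

lemma cstar_subalgebra_commutant:
  fixes S :: "'a::cstar_algebra set"
  assumes S: "\<And>s. s \<in> S \<Longrightarrow> star s \<in> S"
  shows "cstar_subalgebra (commutant S)"
  unfolding cstar_subalgebra_def
proof (intro conjI ballI)
  show "complex_vector.subspace (commutant S)"
    by (rule complex_vector.subspaceI)
      (simp_all add: commutant_def distrib_left distrib_right mult_scaleC_left mult_scaleC_right)
  have "closed {a. a * s = s * a}" for s :: 'a
    by (intro closed_Collect_eq continuous_intros)
  then have "closed (\<Inter>s\<in>S. {a. a * s = s * a})" by blast
  also have "(\<Inter>s\<in>S. {a. a * s = s * a}) = commutant S" by (auto simp: commutant_def)
  finally show "closed (commutant S)" .
  fix x assume x: "x \<in> commutant S"
  show "x * y \<in> commutant S" if "y \<in> commutant S" for y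
    unfolding commutant_def
  proof (intro CollectI ballI)
    fix s assume "s \<in> S"
    then have "x * s = s * x" "y * s = s * y" using x that by (auto simp: commutant_def)
    then show "x * y * s = s * (x * y)" by (metis mult.assoc)
  qed
  show "star x \<in> commutant S"
    unfolding commutant_def
  proof (intro CollectI ballI)
    fix s assume "s \<in> S"
    then have "x * star s = star s * x" using x S by (auto simp: commutant_def)
    then have "star (x * star s) = star (star s * x)" by (rule arg_cong)
    then show "star x * s = s * star x" by (simp add: star_mult)
  qed
qed

lemma (in comm_cstar) masa_mem:
  assumes masa: "masa_inclusion D" and z: "star z = z" "\<And>d. d \<in> D \<Longrightarrow> z * d = d * z"
  shows "z \<in> D"
proof -
  let ?S = "insert z D"
  let ?B = "commutant (commutant ?S)"
  have star_S: "star s \<in> ?S" if "s \<in> ?S" for s using that z by auto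
  have SS': "?S \<subseteq> commutant ?S"
    using z comm unfolding commutant_def by auto
  have star_S': "star s \<in> commutant ?S" if "s \<in> commutant ?S" for s
    using cstar_subalgebra_commutant[OF star_S] that by (auto simp: cstar_subalgebra_def)
  have SB: "?S \<subseteq> ?B" unfolding commutant_def by auto
  have "?B \<subseteq> commutant ?S" using SS' unfolding commutant_def by blast
  then have "abelian ?B" unfolding abelian_def commutant_def by blast
  then have "?B = D"
    using masa cstar_subalgebra_commutant[OF star_S'] SB unfolding masa_inclusion_def by blast
  then show ?thesis using SB by blast
qed

lemma star_normalizers: "n \<in> normalizers D \<Longrightarrow> star n \<in> normalizers D"
  by (simp add: normalizers_def)

locale faithful_expectation = comm_cstar D for D :: "'a::cstar_algebra set" +
  fixes P :: "'a \<Rightarrow> 'a"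
  assumes expectation: "conditional_expectation D P" and faithful: "faithful P"
begin

lemma P_add: "P (a + b) = P a + P b"
  and P_scaleC: "P (c *\<^sub>C a) = c *\<^sub>C P a"
  using expectation by (simp_all add: conditional_expectation_def Vector_Spaces.linear_iff)

lemma P_zero [simp]: "P 0 = 0"
  using P_scaleC[of 0 0] by simp

lemma P_diff: "P (a - b) = P a - P b"
  using P_add[of a "(- 1) *\<^sub>C b"] P_scaleC[of "- 1" b] by simp

lemma P_mem [simp]: "P a \<in> D"
  and P_id: "d \<in> D \<Longrightarrow> P d = d"
  and norm_P: "norm (P a) \<le> norm a"
  and P_left: "d \<in> D \<Longrightarrow> P (d * a) = d * P a"
  and P_right: "d \<in> D \<Longrightarrow> P (a * d) = P a * d"
  and P_square: "\<exists>d\<in>D. P (star a * a) = star d * d"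
proof -
  have id: "\<forall>d\<in>D. P d = d"
    using expectation unfolding conditional_expectation_def by (elim conjE)
  have norm: "\<forall>a. norm (P a) \<le> norm a"
    using expectation unfolding conditional_expectation_def by (elim conjE)
  have square: "\<forall>a. \<exists>d\<in>D. P (star a * a) = star d * d"
    using expectation unfolding conditional_expectation_def by (elim conjE)
  have bimod: "\<forall>d\<in>D. \<forall>a. P (d * a) = d * P a \<and> P (a * d) = P a * d"
    using expectation unfolding conditional_expectation_def by (elim conjE)
  have "range P \<subseteq> D"
    using expectation unfolding conditional_expectation_def by (elim conjE)
  then show "P a \<in> D" by blast
  show "d \<in> D \<Longrightarrow> P d = d" by (rule bspec[OF id])
  show "norm (P a) \<le> norm a" by (rule spec[OF norm])
  show "\<exists>d\<in>D. P (star a * a) = star d * d" by (rule spec[OF square])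
  show "d \<in> D \<Longrightarrow> P (d * a) = d * P a" "d \<in> D \<Longrightarrow> P (a * d) = P a * d"
    using bimod by simp_all
qed

lemma P_faithful: "P (star a * a) = 0 \<Longrightarrow> a = 0"
  using faithful[unfolded faithful_def, rule_format] .

lemma bounded_linear_P: "bounded_linear P"
  by (rule bounded_linear_intro[where K = 1]) (simp_all add: P_add P_scaleC scaleR_scaleC norm_P)

lemma closed_subspace_P_mult: "complex_vector.subspace {a. P (x * a) = 0}" "closed {a. P (x * a) = 0}"
proof -
  show "complex_vector.subspace {a. P (x * a) = 0}"
    by (rule complex_vector.subspaceI) (simp_all add: distrib_left P_add mult_scaleC_right P_scaleC)
  show "closed {a. P (x * a) = 0}"
    by (rule closed_kernel[OF bounded_linear_compose[OF bounded_linear_P bounded_linear_mult_right]])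
qed

lemma closed_subspace_ker: "complex_vector.subspace {a. P a = 0}" "closed {a. P a = 0}"
proof -
  show "complex_vector.subspace {a. P a = 0}"
    by (rule complex_vector.subspaceI) (simp_all add: P_add P_scaleC)
  show "closed {a. P a = 0}"
    by (rule closed_kernel[OF bounded_linear_P])
qed

text \<open>
  An element of \<open>D\<close> of the form \<open>b\<^sup>*b\<close> with \<open>b \<in> A\<close> has this form with \<open>b \<in> D\<close>, because the
  expectation fixes it.  This replaces the theory of positivity in noncommutative algebras.
\<close>

lemma square_in_D:
  assumes "star b * b \<in> D"
  obtains c where "c \<in> D" "star b * b = star c * c"
  using P_square[of b] P_id[OF assms] that by auto

lemma approx_unit_right:
  assumes b: "star b * b \<in> D"
  obtains e where "\<And>n. e n \<in> D" "\<And>n. star (e n) = e n"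
    "\<And>n. \<exists>s d. d \<in> D \<and> e n = s *\<^sub>C (star b * b) + star b * b * d" "(\<lambda>n::nat. b * e n) \<longlonglongrightarrow> b"
proof -
  obtain c where c: "c \<in> D" "star b * b = star c * c" by (rule square_in_D[OF b]) (rule that)
  obtain e where e: "\<And>n. e n \<in> D" "\<And>n. star (e n) = e n" "\<And>n. norm (e n) \<le> 1"
    "\<And>n. \<exists>s d. d \<in> D \<and> e n = s *\<^sub>C (star b * b) + star b * b * d" "(\<lambda>n::nat. b * e n) \<longlonglongrightarrow> b"
    by (rule approx_unit_sequence[OF c]) (rule that)
  show ?thesis using e(1,2,4,5) by (rule that)
qed

lemma approx_unit_left:
  assumes b: "b * star b \<in> D"
  obtains e where "\<And>n. e n \<in> D" "\<And>n. star (e n) = e n"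
    "\<And>n. \<exists>s d. d \<in> D \<and> e n = s *\<^sub>C (b * star b) + b * star b * d" "(\<lambda>n::nat. e n * b) \<longlonglongrightarrow> b"
proof -
  have "star (star b) * star b \<in> D" using b by simp
  then obtain e where e: "\<And>n. e n \<in> D" "\<And>n. star (e n) = e n"
    "\<And>n. \<exists>s d. d \<in> D \<and> e n = s *\<^sub>C (star (star b) * star b) + star (star b) * star b * d"
    "(\<lambda>n::nat. star b * e n) \<longlonglongrightarrow> star b"
    by (rule approx_unit_right) (rule that)
  have "(\<lambda>n. star (star b * e n)) \<longlonglongrightarrow> star (star b)" using e(4) by (rule tendsto_star)
  then have "(\<lambda>n. e n * b) \<longlonglongrightarrow> b" by (simp only: star_mult star_star e(2))
  with e(1,2) e(3)[unfolded star_star] show ?thesis by (rule that)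
qed

lemma P_star: "P (star a) = star (P a)"
proof -
  have sq: "star (P (star x * x)) = P (star x * x)" for x
    using P_square[of x] by (auto simp: star_mult)
  have herm: "P (star x * y) = star (P (star y * x))" for x y
  proof -
    have h1: "star (P (star x * y) + P (star y * x)) = P (star x * y) + P (star y * x)"
      using sq[of "x + y"] sq[of x] sq[of y]
      by (simp add: star_add distrib_left distrib_right P_add algebra_simps)
    have h2: "star (P (star x * y) - P (star y * x)) = - (P (star x * y) - P (star y * x))"
    proof -
      have "star (\<i> *\<^sub>C (P (star x * y) - P (star y * x))) = \<i> *\<^sub>C (P (star x * y) - P (star y * x))"
        using sq[of "x + \<i> *\<^sub>C y"] sq[of x] sq[of y]
        by (simp add: star_add star_scaleC distrib_left distrib_right P_add P_diff P_scaleC mult_scaleC_left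
            mult_scaleC_right scaleC_scaleC complex_vector.scale_right_diff_distrib
            complex_vector.scale_minus_left star_diff star_minus algebra_simps)
      then have "\<i> *\<^sub>C (- star (P (star x * y) - P (star y * x))) = \<i> *\<^sub>C (P (star x * y) - P (star y * x))"
        by (simp only: star_scaleC complex_cnj_i complex_vector.scale_minus_left complex_vector.scale_minus_right)
      then have "- star (P (star x * y) - P (star y * x)) = P (star x * y) - P (star y * x)"
        by (rule complex_vector.scale_left_imp_eq[OF complex_i_not_zero])
      then show ?thesis by (metis minus_minus)
    qed
    have "star (P (star x * y)) + star (P (star x * y)) =
        star (P (star x * y) + P (star y * x)) + star (P (star x * y) - P (star y * x))"
      by (simp add: star_add star_diff)
    also have "\<dots> = P (star y * x) + P (star y * x)" unfolding h1 h2 by simp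
    finally have "star (P (star x * y)) + star (P (star x * y)) = P (star y * x) + P (star y * x)" .
    then have "2 *\<^sub>R star (P (star x * y)) = 2 *\<^sub>R P (star y * x)" by (simp only: scaleR_2)
    then show ?thesis by (metis scaleR_cancel_left star_star zero_neq_numeral)
  qed
  have "(P (star a) - star (P a)) * d = 0" if d: "d \<in> D" for d
    using herm[of a d] P_left[of "star d" a] P_right[of d "star a"] d
    by (simp add: star_mult left_diff_distrib)
  from this[of "star (P (star a) - star (P a))"] show ?thesis
    by (simp add: mult_star_self_eq_0)
qed

lemma eq_zero_if_annihilates:
  assumes "x \<in> D" "\<And>d. d \<in> D \<Longrightarrow> x * d = 0"
  shows "x = 0"
  using assms(2)[of "star x"] assms(1) by (simp add: mult_star_self_eq_0)

lemma normalizer_square_mult: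
  assumes n: "n \<in> normalizers D" and d: "d \<in> D"
  shows "star n * n * d \<in> D"
proof -
  have nd: "(n * d) * star (n * d) \<in> D"
    using n d by (auto simp: normalizers_def star_mult mult.assoc dest: bspec[of _ _ "d * star d"])
  obtain e where e: "\<And>k. e k \<in> D" "\<And>k. star (e k) = e k"
    "\<And>k. \<exists>s b. b \<in> D \<and> e k = s *\<^sub>C ((n * d) * star (n * d)) + (n * d) * star (n * d) * b"
    "(\<lambda>k::nat. e k * (n * d)) \<longlonglongrightarrow> n * d"
    by (rule approx_unit_left[OF nd]) (rule that)
  have mem: "star n * (e k * (n * d)) \<in> D" for k
  proof -
    have "star n * e k * n \<in> D" using n e(1) by (simp add: normalizers_def)
    then have "star n * e k * n * d \<in> D" using d by (rule mem_mult)
    then show ?thesis by (simp only: mult.assoc)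
  qed
  have "(\<lambda>k. star n * (e k * (n * d))) \<longlonglongrightarrow> star n * (n * d)"
    using e(4) by (rule tendsto_mult_left)
  with mem have "star n * (n * d) \<in> D" by (rule mem_limit)
  then show ?thesis by (simp only: mult.assoc)
qed

lemma normalizer_square_commutes:
  assumes n: "n \<in> normalizers D" and d: "d \<in> D"
  shows "star n * n * d = d * (star n * n)"
proof -
  let ?k = "star n * n"
  have kD: "?k * b \<in> D" if "b \<in> D" for b using n that by (rule normalizer_square_mult)
  have Dk: "b * ?k \<in> D" if "b \<in> D" for b
    using mem_star[OF kD[OF mem_star[OF that]]] by (simp add: star_mult)
  have "?k * d - d * ?k = 0"
  proof (rule eq_zero_if_annihilates)
    show "?k * d - d * ?k \<in> D" using kD Dk d by simp
    fix b assume b: "b \<in> D"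
    have "?k * d * b = ?k * b * d" using comm[OF d b] by (simp only: mult.assoc)
    also have "\<dots> = d * (?k * b)" using kD[OF b] d by (rule comm)
    finally show "(?k * d - d * ?k) * b = 0" by (simp only: left_diff_distrib mult.assoc diff_self)
  qed
  then show ?thesis by simp
qed

lemma masa_normalizer_square:
  assumes masa: "masa_inclusion D" and n: "n \<in> normalizers D"
  shows "star n * n \<in> D" "n * star n \<in> D"
proof -
  show "star n * n \<in> D"
    using masa normalizer_square_commutes[OF n] by (intro masa_mem) (simp_all add: star_mult)
  show "n * star n \<in> D"
    using masa normalizer_square_commutes[OF star_normalizers[OF n]]
    by (intro masa_mem) (simp_all add: star_mult)
qed

text \<open>
  With \<open>y = P (x m)\<close>, both \<open>y (m\<^sup>*m)\<close> and \<open>(m m\<^sup>*) y\<close> are equal to \<open>P (x m m\<^sup>*m)\<close>, but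
  \<open>m\<^sup>*m\<close> and \<open>m m\<^sup>*\<close> are orthogonal.
\<close>

lemma P_nilpotent:
  assumes x: "\<And>d. d \<in> D \<Longrightarrow> x * d = d * x"
    and m: "star m * m \<in> D" "m * star m \<in> D" "m * m = 0"
  shows "P (x * m) = 0"
proof -
  define u v y where "u = star m * m" and "v = m * star m" and "y = P (x * m)"
  have D: "u \<in> D" "v \<in> D" "y \<in> D" using m by (simp_all add: u_def v_def y_def)
  have "u * v = star m * (m * m) * star m" by (simp only: u_def v_def mult.assoc)
  then have uv: "u * v = 0" by (simp add: m(3))
  have "y * u = P (x * m * u)" unfolding y_def using D(1) by (rule P_right[symmetric])
  also have "x * m * u = (x * v) * m" by (simp only: u_def v_def mult.assoc)
  also have "\<dots> = v * (x * m)" unfolding x[OF D(2)] by (simp only: mult.assoc)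
  also have "P (v * (x * m)) = v * y" unfolding y_def using D(2) by (rule P_left)
  finally have yu: "y * u = v * y" .
  have sv: "star v = v" by (simp add: v_def star_mult)
  have "y * v * v = v * y * v" using D by (simp add: comm)
  also have "\<dots> = y * (u * v)" by (simp add: mult.assoc flip: yu)
  finally have yvv: "y * v * v = 0" by (simp add: uv)
  have "star (y * v) * (y * v) = star y * (y * v * v)"
    using D by (simp add: star_mult sv comm_ac)
  then have yv: "y * v = 0" by (simp add: yvv star_mult_self_eq_0)
  have "(star y * m) * star (star y * m) = star y * (v * y)" by (simp add: star_mult v_def mult.assoc)
  also have "v * y = 0" using yv D by (simp add: comm)
  finally have ym: "star y * m = 0" by (simp add: mult_star_self_eq_0)
  have "star y * y = P (star y * (x * m))"
    using P_left[OF mem_star[OF D(3)], of "x * m"] by (simp only: y_def)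
  also have "star y * (x * m) = x * (star y * m)"
    using x[OF mem_star[OF D(3)]] by (simp flip: mult.assoc)
  finally show ?thesis using ym by (simp add: star_mult_self_eq_0 y_def[symmetric])
qed

lemma free_normalizer_sandwich:
  assumes n: "n \<in> free_normalizers D" and d: "d \<in> D"
  shows "n * d * n = 0"
proof -
  have nn: "n * n = 0" and nN: "n \<in> normalizers D" using n by (auto simp: free_normalizers_def)
  have k: "star n * n * d \<in> D" using nN d by (rule normalizer_square_mult)
  have nn': "star n * star n = 0" using nn by (metis star_mult star_zero)
  have "star (n * d * n) * (n * d * n) = star n * (star d * (star n * n * d)) * n"
    by (simp add: star_mult mult.assoc)
  also have "star d * (star n * n * d) = star n * n * d * star d" using k d by (simp add: comm)
  also have "star n * (star n * n * d * star d) * n = (star n * star n) * (n * d * star d * n)"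
    by (simp add: mult.assoc)
  finally show ?thesis by (simp add: nn' star_mult_self_eq_0)
qed

lemma free_normalizer_mult:
  assumes n: "n \<in> free_normalizers D" and d: "d \<in> D"
  shows "star (n * d) * (n * d) \<in> D" "(n * d) * star (n * d) \<in> D" "(n * d) * (n * d) = 0"
    "n * d \<in> free_normalizers D"
proof -
  have nN: "n \<in> normalizers D" using n by (auto simp: free_normalizers_def)
  have N: "n * b * star n \<in> D" "star n * b * n \<in> D" if "b \<in> D" for b
    using nN that by (auto simp: normalizers_def)
  show "star (n * d) * (n * d) \<in> D"
    using mem_mult[OF mem_star[OF d] normalizer_square_mult[OF nN d]] by (simp add: star_mult mult.assoc)
  show "(n * d) * star (n * d) \<in> D"
    using N(1)[of "d * star d"] d by (simp add: star_mult mult.assoc)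
  show sq: "(n * d) * (n * d) = 0"
    using free_normalizer_sandwich[OF n d] by (simp flip: mult.assoc)
  have "n * d * b * star (n * d) \<in> D \<and> star (n * d) * b * (n * d) \<in> D" if b: "b \<in> D" for b
  proof
    have "n * (d * b * star d) * star n \<in> D" using d b by (intro N(1)) simp
    then show "n * d * b * star (n * d) \<in> D" by (simp only: star_mult mult.assoc)
    have "star d * (star n * b * n) * d \<in> D" using d N(2)[OF b] by simp
    then show "star (n * d) * b * (n * d) \<in> D" by (simp only: star_mult mult.assoc)
  qed
  then have "n * d \<in> normalizers D" by (simp only: normalizers_def mem_Collect_eq) blast
  then show "n * d \<in> free_normalizers D" using sq by (simp only: free_normalizers_def mem_Collect_eq)
qed

lemma P_free_normalizer_commutant:
  assumes x: "\<And>d. d \<in> D \<Longrightarrow> x * d = d * x" and n: "n \<in> free_normalizers D"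
  shows "P (x * n) = 0"
proof (rule eq_zero_if_annihilates)
  fix d assume d: "d \<in> D"
  have "P (x * n) * d = P (x * (n * d))" using d by (simp add: P_right mult.assoc flip: P_right)
  also have "\<dots> = 0" using x free_normalizer_mult(1-3)[OF n d] by (rule P_nilpotent)
  finally show "P (x * n) * d = 0" .
qed simp

lemma P_free_normalizer: "n \<in> free_normalizers D \<Longrightarrow> P n = 0"
  using P_free_normalizer_commutant[of "star (P n)" n] P_left[of "star (P n)" n]
  by (simp add: comm star_mult_self_eq_0 mult_star_self_eq_0)

lemma closure_span_free_subset: "closure (complex_vector.span (free_normalizers D)) \<subseteq> {a. P a = 0}"
  using P_free_normalizer closed_subspace_ker by (intro closure_span_subset) auto

lemma kumjian_imp_masa:
  assumes dense: "closure (complex_vector.span (free_normalizers D)) = {a. P a = 0}"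
  shows "masa_inclusion D"
  unfolding masa_inclusion_def
proof (intro conjI allI impI inclusion)
  fix B assume B: "cstar_subalgebra B \<and> abelian B \<and> D \<subseteq> B"
  have "b \<in> D" if b: "b \<in> B" for b
  proof -
    define x where "x = b - P b"
    have "star b \<in> B" using B b by (auto simp: cstar_subalgebra_def)
    have sx: "star x * d = d * star x" if d: "d \<in> D" for d
    proof -
      have "star b * d = d * star b" using \<open>star b \<in> B\<close> d B unfolding abelian_def by blast
      then show ?thesis using comm[OF mem_star[OF P_mem] d] by (simp add: x_def star_diff algebra_simps)
    qed
    have "free_normalizers D \<subseteq> {a. P (star x * a) = 0}"
      using P_free_normalizer_commutant[OF sx] by blast
    then have "{a. P a = 0} \<subseteq> {a. P (star x * a) = 0}"
      unfolding dense[symmetric] by (intro closure_span_subset closed_subspace_P_mult)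
    moreover have "P x = 0" by (simp add: x_def P_diff P_id)
    ultimately have "x = 0" using P_faithful by blast
    then show ?thesis using P_mem[of b] by (simp add: x_def)
  qed
  then show "B = D" using B by blast
qed

lemma D_subset_normalizers: "D \<subseteq> normalizers D"
  by (auto simp: normalizers_def)

lemma kumjian_imp_regular:
  assumes dense: "closure (complex_vector.span (free_normalizers D)) = {a. P a = 0}"
  shows "regular_inclusion D"
  unfolding regular_inclusion_def
proof (intro conjI inclusion)
  let ?M = "closure (complex_vector.span (normalizers D))"
  have "{a. P a = 0} \<subseteq> ?M"
    unfolding dense[symmetric] using subset_closure_span[of "normalizers D"]
    by (intro closure_span_subset subspace_closure_span) (auto simp: free_normalizers_def)
  then have "a - P a \<in> ?M" for a by (auto simp: P_diff P_id)
  moreover have "P a \<in> ?M" for a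
    using D_subset_normalizers subset_closure_span[of "normalizers D"] P_mem[of a] by blast
  ultimately have "(a - P a) + P a \<in> ?M" for a
    using subspace_closure_span by (intro complex_vector.subspace_add)
  then show "?M = UNIV" by auto
qed

lemma state_expectation:
  assumes f: "state_on D f"
  shows "state_on UNIV (\<lambda>a. f (P a))"
proof (rule state_onI[OF _ cstar_subalgebra_UNIV])
  interpret f: positive_functional_on D f
    using cstar_subalgebra state_on_positive[OF f] by unfold_locales
  have "f (P (star x * x)) \<in> \<real>\<^sub>\<ge>\<^sub>0" for x
    using P_square[of x] f.f by (auto simp: positive_functional_def)
  then show "positive_functional UNIV (\<lambda>a. f (P a))"
    by (simp add: positive_functional_def P_add P_scaleC f.add f.scale)
  show "cmod (f (P x)) \<le> norm x" for x
    using state_on_norm_le[OF f cstar_subalgebra P_mem[of x]] norm_P[of x] by simp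
  fix s :: real assume "s < 1"
  then obtain x where "x \<in> D" "norm x \<le> 1" "s < cmod (f x)"
    using state_on_approx[OF f cstar_subalgebra] by blast
  then show "\<exists>x\<in>UNIV. norm x \<le> 1 \<and> s < cmod (f (P x))" using P_id by auto
qed

lemma bounded_linear_state:
  assumes g: "state_on UNIV g"
  shows "bounded_linear (g :: 'a \<Rightarrow> complex)"
proof -
  interpret g: positive_functional_on UNIV g
    using cstar_subalgebra_UNIV state_on_positive[OF g] by unfold_locales
  show ?thesis
    using state_on_norm_le[OF g cstar_subalgebra_UNIV]
    by (intro bounded_linear_intro[where K = 1])
      (auto simp: g.add g.scale scaleR_scaleC scaleR_conv_of_real)
qed

lemma closed_subspace_state_ker:
  assumes g: "state_on UNIV (g :: 'a \<Rightarrow> complex)"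
  shows "complex_vector.subspace {a. g a = 0}" "closed {a. g a = 0}"
proof -
  interpret g: positive_functional_on UNIV g
    using cstar_subalgebra_UNIV state_on_positive[OF g] by unfold_locales
  show "complex_vector.subspace {a. g a = 0}"
    by (rule complex_vector.subspaceI) (simp_all add: g.add g.scale g.zero)
  show "closed {a. g a = 0}"
    by (rule closed_kernel[OF bounded_linear_state[OF g]])
qed

lemma state_vanishes:
  assumes g: "state_on UNIV g" and d: "d \<in> D" "g (star d * d) = 0"
  shows "g (a * d) = 0" "g (star d * a) = 0"
proof -
  interpret g: positive_functional_on UNIV g
    using cstar_subalgebra_UNIV state_on_positive[OF g] by unfold_locales
  show "g (a * d) = 0" using g.Cauchy_Schwarz_eq_0[of "star a" d] d by simp
  show "g (star d * a) = 0" using g.Cauchy_Schwarz_eq_0[of d a] d by simp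
qed

lemma state_free_normalizer:
  assumes masa: "masa_inclusion D" and \<phi>: "character \<phi>" and g: "state_on UNIV g"
    and ext: "\<And>d. d \<in> D \<Longrightarrow> g d = \<phi> d" and n: "n \<in> free_normalizers D"
  shows "g n = 0"
proof -
  have nN: "n \<in> normalizers D" and nn: "n * n = 0" using n by (auto simp: free_normalizers_def)
  define k v where "k = star n * n" and "v = n * star n"
  have D: "k \<in> D" "v \<in> D" using masa_normalizer_square[OF masa nN] by (simp_all add: k_def v_def)
  have null: "g (a * d) = 0" "g (d * a) = 0" if d: "d \<in> D" "\<phi> d = 0" for a d
  proof -
    have z1: "g (star d * d) = 0"
      unfolding ext[OF mem_mult[OF mem_star[OF d(1)] d(1)]]
        characterD(3)[OF \<phi> mem_star[OF d(1)] d(1)] d(2) by simp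
    have z2: "g (star (star d) * star d) = 0"
      unfolding star_star ext[OF mem_mult[OF d(1) mem_star[OF d(1)]]]
        characterD(3)[OF \<phi> d(1) mem_star[OF d(1)]] d(2) by simp
    show "g (a * d) = 0" by (rule state_vanishes(1)[OF g d(1) z1])
    show "g (d * a) = 0" using state_vanishes(2)[OF g mem_star[OF d(1)] z2] by (simp only: star_star)
  qed
  have lim0: "g y = 0" if "z \<longlonglongrightarrow> y" "\<And>j. g (z j) = 0" for y and z :: "nat \<Rightarrow> 'a"
    using bounded_linear.tendsto[OF bounded_linear_state[OF g] that(1)]
    unfolding that(2) by (simp add: LIMSEQ_const_iff)
  have "k * v = star n * (n * n) * star n" by (simp only: k_def v_def mult.assoc)
  then have "k * v = 0" by (simp add: nn)
  then have "\<phi> k * \<phi> v = 0"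
    using characterD(3)[OF \<phi> D] characterD(2)[OF \<phi> mem_zero, of 0] by simp
  then consider "\<phi> k = 0" | "\<phi> v = 0" by auto
  then show ?thesis
  proof cases
    case 1
    obtain e where e: "\<And>j. e j \<in> D" "\<And>j. star (e j) = e j"
      "\<And>j. \<exists>s d. d \<in> D \<and> e j = s *\<^sub>C (star n * n) + star n * n * d" "(\<lambda>j::nat. n * e j) \<longlonglongrightarrow> n"
      by (rule approx_unit_right[OF D(1)[unfolded k_def]]) (rule that)
    have "\<phi> (e j) = 0" for j
      using e(3)[of j, folded k_def] 1 D(1) by (elim exE conjE) (simp add: characterD(1-3)[OF \<phi>])
    then have "g (n * e j) = 0" for j by (rule null(1)[OF e(1)])
    then show ?thesis by (rule lim0[OF e(4)])
  next
    case 2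
    obtain e where e: "\<And>j. e j \<in> D" "\<And>j. star (e j) = e j"
      "\<And>j. \<exists>s d. d \<in> D \<and> e j = s *\<^sub>C (n * star n) + n * star n * d" "(\<lambda>j::nat. e j * n) \<longlonglongrightarrow> n"
      by (rule approx_unit_left[OF D(2)[unfolded v_def]]) (rule that)
    have "\<phi> (e j) = 0" for j
      using e(3)[of j, folded v_def] 2 D(2) by (elim exE conjE) (simp add: characterD(1-3)[OF \<phi>])
    then have "g (e j * n) = 0" for j by (rule null(2)[OF e(1)])
    then show ?thesis by (rule lim0[OF e(4)])
  qed
qed

lemma kumjian_imp_unique_extension:
  assumes dense: "closure (complex_vector.span (free_normalizers D)) = {a. P a = 0}"
  shows "pure_states_extend_uniquely D"
  unfolding pure_states_extend_uniquely_def
proof (intro allI impI)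
  fix f assume pure: "pure_state_on D f"
  have st: "state_on D f" using pure by (simp add: pure_state_on_def)
  note \<phi> = pure_state_character[OF pure]
  note masa = kumjian_imp_masa[OF dense]
  show "\<exists>!g. state_on UNIV g \<and> (\<forall>d\<in>D. g d = f d)"
  proof (rule ex1I)
    show "state_on UNIV (\<lambda>a. f (P a)) \<and> (\<forall>d\<in>D. f (P d) = f d)"
      using state_expectation[OF st] P_id by simp
    fix g assume g: "state_on UNIV g \<and> (\<forall>d\<in>D. g d = f d)"
    interpret g: positive_functional_on UNIV g
      using cstar_subalgebra_UNIV state_on_positive[OF conjunct1[OF g]] by unfold_locales
    have "free_normalizers D \<subseteq> {a. g a = 0}"
      using state_free_normalizer[OF masa \<phi>, of g] g by blast
    then have "{a. P a = 0} \<subseteq> {a. g a = 0}"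
      unfolding dense[symmetric] using closed_subspace_state_ker[of g] g by (intro closure_span_subset) auto
    moreover have "P (a - P a) = 0" for a by (simp add: P_diff P_id)
    ultimately have "g (a - P a) = 0" for a by blast
    then have "g a = f (P a)" for a using g.diff[of a "P a"] g by simp
    then show "g = (\<lambda>a. f (P a))" by (rule ext)
  qed
qed

lemma no_state_annihilates:
  assumes masa: "masa_inclusion D" and reg: "regular_inclusion D"
    and f: "state_on UNIV f" "\<And>d. d \<in> D \<Longrightarrow> f d = 0"
  shows False
proof -
  have "f n = 0" if n: "n \<in> normalizers D" for n
  proof -
    obtain e where e: "\<And>j. e j \<in> D" "\<And>j. star (e j) = e j"
      "\<And>j. \<exists>s d. d \<in> D \<and> e j = s *\<^sub>C (star n * n) + star n * n * d" "(\<lambda>j::nat. n * e j) \<longlonglongrightarrow> n"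
      by (rule approx_unit_right[OF masa_normalizer_square(1)[OF masa n]]) (rule that)
    have "f (n * e j) = 0" for j
      using state_vanishes(1)[OF f(1) e(1)[of j]] f(2) e(1) by simp
    then show ?thesis
      using bounded_linear.tendsto[OF bounded_linear_state[OF f(1)] e(4)] by (simp add: LIMSEQ_const_iff)
  qed
  then have "closure (complex_vector.span (normalizers D)) \<subseteq> {a. f a = 0}"
    using closed_subspace_state_ker[OF f(1)] by (intro closure_span_subset) auto
  then have "f a = 0" for a using reg by (auto simp: regular_inclusion_def)
  then show False using state_on_approx[OF f(1) cstar_subalgebra_UNIV, of 0] by auto
qed

end

section \<open>From unique extension to free normalizers\<close>

context comm_cstar
begin

interpretation unit: unital_comm_cstar "unitization_set D"
  by (rule unital_comm_cstar_unitization)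

lemma characters_separated_by_product:
  assumes \<sigma>: "character \<sigma>" and \<tau>: "character \<tau>" and x: "x \<in> D" "\<sigma> x \<noteq> 0" and y: "y \<in> D" "\<tau> y \<noteq> 0"
    and d: "d \<in> D" "\<sigma> d \<noteq> \<tau> d"
  obtains a b where "a \<in> D" "b \<in> D" "a * b = 0" "\<sigma> a \<noteq> 0" "\<tau> b \<noteq> 0"
proof -
  define S T where "S z = \<sigma> (alg_part z) + scal_part z" and "T z = \<tau> (alg_part z) + scal_part z" for z
  have ext_mult: "\<phi> (alg_part (z * w)) + scal_part (z * w) =
      (\<phi> (alg_part z) + scal_part z) * (\<phi> (alg_part w) + scal_part w)"
    if "character \<phi>" "z \<in> unitization_set D" "w \<in> unitization_set D" for \<phi> z w
    using that(2,3) by (simp add: characterD(1-3)[OF that(1)] algebra_simps)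
  have ext_diff: "\<phi> (alg_part (z - w)) + scal_part (z - w) =
      (\<phi> (alg_part z) + scal_part z) - (\<phi> (alg_part w) + scal_part w)"
    if "character \<phi>" "z \<in> unitization_set D" "w \<in> unitization_set D" for \<phi> z w
    using that(2,3) by (simp add: characterD(5)[OF that(1)])
  have ext_star: "\<phi> (alg_part (star z)) + scal_part (star z) = cnj (\<phi> (alg_part z) + scal_part z)"
    if "character \<phi>" "z \<in> unitization_set D" for \<phi> z
    using that(2) by (simp add: characterD(4)[OF that(1)])
  note S = ext_mult[OF \<sigma>, folded S_def] ext_diff[OF \<sigma>, folded S_def] ext_star[OF \<sigma>, folded S_def]
  note T = ext_mult[OF \<tau>, folded T_def] ext_diff[OF \<tau>, folded T_def] ext_star[OF \<tau>, folded T_def]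
  obtain f where f: "f \<in> unitization_set D" "star f = f" "S f = - T f" "S f \<noteq> 0" "S f \<in> \<real>"
  proof -
    obtain g where g: "g \<in> D" "star g = g" "\<sigma> g \<noteq> \<tau> g"
    proof -
      obtain a b where D: "a \<in> D" "b \<in> D" "star a = a" "star b = b" and dab: "d = a + \<i> *\<^sub>C b"
        using cartesian_decomposition[OF d(1)] by metis
      have "\<sigma> d = \<sigma> a + \<i> * \<sigma> b" "\<tau> d = \<tau> a + \<i> * \<tau> b"
        unfolding dab using D by (simp_all add: characterD(1,2)[OF \<sigma>] characterD(1,2)[OF \<tau>])
      then have "\<sigma> a \<noteq> \<tau> a \<or> \<sigma> b \<noteq> \<tau> b" using d(2) by auto
      then show ?thesis using that D by blast
    qed
    have real: "\<phi> g = of_real (Re (\<phi> g))" if "character \<phi>" for \<phi>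
      using characterD(4)[OF that g(1)] g(2) by (simp add: complex_eq_iff)
    define m where "m = (Re (\<sigma> g) + Re (\<tau> g)) / 2"
    let ?f = "emb g - of_real m"
    have "\<sigma> g - of_real m = of_real ((Re (\<sigma> g) - Re (\<tau> g)) / 2)"
      by (subst real[OF \<sigma>]) (simp add: m_def complex_eq_iff field_simps)
    moreover have "\<tau> g - of_real m = - of_real ((Re (\<sigma> g) - Re (\<tau> g)) / 2)"
      by (subst real[OF \<tau>]) (simp add: m_def complex_eq_iff field_simps)
    moreover have "Re (\<sigma> g) \<noteq> Re (\<tau> g)" using g(3) real[OF \<sigma>] real[OF \<tau>] by metis
    moreover have "S ?f = \<sigma> g - of_real m" "T ?f = \<tau> g - of_real m" by (simp_all add: S_def T_def)
    ultimately have "S ?f = - T ?f" "S ?f \<noteq> 0" "S ?f \<in> \<real>" by (simp_all del: of_real_divide of_real_diff)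
    moreover have "?f \<in> unitization_set D" using g by simp
    moreover have "star ?f = ?f" using g(2) by (simp add: star_diff flip: emb_star)
    ultimately show ?thesis using that by blast
  qed
  obtain c where c: "c \<in> unit.cone" "f * f = c * c"
    using unit.cone_sqrt[OF unit.coneI[OF f(1)]] f(2) by metis
  have cD: "c \<in> unitization_set D" using unit.cone_subset[OF c(1)] .
  obtain b where b: "b \<in> unitization_set D" "c = star b * b" using c(1) unfolding unit.cone_def by blast
  have nonneg: "S c = of_real ((cmod (S b))\<^sup>2)" "T c = of_real ((cmod (T b))\<^sup>2)"
    using b by (simp_all add: S T complex_norm_square mult.commute del: of_real_power unitization_set_iff)
  define s where "s = Re (S f)"
  have Sf: "S f = of_real s" "T f = of_real (- s)" "s \<noteq> 0"
  proof -
    show "S f = of_real s" using f(5) by (simp add: s_def complex_is_Real_iff complex_eq_iff)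
    then show "T f = of_real (- s)" "s \<noteq> 0" using f(3,4) by (auto simp: minus_equation_iff)
  qed
  have "S c * S c = S f * S f" "T c * T c = T f * T f"
    using S(1)[OF cD cD] S(1)[OF f(1) f(1)] T(1)[OF cD cD] T(1)[OF f(1) f(1)] c(2) by simp_all
  then have sq: "((cmod (S b))\<^sup>2)\<^sup>2 = s\<^sup>2" "((cmod (T b))\<^sup>2)\<^sup>2 = s\<^sup>2"
    unfolding nonneg Sf by (simp_all only: of_real_mult[symmetric] of_real_eq_iff) (simp_all add: power2_eq_square)
  have abs: "(cmod (S b))\<^sup>2 = \<bar>s\<bar>" "(cmod (T b))\<^sup>2 = \<bar>s\<bar>"
    using sq by (metis abs_of_nonneg power2_eq_iff_nonneg power2_abs abs_ge_zero zero_le_power2)+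
  have Sc: "S c = of_real \<bar>s\<bar>" "T c = of_real \<bar>s\<bar>" using nonneg abs by simp_all
  define p q where "p = (if s > 0 then c + f else c - f)" and "q = (if s > 0 then c - f else c + f)"
  have cf: "c * f = f * c" using cD f(1) by (rule unit.comm)
  have pq: "p \<in> unitization_set D" "q \<in> unitization_set D" "p * q = 0"
    using cD f(1) c(2) cf by (simp_all add: p_def q_def algebra_simps)
  have add_eq: "c + f = c - (0 - f)" by simp
  have zero: "S 0 = 0" "T 0 = 0"
    using characterD(2)[OF \<sigma> mem_zero, of 0] characterD(2)[OF \<tau> mem_zero, of 0] by (simp_all add: S_def T_def)
  have Sadd: "S (c + f) = S c + S f" "T (c + f) = T c + T f"
    unfolding add_eq using cD f(1) by (simp_all only: S(2) T(2) unit.mem_diff unit.mem_zero zero) simp_all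
  have "S p = of_real (2 * \<bar>s\<bar>)"
  proof (cases "s > 0")
    case True
    then have "S p = of_real (\<bar>s\<bar> + s)" by (simp only: p_def if_True Sadd Sc Sf(1) of_real_add)
    then show ?thesis using True by simp
  next
    case False
    then have "S p = of_real (\<bar>s\<bar> - s)"
      by (simp only: p_def if_False S(2)[OF cD f(1)] Sc Sf(1) of_real_diff)
    then show ?thesis using False by simp
  qed
  moreover have "T q = of_real (2 * \<bar>s\<bar>)"
  proof (cases "s > 0")
    case True
    then have "T q = of_real (\<bar>s\<bar> - (- s))"
      by (simp only: q_def if_True T(2)[OF cD f(1)] Sc Sf(2) of_real_diff)
    then show ?thesis using True by simp
  next
    case False
    then have "T q = of_real (\<bar>s\<bar> + (- s))"
      by (simp only: q_def if_False Sadd Sc Sf(2) of_real_add)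
    then show ?thesis using False by simp
  qed
  ultimately have "S p \<noteq> 0" "T q \<noteq> 0" using Sf(3) by simp_all
  define a' b' where "a' = alg_part (p * emb x)" and "b' = alg_part (q * emb y)"
  have emb': "emb a' = p * emb x" "emb b' = q * emb y"
    unfolding a'_def b'_def by (rule emb_alg_part; simp)+
  have D': "a' \<in> D" "b' \<in> D" using pq x y by (simp_all add: a'_def b'_def)
  have "emb (a' * b') = p * q * (emb x * emb y)"
  proof -
    have "emb x * (q * emb y) = q * (emb x * emb y)" using x(1) pq(2) by (intro unit.left_comm) simp_all
    then show ?thesis by (simp only: emb_mult emb' mult.assoc)
  qed
  then have ab0: "a' * b' = 0" by (metis emb_eq_iff emb_zero mult_zero_left pq(3))
  have "S (p * emb x) = S p * \<sigma> x" "T (q * emb y) = T q * \<tau> y"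
    using S(1)[OF pq(1), of "emb x"] T(1)[OF pq(2), of "emb y"] x y by (simp_all add: S_def T_def)
  then have "\<sigma> a' \<noteq> 0" "\<tau> b' \<noteq> 0"
    using \<open>S p \<noteq> 0\<close> \<open>T q \<noteq> 0\<close> x(2) y(2) by (simp_all add: S_def T_def a'_def b'_def)
  with D' ab0 show ?thesis by (rule that)
qed

end

context faithful_expectation
begin

lemma sandwich_state:
  assumes PU: "pure_states_extend_uniquely D"
    and \<sigma>: "character \<sigma>" and u: "u \<in> D" "\<sigma> u \<noteq> 0"
    and K: "\<sigma> (P (star y * y)) = of_real K"
    and y: "\<And>d. d \<in> D \<Longrightarrow> \<sigma> (P (star y * d * y)) = \<sigma> d * of_real K"
  shows "\<sigma> (P (star y * a * y)) = of_real K * \<sigma> (P a)"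
proof -
  define \<rho> where "\<rho> a = \<sigma> (P a)" for a
  define R where "R a = \<rho> (star y * a * y)" for a
  have pure: "pure_state_on D \<sigma>" using \<sigma> u by (rule character_pure_state)
  then have st: "state_on D \<sigma>" by (simp add: pure_state_on_def)
  have st_\<rho>: "state_on UNIV \<rho>" unfolding \<rho>_def by (rule state_expectation[OF st])
  interpret \<rho>: positive_functional_on UNIV \<rho>
    using cstar_subalgebra_UNIV state_on_positive[OF st_\<rho>] by unfold_locales
  have K': "\<rho> (star y * y) = of_real K" using K by (simp add: \<rho>_def)
  have K0: "0 \<le> K" using \<rho>.square_nonneg[of y] K' by simp
  have bound: "cmod (R a) \<le> K * norm a" for a
  proof (cases "a = 0")
    case True
    then show ?thesis using \<rho>.zero by (simp add: R_def)
  next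
    case False
    define n2 where "n2 = (norm a)\<^sup>2"
    have n2: "n2 > 0" using False by (simp add: n2_def)
    define z where "z = (1 / n2) *\<^sub>R (star a * a)"
    have z: "star z = z" "norm z \<le> 1"
      using n2 by (simp_all add: z_def star_scaleR star_mult cstar_identity n2_def)
    obtain w where w: "star w = w" "norm w \<le> 1" "w + w - w * w = z"
      "\<And>S. cstar_subalgebra S \<Longrightarrow> z \<in> S \<Longrightarrow> w \<in> S"
      by (rule cstar_sqrt[OF z]) (rule that)
    have aa: "star a * a = complex_of_real n2 *\<^sub>C z"
      using n2 by (simp add: z_def scaleR_scaleC scaleC_scaleC)
    have "star (y - w * y) * (y - w * y) = star y * y - star y * (w + w - w * w) * y"
      by (simp add: star_diff star_mult w(1) algebra_simps)
    then have "\<rho> (star (y - w * y) * (y - w * y)) = of_real K - \<rho> (star y * z * y)"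
      unfolding w(3) by (simp add: \<rho>.diff K')
    then have "Re (\<rho> (star y * z * y)) \<le> K"
      using \<rho>.square_nonneg[of "y - w * y"] by simp
    moreover have "star (a * y) * (a * y) = complex_of_real n2 *\<^sub>C (star y * z * y)"
      using aa by (simp add: star_mult mult.assoc mult_scaleC_left mult_scaleC_right)
        (metis aa mult.assoc mult_scaleC_left mult_scaleC_right)
    ultimately have "Re (\<rho> (star (a * y) * (a * y))) \<le> n2 * K"
      using n2 by (simp add: \<rho>.scale)
    then have "Re (\<rho> (star y * y)) * Re (\<rho> (star (a * y) * (a * y))) \<le> K * (n2 * K)"
      using K0 K' by (simp add: mult_left_mono)
    moreover have "(cmod (R a))\<^sup>2 \<le> Re (\<rho> (star y * y)) * Re (\<rho> (star (a * y) * (a * y)))"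
      using \<rho>.Cauchy_Schwarz[of y "a * y"] by (simp add: R_def mult.assoc)
    ultimately have "(cmod (R a))\<^sup>2 \<le> (K * norm a)\<^sup>2"
      by (simp add: n2_def power2_eq_square mult_ac)
    then show ?thesis using K0 by (intro power2_le_imp_le[of "cmod (R a)"]) auto
  qed
  have "R a = of_real K * \<rho> a"
  proof (cases "K = 0")
    case True
    then show ?thesis using bound[of a] by simp
  next
    case False
    then have K: "K > 0" using K0 by simp
    define g where "g a = R a / of_real K" for a
    have "state_on UNIV g"
    proof (rule state_onI[OF _ cstar_subalgebra_UNIV])
      have "g (star x * x) \<in> \<real>\<^sub>\<ge>\<^sub>0" for x
      proof -
        have "R (star x * x) = \<rho> (star (x * y) * (x * y))" by (simp add: R_def star_mult mult.assoc)
        then have "R (star x * x) \<in> \<real>\<^sub>\<ge>\<^sub>0"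
          using \<rho>.f by (simp add: positive_functional_def)
        then show ?thesis unfolding g_def using K by (intro nonneg_Reals_divide_I) auto
      qed
      then show "positive_functional UNIV g"
        by (simp add: positive_functional_def g_def R_def distrib_left distrib_right \<rho>.add
            add_divide_distrib mult_scaleC_left mult_scaleC_right \<rho>.scale)
      show "cmod (g x) \<le> norm x" for x
        using bound[of x] K by (simp add: g_def norm_divide field_simps)
      fix s :: real assume "s < 1"
      then obtain x where x: "x \<in> D" "norm x \<le> 1" "s < cmod (\<sigma> x)"
        using state_on_approx[OF st cstar_subalgebra] by blast
      have "g x = \<sigma> x" using y[OF x(1)] K by (simp add: g_def R_def \<rho>_def)
      then show "\<exists>x\<in>UNIV. norm x \<le> 1 \<and> s < cmod (g x)" using x by auto
    qed
    moreover have "\<forall>d\<in>D. g d = \<sigma> d" using y K by (simp add: g_def R_def \<rho>_def)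
    moreover have "\<forall>d\<in>D. \<rho> d = \<sigma> d" by (simp add: \<rho>_def P_id)
    moreover have "\<exists>!g. state_on UNIV g \<and> (\<forall>d\<in>D. g d = \<sigma> d)"
      using PU pure by (simp add: pure_states_extend_uniquely_def)
    ultimately have "g = \<rho>" using st_\<rho> by (metis (no_types, lifting))
    then have "g a = \<rho> a" by simp
    then show ?thesis using K by (simp add: g_def field_simps)
  qed
  then show ?thesis by (simp add: R_def \<rho>_def)
qed

text \<open>
  If \<open>n\<close> fixes the character \<open>\<sigma>\<close>, then the functionals \<open>a \<mapsto> \<sigma> (P (y\<^sup>* a y))\<close> with
  \<open>y = u + z n\<close> and \<open>z\<close> complex restrict to multiples of \<open>\<sigma>\<close>, so unique extension and
  polarization in \<open>z\<close> apply.
\<close>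

lemma fixed_character:
  assumes PU: "pure_states_extend_uniquely D" and n: "n \<in> normalizers D" and k: "star n * n \<in> D"
    and \<sigma>: "character \<sigma>" and u0: "u0 \<in> D" "\<sigma> u0 \<noteq> 0"
    and fixed: "\<And>d. d \<in> D \<Longrightarrow> \<sigma> (star n * d * n) = \<sigma> d * \<sigma> (star n * n)"
  shows "\<sigma> (star n * n) = of_real ((cmod (\<sigma> (P n)))\<^sup>2)"
proof -
  define u where "u = (1 / \<sigma> u0) *\<^sub>C u0"
  have u: "u \<in> D" "\<sigma> u = 1" "\<sigma> (star u) = 1" using u0 by (simp_all add: u_def characterD[OF \<sigma>])
  define h where "h = P n"
  have hD: "h \<in> D" by (simp add: h_def)
  have sh: "P (star n) = star h" by (simp add: h_def P_star)
  define c where "c = (cmod (\<sigma> (P n)))\<^sup>2"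
  define k' where "k' = Re (\<sigma> (star n * n))"
  have "cnj (\<sigma> (star n * n)) = \<sigma> (star n * n)"
    using characterD(4)[OF \<sigma> k] by (simp add: star_mult)
  then have k': "\<sigma> (star n * n) = of_real k'" by (simp add: k'_def complex_eq_iff)
  have expand: "\<sigma> (P (star (u + z *\<^sub>C n) * a * (u + z *\<^sub>C n))) =
      \<sigma> (P a) + z * \<sigma> (P (a * n)) + cnj z * \<sigma> (P (star n * a)) + cnj z * z * \<sigma> (P (star n * a * n))" for z a
  proof -
    have "star (u + z *\<^sub>C n) * a * (u + z *\<^sub>C n) =
        star u * a * u + z *\<^sub>C (star u * (a * n)) + cnj z *\<^sub>C (star n * a * u)
          + (cnj z * z) *\<^sub>C (star n * a * n)"
      by (simp add: star_add star_scaleC distrib_left distrib_right mult_scaleC_left mult_scaleC_right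
          scaleC_scaleC scaleC_add_right mult.assoc add.assoc add.left_commute mult.commute[of z])
    then have "P (star (u + z *\<^sub>C n) * a * (u + z *\<^sub>C n)) =
        star u * P a * u + z *\<^sub>C (star u * P (a * n)) + cnj z *\<^sub>C (P (star n * a) * u)
          + (cnj z * z) *\<^sub>C P (star n * a * n)"
      using u(1) by (simp add: P_add P_scaleC P_left P_right)
    then show ?thesis using u by (simp add: characterD(1-3)[OF \<sigma>])
  qed
  have expand1: "\<sigma> (P (star (u + z *\<^sub>C n) * (u + z *\<^sub>C n))) =
      1 + z * \<sigma> h + cnj z * \<sigma> (star h) + cnj z * z * \<sigma> (star n * n)" for z
  proof -
    have "star (u + z *\<^sub>C n) * (u + z *\<^sub>C n) =
        star u * u + z *\<^sub>C (star u * n) + cnj z *\<^sub>C (star n * u) + (cnj z * z) *\<^sub>C (star n * n)"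
      by (simp add: star_add star_scaleC distrib_left distrib_right mult_scaleC_left mult_scaleC_right
          scaleC_scaleC scaleC_add_right mult.assoc add.assoc add.left_commute mult.commute[of z])
    then have "P (star (u + z *\<^sub>C n) * (u + z *\<^sub>C n)) =
        star u * u + z *\<^sub>C (star u * h) + cnj z *\<^sub>C (star h * u) + (cnj z * z) *\<^sub>C (star n * n)"
      using u(1) k by (simp add: P_add P_scaleC P_left P_right P_id sh) (simp add: h_def)
    then show ?thesis using u hD k by (simp add: characterD(1-3)[OF \<sigma>])
  qed
  have K: "\<sigma> (P (star (u + z *\<^sub>C n) * (u + z *\<^sub>C n))) =
      of_real (1 + 2 * Re (z * \<sigma> h) + (cmod z)\<^sup>2 * k')" for z
  proof -
    have "z * \<sigma> h + cnj z * \<sigma> (star h) = of_real (2 * Re (z * \<sigma> h))"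
      using characterD(4)[OF \<sigma> hD] by (simp add: complex_eq_iff)
    moreover have "cnj z * z = of_real ((cmod z)\<^sup>2)" by (simp only: complex_norm_square mult.commute)
    ultimately show ?thesis
      unfolding expand1 k' by (simp only: add.assoc of_real_add of_real_mult of_real_1)
  qed
  have "\<sigma> (P (star (u + z *\<^sub>C n) * d * (u + z *\<^sub>C n))) =
      \<sigma> d * of_real (1 + 2 * Re (z * \<sigma> h) + (cmod z)\<^sup>2 * k')" if d: "d \<in> D" for z d
  proof -
    have "star n * d * n \<in> D" using n d by (simp add: normalizers_def)
    then have "\<sigma> (P (star (u + z *\<^sub>C n) * d * (u + z *\<^sub>C n))) =
        \<sigma> d * (1 + z * \<sigma> h + cnj z * \<sigma> (star h) + cnj z * z * \<sigma> (star n * n))"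
      unfolding expand using d hD fixed[OF d]
      by (simp add: P_id P_left P_right sh characterD(3)[OF \<sigma>]) (simp add: h_def[symmetric] characterD(3)[OF \<sigma>] algebra_simps)
    then show ?thesis unfolding K[symmetric] expand1 .
  qed
  note sandwich = sandwich_state[OF PU \<sigma> u0 K this]
  define b p q r where "b = star n" and "p = \<sigma> (P (b * n))" and "q = \<sigma> (P (star n * b))"
    and "r = \<sigma> (P (star n * b * n))"
  define B where "B = \<sigma> (P b)"
  have eq: "B + z * p + cnj z * q + cnj z * z * r =
      (1 + z * \<sigma> h + cnj z * \<sigma> (star h) + cnj z * z * \<sigma> (star n * n)) * B" for z
    using sandwich[of z b] unfolding expand K[symmetric] expand1 by (simp only: p_def q_def r_def B_def)
  have e1: "p + q + r = (\<sigma> h + \<sigma> (star h) + \<sigma> (star n * n)) * B"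
    using eq[of 1] by (simp add: algebra_simps)
  have e2: "r - p - q = (\<sigma> (star n * n) - \<sigma> h - \<sigma> (star h)) * B"
    using eq[of "-1"] by (simp add: algebra_simps)
  have e3: "\<i> * p - \<i> * q + r = (\<i> * \<sigma> h - \<i> * \<sigma> (star h) + \<sigma> (star n * n)) * B"
    using eq[of \<i>] by (simp add: algebra_simps)
  have "2 * r = 2 * (\<sigma> (star n * n) * B)" using arg_cong2[OF e1 e2, of "(+)"] by (simp add: algebra_simps)
  then have r: "r = \<sigma> (star n * n) * B" by simp
  have pq1: "p + q = (\<sigma> h + \<sigma> (star h)) * B" using e1 r by (simp add: algebra_simps)
  have "\<i> * (p - q) = \<i> * ((\<sigma> h - \<sigma> (star h)) * B)" using e3 r by (simp add: algebra_simps)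
  then have pq2: "p - q = (\<sigma> h - \<sigma> (star h)) * B" by simp
  have "2 * p = 2 * (\<sigma> h * B)" using arg_cong2[OF pq1 pq2, of "(+)"] by (simp add: algebra_simps)
  then have "p = \<sigma> h * B" by simp
  then have "\<sigma> (star n * n) = \<sigma> h * cnj (\<sigma> h)"
    using k characterD(4)[OF \<sigma> hD] by (simp add: p_def B_def b_def P_id sh)
  then show ?thesis by (simp only: complex_norm_square h_def)
qed

lemma normalizer_expectation_relation:
  assumes n: "n \<in> normalizers D" and masa: "masa_inclusion D" and d: "d \<in> D"
  shows "P n * (star n * d * n) = d * (star n * n) * P n"
proof -
  have v: "n * star n \<in> D" and k: "star n * n \<in> D" using masa_normalizer_square[OF masa n] by auto
  have b: "star n * d * n \<in> D" using n d by (simp add: normalizers_def)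
  have "P n * (star n * d * n) = P (n * (star n * d * n))" using P_right[OF b] by simp
  also have "n * (star n * d * n) = (n * star n) * d * n" by (simp only: mult.assoc)
  also have "(n * star n) * d = d * (n * star n)" using v d by (rule comm)
  also have "P (d * (n * star n) * n) = d * (n * star n) * P n" using d v by (intro P_left) simp
  also have "n * star n * P n = P n * (star n * n)"
    using P_left[OF v, of n] P_right[OF k, of n] by (simp add: mult.assoc)
  then have "d * (n * star n) * P n = d * (star n * n) * P n"
    using comm[OF k P_mem[of n]] by (simp add: mult.assoc)
  finally show ?thesis .
qed

lemma normalizer_character:
  assumes n: "n \<in> normalizers D" and masa: "masa_inclusion D"
    and \<sigma>: "character \<sigma>" and k: "\<sigma> (star n * n) \<noteq> 0"
  defines "\<tau> \<equiv> \<lambda>d. \<sigma> (star n * d * n) / \<sigma> (star n * n)"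
  shows "character \<tau>" "\<tau> (n * star n) \<noteq> 0"
proof -
  have vD: "n * star n \<in> D" and kD: "star n * n \<in> D" using masa_normalizer_square[OF masa n] by auto
  have bD: "star n * d * n \<in> D" if "d \<in> D" for d using n that by (simp add: normalizers_def)
  have "cnj (\<sigma> (star n * n)) = \<sigma> (star n * n)" using characterD(4)[OF \<sigma> kD] by (simp add: star_mult)
  note real = this
  have mult: "\<sigma> (star n * (x * y) * n) * \<sigma> (star n * n) = \<sigma> (star n * x * n) * \<sigma> (star n * y * n)"
    if xy: "x \<in> D" "y \<in> D" for x y
  proof -
    have "star n * x * n * (star n * y * n) = star n * (x * (n * star n * y)) * n" by (simp only: mult.assoc)
    also have "n * star n * y = y * (n * star n)" using vD xy(2) by (rule comm)
    also have "star n * (x * (y * (n * star n))) * n = star n * (x * y) * n * (star n * n)" by (simp only: mult.assoc)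
    finally show ?thesis
      using characterD(3)[OF \<sigma> bD[OF xy(1)] bD[OF xy(2)]] characterD(3)[OF \<sigma> bD[OF mem_mult[OF xy]] kD] by simp
  qed
  show "character \<tau>"
    unfolding character_def
  proof (intro conjI ballI allI)
    fix x assume x: "x \<in> D"
    show "\<tau> (c *\<^sub>C x) = c * \<tau> x" for c
      using bD[OF x] by (simp add: \<tau>_def mult_scaleC_left mult_scaleC_right characterD(2)[OF \<sigma>])
    have "star n * star x * n = star (star n * x * n)" by (simp add: star_mult mult.assoc)
    then show "\<tau> (star x) = cnj (\<tau> x)"
      using characterD(4)[OF \<sigma> bD[OF x]] real by (simp add: \<tau>_def)
    fix y assume y: "y \<in> D"
    show "\<tau> (x + y) = \<tau> x + \<tau> y"
      using characterD(1)[OF \<sigma> bD[OF x] bD[OF y]] by (simp add: \<tau>_def distrib_left distrib_right add_divide_distrib)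
    show "\<tau> (x * y) = \<tau> x * \<tau> y"
      unfolding \<tau>_def using mult[OF x y] k by (simp add: field_simps)
  qed
  have "star n * (n * star n) * n = (star n * n) * (star n * n)" by (simp only: mult.assoc)
  then show "\<tau> (n * star n) \<noteq> 0" using characterD(3)[OF \<sigma> kD kD] k by (simp add: \<tau>_def)
qed

lemma normalizer_minus_expectation:
  assumes PU: "pure_states_extend_uniquely D" and masa: "masa_inclusion D" and n: "n \<in> normalizers D"
  shows "n - P n \<in> closure (complex_vector.span (free_normalizers D))" (is "_ \<in> ?M")
proof -
  define h k where "h = P n" and "k = star n * n"
  have hD: "h \<in> D" by (simp add: h_def)
  have kD: "k \<in> D" and vD: "n * star n \<in> D" using masa_normalizer_square[OF masa n] by (auto simp: k_def)
  have bD: "star n * d * n \<in> D" if "d \<in> D" for d using n that by (simp add: normalizers_def)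
  have rel: "h * (star n * d * n) = d * k * h" if "d \<in> D" for d
    using normalizer_expectation_relation[OF n masa that] by (simp only: h_def k_def)
  have M: "complex_vector.subspace ?M" "closed ?M" by (rule subspace_closure_span, rule closed_closure)
  have M_right: "a * d \<in> ?M" if "a \<in> ?M" "d \<in> D" for a d
  proof -
    have "complex_vector.subspace {a. a * d \<in> ?M}"
      using M(1) by (auto simp: complex_vector.subspace_def distrib_right mult_scaleC_left)
    moreover have "closed {a. a * d \<in> ?M}"
      using closed_vimage[OF M(2) linear_continuous_on[OF bounded_linear_mult_left, of UNIV d]]
      by (simp add: vimage_def)
    moreover have "free_normalizers D \<subseteq> {a. a * d \<in> ?M}"
      using free_normalizer_mult(4)[OF _ that(2)] subset_closure_span[of "free_normalizers D"] by blast
    ultimately show ?thesis using closure_span_subset that(1) by blast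
  qed
  define J where "J = {e \<in> D. (n - h) * e \<in> ?M}"
  have J_sub: "complex_vector.subspace J"
    using M(1) by (auto simp: complex_vector.subspace_def J_def distrib_left mult_scaleC_right)
  have J_ideal: "e * d \<in> J" if "e \<in> J" "d \<in> D" for e d
    using M_right[of "(n - h) * e" d] that by (simp add: J_def mult.assoc)
  have "closed {e. (n - h) * e \<in> ?M}"
    using closed_vimage[OF M(2) linear_continuous_on[OF bounded_linear_mult_right, of UNIV "n - h"]]
    by (simp add: vimage_def)
  moreover have "J = D \<inter> {e. (n - h) * e \<in> ?M}" by (auto simp: J_def)
  ultimately have J_closed: "closed J" using closed by (simp add: closed_Int)
  have "k \<in> J"
  proof (rule ccontr)
    assume "k \<notin> J"
    then have kJ: "k \<notin> closure J" using J_closed by simp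
    obtain c where c: "c \<in> D" "k = star c * c"
      using square_in_D[of n] kD unfolding k_def by blast
    have JD: "J \<subseteq> D" by (auto simp: J_def)
    obtain \<sigma> where \<sigma>: "character \<sigma>" and \<sigma>J: "\<And>j. j \<in> J \<Longrightarrow> \<sigma> j = 0" and \<sigma>k: "\<sigma> k \<noteq> 0"
      using character_exists[OF JD J_sub J_ideal c kJ] by blast
    show False
    proof (cases "\<forall>d\<in>D. \<sigma> (star n * d * n) = \<sigma> d * \<sigma> k")
      case True
      have "(k - star h * h) * h = 0"
      proof (rule ccontr)
        define x where "x = (k - star h * h) * h"
        assume "(k - star h * h) * h \<noteq> 0"
        then have "star x * x \<noteq> 0" by (simp only: x_def star_mult_self_eq_0 not_False_eq_True)
        then have nz: "star x * x \<notin> closure {0}"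
          by (simp only: closure_closed[OF closed_singleton] singleton_iff not_False_eq_True)
        have xD: "x \<in> D" using kD hD by (simp add: x_def)
        have zero: "{0} \<subseteq> D" "\<And>j d. j \<in> {0} \<Longrightarrow> d \<in> D \<Longrightarrow> j * d \<in> {0}" by simp_all
        obtain \<tau> where \<tau>: "character \<tau>" "\<And>j. j \<in> {0} \<Longrightarrow> \<tau> j = 0" "\<tau> (star x * x) \<noteq> 0"
          using character_exists[OF zero(1) complex_vector.subspace_single_0 zero(2) xD refl nz] by blast
        have "\<tau> x \<noteq> 0" using \<tau>(3) unfolding characterD(3)[OF \<tau>(1) mem_star[OF xD] xD] by simp
        moreover have "\<tau> x = (\<tau> k - cnj (\<tau> h) * \<tau> h) * \<tau> h"
          unfolding x_def using kD hD by (simp add: characterD(3-5)[OF \<tau>(1)])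
        ultimately have \<tau>h: "\<tau> h \<noteq> 0" "\<tau> k \<noteq> cnj (\<tau> h) * \<tau> h" by auto
        have "\<tau> (star n * d * n) = \<tau> d * \<tau> k" if d: "d \<in> D" for d
        proof -
          have "\<tau> h * \<tau> (star n * d * n) = \<tau> (h * (star n * d * n))"
            by (rule characterD(3)[OF \<tau>(1) hD bD[OF d], symmetric])
          also have "\<dots> = \<tau> (d * k) * \<tau> h" unfolding rel[OF d]
            by (rule characterD(3)[OF \<tau>(1) mem_mult[OF d kD] hD])
          also have "\<tau> (d * k) = \<tau> d * \<tau> k" by (rule characterD(3)[OF \<tau>(1) d kD])
          finally show ?thesis using \<tau>h(1) by (simp add: mult.commute)
        qed
        then have "\<tau> k = of_real ((cmod (\<tau> h))\<^sup>2)"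
          unfolding k_def h_def
          by (rule fixed_character[OF PU n kD[unfolded k_def] \<tau>(1) hD \<tau>h(1)])
        then show False using \<tau>h(2) by (simp only: complex_norm_square mult.commute)
      qed
      then have hk: "star h * ((k - star h * h) * h) = 0" by simp
      have "star ((n - h) * h) * ((n - h) * h) =
          star h * (star n * n - star n * h - star h * n + star h * h) * h"
        by (simp add: star_mult star_diff algebra_simps)
      also have "P \<dots> = star h * (k - star h * h - star h * h + star h * h) * h"
        using hD kD by (simp add: P_left P_right P_add P_diff P_id P_star k_def[symmetric] h_def[symmetric])
      also have "\<dots> = 0" using hk by (simp add: mult.assoc)
      finally have "(n - h) * h = 0" by (rule P_faithful)
      then have "h \<in> J" using hD complex_vector.subspace_0[OF M(1)] by (simp add: J_def)
      then have "\<sigma> h = 0" by (rule \<sigma>J)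
      moreover have "\<sigma> k = of_real ((cmod (\<sigma> h))\<^sup>2)"
        unfolding k_def h_def
        by (rule fixed_character[OF PU n kD[unfolded k_def] \<sigma> kD \<sigma>k]) (use True in \<open>simp add: k_def\<close>)
      ultimately show False using \<sigma>k by simp
    next
      case False
      define \<tau> where "\<tau> d = \<sigma> (star n * d * n) / \<sigma> k" for d
      have \<tau>: "character \<tau>" "\<tau> (n * star n) \<noteq> 0"
        unfolding \<tau>_def k_def
        by (rule normalizer_character[OF n masa \<sigma>]; use \<sigma>k in \<open>simp add: k_def\<close>)+
      obtain d where d: "d \<in> D" "\<sigma> (star n * d * n) \<noteq> \<sigma> d * \<sigma> k" using False by blast
      then have "\<sigma> d \<noteq> \<tau> d" using \<sigma>k by (simp add: \<tau>_def field_simps)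
      then obtain a b where ab: "a \<in> D" "b \<in> D" "a * b = 0" "\<sigma> a \<noteq> 0" "\<tau> b \<noteq> 0"
        using characters_separated_by_product[OF \<sigma> \<tau>(1) kD \<sigma>k vD \<tau>(2) d(1)] by blast
      define \<beta> where "\<beta> x = star n * x * n" for x
      have \<beta>D: "\<beta> x \<in> D" if "x \<in> D" for x using bD[OF that] by (simp add: \<beta>_def)
      define e where "e = a * \<beta> b"
      have eD: "e \<in> D" using ab \<beta>D by (simp add: e_def)
      have "\<sigma> (\<beta> b) \<noteq> 0" using ab(5) by (auto simp: \<tau>_def \<beta>_def)
      then have \<sigma>e: "\<sigma> (e * k) \<noteq> 0"
        using ab eD kD \<beta>D[OF ab(2)] \<sigma>k by (simp add: characterD(3)[OF \<sigma>] e_def)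
      have "\<beta> e * \<beta> b = star n * (e * (n * star n * b)) * n" by (simp only: \<beta>_def mult.assoc)
      also have "\<dots> = star n * (a * \<beta> b * (n * star n * b)) * n" by (simp only: e_def)
      also have "a * \<beta> b * (n * star n * b) = (a * b) * (\<beta> b * (n * star n))"
      proof -
        have "w * x * (y * z) = (w * z) * (x * y)" if "w \<in> D" "x \<in> D" "y \<in> D" "z \<in> D" for w x y z
          using that by (simp add: comm_ac)
        from this[OF ab(1) \<beta>D[OF ab(2)] vD ab(2)] show ?thesis .
      qed
      finally have "\<beta> e * \<beta> b = 0" by (simp add: ab(3))
      then have \<beta>ee: "\<beta> e * e = 0"
        using left_comm[OF \<beta>D[OF eD] ab(1), of "\<beta> b"] by (simp add: e_def)
      have enk: "e * n * k = n * \<beta> e"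
      proof -
        have "n * \<beta> e = (n * star n) * e * n" by (simp only: \<beta>_def mult.assoc)
        also have "(n * star n) * e = e * (n * star n)" using vD eD by (rule comm)
        finally show ?thesis by (simp only: k_def mult.assoc)
      qed
      have "e * n * (e * k) = e * n * k * e" using comm[OF eD kD] by (simp only: mult.assoc)
      also have "\<dots> = n * (\<beta> e * e)" unfolding enk by (simp only: mult.assoc)
      finally have enek: "e * n * (e * k) = 0" by (simp add: \<beta>ee)
      let ?m = "n * (e * k)"
      have "?m * ?m = n * (k * (e * n * (e * k)))" using comm[OF eD kD] by (simp only: mult.assoc)
      then have mm: "?m * ?m = 0" by (simp add: enek)
      have m: "?m \<in> normalizers D"
        unfolding normalizers_def
      proof (intro CollectI ballI conjI)
        fix x assume x: "x \<in> D"
        have "n * (e * k * x * star (e * k)) * star n \<in> D"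
          using n eD kD x by (simp add: normalizers_def)
        then show "?m * x * star ?m \<in> D" by (simp only: star_mult mult.assoc)
        have "star (e * k) * (star n * x * n) * (e * k) \<in> D"
          using bD[OF x] eD kD by simp
        then show "star ?m * x * ?m \<in> D" by (simp only: star_mult mult.assoc)
      qed
      have mN: "?m \<in> free_normalizers D" using m mm by (simp add: free_normalizers_def)
      have "h * (e * k) = P ?m" using P_right[of "e * k" n] eD kD by (simp add: h_def)
      also have "\<dots> = 0" using mN by (rule P_free_normalizer)
      finally have "(n - h) * (e * k) = ?m" by (simp only: left_diff_distrib diff_zero)
      then have "e * k \<in> J"
        using mN subset_closure_span[of "free_normalizers D"] eD kD by (auto simp: J_def)
      then show False using \<sigma>J \<sigma>e by blast
    qed
  qed
  obtain e where e: "\<And>j. e j \<in> D" "\<And>j. star (e j) = e j"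
    "\<And>j. \<exists>s d. d \<in> D \<and> e j = s *\<^sub>C (star n * n) + star n * n * d" "(\<lambda>j::nat. n * e j) \<longlonglongrightarrow> n"
    by (rule approx_unit_right[OF kD[unfolded k_def]]) (rule that)
  have "e j \<in> J" for j
  proof -
    obtain s d where "d \<in> D" and ej: "e j = s *\<^sub>C k + k * d" using e(3)[of j] unfolding k_def by blast
    then show ?thesis
      unfolding ej using J_sub J_ideal \<open>k \<in> J\<close>
      by (intro complex_vector.subspace_add complex_vector.subspace_scale)
  qed
  then have "(n - h) * e j \<in> ?M" for j by (simp add: J_def)
  moreover have "(\<lambda>j. (n - h) * e j) \<longlonglongrightarrow> n - h"
  proof -
    have eq: "P (n * e j) = h * e j" for j using P_right[OF e(1)] by (simp only: h_def)
    have "(\<lambda>j. P (n * e j)) \<longlonglongrightarrow> h"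
      unfolding h_def using e(4) by (rule bounded_linear.tendsto[OF bounded_linear_P])
    then have "(\<lambda>j. h * e j) \<longlonglongrightarrow> h" by (simp only: eq)
    with e(4) have "(\<lambda>j. n * e j - h * e j) \<longlonglongrightarrow> n - h" by (rule tendsto_diff)
    then show ?thesis by (simp only: left_diff_distrib)
  qed
  ultimately have "n - h \<in> ?M" by (rule closed_sequentially[OF M(2)])
  then show ?thesis by (simp only: h_def)
qed

lemma cartan_imp_kumjian:
  assumes PU: "pure_states_extend_uniquely D" and masa: "masa_inclusion D" and reg: "regular_inclusion D"
  shows "closure (complex_vector.span (free_normalizers D)) = {a. P a = 0}" (is "?M = _")
proof
  show "?M \<subseteq> {a. P a = 0}" by (rule closure_span_free_subset)
  have M: "complex_vector.subspace ?M" "closed ?M" by (rule subspace_closure_span, rule closed_closure)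
  have "complex_vector.subspace {a. a - P a \<in> ?M}"
  proof (rule complex_vector.subspaceI)
    show "0 \<in> {a. a - P a \<in> ?M}" using complex_vector.subspace_0[OF M(1)] by simp
    fix x y and c assume x: "x \<in> {a. a - P a \<in> ?M}"
    show "c *\<^sub>C x \<in> {a. a - P a \<in> ?M}"
      using complex_vector.subspace_scale[OF M(1), of "x - P x" c] x
      by (simp add: P_scaleC complex_vector.scale_right_diff_distrib)
    assume "y \<in> {a. a - P a \<in> ?M}"
    then show "x + y \<in> {a. a - P a \<in> ?M}"
      using complex_vector.subspace_add[OF M(1), of "x - P x" "y - P y"] x
      by (simp add: P_add algebra_simps)
  qed
  moreover have "closed {a. a - P a \<in> ?M}"
    using closed_vimage[OF M(2) linear_continuous_on[OF bounded_linear_sub[OF bounded_linear_ident bounded_linear_P], of UNIV]]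
    by (simp add: vimage_def)
  moreover have "normalizers D \<subseteq> {a. a - P a \<in> ?M}"
    using normalizer_minus_expectation[OF PU masa] by blast
  ultimately have "closure (complex_vector.span (normalizers D)) \<subseteq> {a. a - P a \<in> ?M}"
    by (intro closure_span_subset)
  then have all: "a - P a \<in> ?M" for a using reg by (auto simp: regular_inclusion_def)
  show "{a. P a = 0} \<subseteq> ?M"
  proof
    fix a assume "a \<in> {a. P a = 0}"
    then show "a \<in> ?M" using all[of a] by simp
  qed
qed

end

section \<open>Unitizations and the main theorem\<close>

lemma kumjian_iff_cartan:
  fixes D :: "'a::cstar_algebra set"
  assumes "inclusion D"
  shows "kumjian_conditions D \<longleftrightarrow> cartan_inclusion D \<and> pure_states_extend_uniquely D"
proof
  assume "kumjian_conditions D"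
  then obtain P where P: "conditional_expectation D P" "faithful P"
    and dense: "closure (complex_vector.span (free_normalizers D)) = {a. P a = 0}"
    unfolding kumjian_conditions_def by blast
  interpret faithful_expectation D P using assms P by unfold_locales
  show "cartan_inclusion D \<and> pure_states_extend_uniquely D"
    unfolding cartan_inclusion_def
    using kumjian_imp_regular[OF dense] kumjian_imp_masa[OF dense]
      kumjian_imp_unique_extension[OF dense] P by blast
next
  assume cartan: "cartan_inclusion D \<and> pure_states_extend_uniquely D"
  then obtain P where P: "conditional_expectation D P" "faithful P"
    unfolding cartan_inclusion_def by blast
  interpret faithful_expectation D P using assms P by unfold_locales
  show "kumjian_conditions D"
    unfolding kumjian_conditions_def
    using cartan_imp_kumjian cartan P unfolding cartan_inclusion_def by blast
qed

lemma cartan_imp_no_annihilating_state: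
  fixes D :: "'a::cstar_algebra set"
  assumes "cartan_inclusion D" "state_on UNIV f" "\<forall>d\<in>D. f d = 0"
  shows False
proof -
  obtain P where P: "conditional_expectation D P" "faithful P"
    using assms(1) unfolding cartan_inclusion_def by blast
  have "inclusion D" using assms(1) unfolding cartan_inclusion_def masa_inclusion_def by blast
  then interpret faithful_expectation D P using P by unfold_locales
  show False
    using assms by (intro no_state_annihilates[of f]) (simp_all add: cartan_inclusion_def)
qed

definition expectation_unitization :: "('a::cstar_algebra \<Rightarrow> 'a) \<Rightarrow> 'a unitization \<Rightarrow> 'a unitization" where
  "expectation_unitization P z = Unitization (P (alg_part z)) (scal_part z)"

lemma expectation_unitization_parts [simp]:
  "alg_part (expectation_unitization P z) = P (alg_part z)"
  "scal_part (expectation_unitization P z) = scal_part z"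
  by (simp_all add: expectation_unitization_def)

context faithful_expectation
begin

interpretation unit: unital_comm_cstar "unitization_set D"
  by (rule unital_comm_cstar_unitization)

abbreviation Q :: "'a unitization \<Rightarrow> 'a unitization" where "Q \<equiv> expectation_unitization P"

lemma Q_linear: "Q (z + w) = Q z + Q w" "Q (z - w) = Q z - Q w" "Q (c *\<^sub>C z) = c *\<^sub>C Q z"
  by (rule unitization_eqI; simp add: P_add P_diff P_scaleC)+

lemma Q_mem: "Q z \<in> unitization_set D"
  by simp

lemma Q_square: "Q (star z * z) \<in> unit.cone"
proof -
  define a c where "a = alg_part z" and "c = scal_part z"
  obtain d where d: "d \<in> D" "P (star (a - P a) * (a - P a)) = star d * d" using P_square by blast
  have "P (star (a - P a) * (a - P a)) = P (star a * a) - star (P a) * P a"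
    by (simp add: star_diff left_diff_distrib right_diff_distrib P_diff P_left P_right P_id P_star)
  then have eq: "P (star a * a) = star (P a) * P a + star d * d" using d(2) by simp
  have "Q (star z * z) = star (Q z) * Q z + star (emb d) * emb d"
    by (rule unitization_eqI)
      (simp_all add: P_add P_scaleC P_star eq a_def[symmetric] c_def[symmetric] add_ac)
  moreover have "star (Q z) * Q z \<in> unit.cone" using Q_mem by (rule unit.coneI)
  moreover have "star (emb d) * emb d \<in> unit.cone" using d(1) by (intro unit.coneI) simp
  ultimately show ?thesis by (simp only: unit.cone_add)
qed

lemma Q_schwarz: "Q (star z * z) - star (Q z) * Q z \<in> unit.cone"
proof -
  have "Q (star (z - Q z) * (z - Q z)) = Q (star z * z) - star (Q z) * Q z"
    by (rule unitization_eqI)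
      (simp_all add: P_add P_diff P_scaleC P_star P_left P_right P_id star_diff algebra_simps
        complex_vector.scale_right_diff_distrib)
  then show ?thesis using Q_square[of "z - Q z"] by simp
qed

lemma norm_Q: "norm (Q z) \<le> norm z"
proof -
  define r where "r = (norm z)\<^sup>2"
  have r: "0 \<le> r" by (simp add: r_def)
  have "Q (of_real r - star z * z) \<in> unit.cone"
  proof (cases "z = 0")
    case True
    have "Q 0 = 0" by (rule unitization_eqI) simp_all
    then show ?thesis using True unit.cone_of_real[of 0] by (simp add: r_def)
  next
    case False
    then have r: "r > 0" by (simp add: r_def)
    define x where "x = (1 / r) *\<^sub>R (star z * z)"
    have x: "star x = x" "norm x \<le> 1"
      using r by (simp_all add: x_def star_scaleR star_mult cstar_identity r_def)
    obtain y where y: "star y = y" "norm y \<le> 1" "y + y - y * y = x"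
      "\<And>S. cstar_subalgebra S \<Longrightarrow> x \<in> S \<Longrightarrow> y \<in> S"
      by (rule cstar_sqrt[OF x]) (rule that)
    have rx: "star z * z = r *\<^sub>R x" using r by (simp add: x_def)
    have "of_real r - star z * z = r *\<^sub>R (1 - x)"
      unfolding rx by (simp add: scaleR_right_diff_distrib of_real_def)
    also have "1 - x = star (1 - y) * (1 - y)"
      unfolding y(3)[symmetric] by (simp add: star_diff y(1) algebra_simps)
    finally have "Q (of_real r - star z * z) = r *\<^sub>R Q (star (1 - y) * (1 - y))"
      by (simp only: scaleR_scaleC Q_linear)
    then show ?thesis using r Q_square[of "1 - y"] by (simp only: unit.cone_scaleR less_imp_le)
  qed
  moreover have "Q (of_real r) = of_real r" by (rule unitization_eqI) simp_all
  ultimately have c1: "of_real r - Q (star z * z) \<in> unit.cone" by (simp only: Q_linear)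
  have c2: "star (Q z) * Q z \<in> unit.cone" using Q_mem by (rule unit.coneI)
  have "star (Q z) * Q z + ((Q (star z * z) - star (Q z) * Q z) + (of_real r - Q (star z * z))) = of_real r"
    by simp
  then have "norm (star (Q z) * Q z) \<le> r"
    using c2 unit.cone_add[OF Q_schwarz c1] r by (intro unit.norm_le_of_cone_sum)
  then have "(norm (Q z))\<^sup>2 \<le> (norm z)\<^sup>2" by (simp add: cstar_identity r_def)
  then show ?thesis by (rule power2_le_imp_le) simp
qed

lemma expectation_Q: "conditional_expectation (unitization_set D) Q"
  unfolding conditional_expectation_def
proof (intro conjI allI ballI)
  show "Vector_Spaces.linear (*\<^sub>C) (*\<^sub>C) Q"
    by (simp only: Vector_Spaces.linear_iff Q_linear complex_vector.vector_space_axioms simp_thms)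
  show "range Q \<subseteq> unitization_set D" by auto
  show "Q d = d" if "d \<in> unitization_set D" for d
    using that by (intro unitization_eqI) (simp_all add: P_id)
  show "norm (Q a) \<le> norm a" for a by (rule norm_Q)
  show "\<exists>d\<in>unitization_set D. Q (star a * a) = star d * d" for a
    using Q_square[of a] unfolding unit.cone_def by blast
  show "Q (d * a) = d * Q a" "Q (a * d) = Q a * d" if "d \<in> unitization_set D" for d a
    using that by (intro unitization_eqI; simp add: P_add P_scaleC P_left P_right P_id)+
qed

lemma faithful_Q: "faithful Q"
  unfolding faithful_def
proof (intro allI impI)
  fix z assume z: "Q (star z * z) = 0"
  have "scal_part (Q (star z * z)) = 0" unfolding z by simp
  then have s: "scal_part z = 0" by simp
  have "alg_part (Q (star z * z)) = 0" unfolding z by simp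
  then have "P (star (alg_part z) * alg_part z) = 0" by (simp add: s)
  then have "alg_part z = 0" by (rule P_faithful)
  then show "z = 0" using s by (intro unitization_eqI) simp_all
qed

lemma kumjian_unitization:
  assumes dense: "closure (complex_vector.span (free_normalizers D)) = {a. P a = 0}"
  shows "kumjian_conditions (unitization_set D)"
proof -
  interpret Q: faithful_expectation "unitization_set D" Q
    using unit.inclusion expectation_Q faithful_Q by unfold_locales
  let ?M = "closure (complex_vector.span (free_normalizers (unitization_set D)))"
  have emb_free: "emb n \<in> free_normalizers (unitization_set D)" if n: "n \<in> free_normalizers D" for n
  proof -
    have nN: "n \<in> normalizers D" "n * n = 0" using n by (auto simp: free_normalizers_def)
    note sq = masa_normalizer_square[OF kumjian_imp_masa[OF dense] nN(1)]
    have "alg_part (emb n * z * star (emb n)) \<in> D" "alg_part (star (emb n) * z * emb n) \<in> D"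
      if "alg_part z \<in> D" for z
    proof -
      have "n * alg_part z * star n \<in> D" "star n * alg_part z * n \<in> D"
        using nN(1) that by (simp_all add: normalizers_def)
      then show "alg_part (emb n * z * star (emb n)) \<in> D" "alg_part (star (emb n) * z * emb n) \<in> D"
        using sq by (simp_all add: distrib_right mult_scaleC_left)
    qed
    then have "emb n \<in> normalizers (unitization_set D)"
      by (simp add: normalizers_def del: alg_part_ops)
    moreover have "emb n * emb n = 0" using nN(2) by (simp add: emb_zero flip: emb_mult)
    ultimately show ?thesis by (simp only: free_normalizers_def mem_Collect_eq)
  qed
  have "{z. Q z = 0} \<subseteq> ?M"
  proof
    fix z assume "z \<in> {z. Q z = 0}"
    then have z: "Q z = 0" by simp
    have s: "scal_part z = 0" and Pa: "P (alg_part z) = 0"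
      using arg_cong[OF z, of scal_part] arg_cong[OF z, of alg_part] by simp_all
    have "complex_vector.subspace {a. emb a \<in> ?M}"
      using subspace_closure_span[of "free_normalizers (unitization_set D)"]
      by (auto simp: complex_vector.subspace_def emb_zero emb_add emb_scaleC)
    moreover have "closed {a. emb a \<in> ?M}"
      using closed_vimage[OF closed_closure linear_continuous_on[OF bounded_linear_emb, of UNIV]]
      by (simp add: vimage_def)
    moreover have "free_normalizers D \<subseteq> {a. emb a \<in> ?M}"
      using emb_free subset_closure_span[of "free_normalizers (unitization_set D)"] by blast
    ultimately have "closure (complex_vector.span (free_normalizers D)) \<subseteq> {a. emb a \<in> ?M}"
      by (intro closure_span_subset)
    then have "emb (alg_part z) \<in> ?M" using Pa unfolding dense by blast
    then show "z \<in> ?M" by (simp only: emb_alg_part[OF s])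
  qed
  then have "?M = {z. Q z = 0}" using Q.closure_span_free_subset by blast
  then show ?thesis unfolding kumjian_conditions_def using expectation_Q faithful_Q by blast
qed

end

lemma kumjian_of_unitization:
  fixes D :: "'a::cstar_algebra set"
  assumes D: "inclusion D" and kumjian: "kumjian_conditions (unitization_set D)"
  shows "kumjian_conditions D"
proof -
  interpret comm_cstar D using D by unfold_locales
  obtain Q where Q: "conditional_expectation (unitization_set D) Q" "faithful Q"
    and dense: "closure (complex_vector.span (free_normalizers (unitization_set D))) = {z. Q z = 0}"
    using kumjian unfolding kumjian_conditions_def by blast
  interpret Q: faithful_expectation "unitization_set D" Q
    using inclusion_unitization_set[OF D] Q by unfold_locales
  have free: "scal_part n = 0 \<and> alg_part n \<in> free_normalizers D"
    if n: "n \<in> free_normalizers (unitization_set D)" for n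
  proof
    have nn: "n * n = 0" and nN: "n \<in> normalizers (unitization_set D)"
      using n by (auto simp: free_normalizers_def)
    have "scal_part (n * n) = 0" unfolding nn by simp
    then show s: "scal_part n = 0" by simp
    have "alg_part (n * n) = 0" unfolding nn by simp
    then have "alg_part n * alg_part n = 0" by (simp add: s)
    moreover have "alg_part n * d * star (alg_part n) \<in> D \<and> star (alg_part n) * d * alg_part n \<in> D"
      if "d \<in> D" for d
    proof -
      have "emb d \<in> unitization_set D" using that by simp
      then have "n * emb d * star n \<in> unitization_set D" "star n * emb d * n \<in> unitization_set D"
        using nN unfolding normalizers_def by blast+
      then show ?thesis by (simp add: s)
    qed
    ultimately show "alg_part n \<in> free_normalizers D"
      unfolding free_normalizers_def normalizers_def by blast
  qed
  let ?N = "closure (complex_vector.span (free_normalizers D))"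
  have "complex_vector.subspace {z. scal_part z = 0 \<and> alg_part z \<in> ?N}"
    using subspace_closure_span[of "free_normalizers D"] by (auto simp: complex_vector.subspace_def)
  moreover have "closed {z. scal_part z = 0 \<and> alg_part z \<in> ?N}"
  proof -
    have "closed {z :: 'a unitization. alg_part z \<in> ?N}"
      using closed_vimage[OF closed_closure linear_continuous_on[OF bounded_linear_alg_part, of UNIV]]
      by (simp add: vimage_def)
    with closed_kernel[OF bounded_linear_scal_part] show ?thesis
      by (rule closed_Collect_conj)
  qed
  moreover have "free_normalizers (unitization_set D) \<subseteq> {z. scal_part z = 0 \<and> alg_part z \<in> ?N}"
    using free subset_closure_span[of "free_normalizers D"] by blast
  ultimately have ker: "{z. Q z = 0} \<subseteq> {z. scal_part z = 0 \<and> alg_part z \<in> ?N}"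
    unfolding dense[symmetric] by (intro closure_span_subset)
  define P where "P a = alg_part (Q (emb a))" for a
  have QP: "Q (emb a) = emb (P a)" for a
  proof -
    have "Q (emb a - Q (emb a)) = 0" by (simp only: Q.P_diff Q.P_id[OF Q.P_mem] diff_self)
    then have "scal_part (emb a - Q (emb a)) = 0" using ker by blast
    then have "scal_part (Q (emb a)) = 0" by simp
    then show ?thesis by (simp only: P_def emb_alg_part)
  qed
  have P_mem: "P a \<in> D" for a using Q.P_mem[of "emb a"] by (simp add: P_def)
  have mem: "emb d \<in> unitization_set D" if "d \<in> D" for d using that by simp
  have P: "conditional_expectation D P"
    unfolding conditional_expectation_def
  proof (intro conjI allI ballI)
    have "P (a + b) = P a + P b" "P (c *\<^sub>C a) = c *\<^sub>C P a" for a b c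
      by (simp_all add: P_def emb_add emb_scaleC Q.P_add Q.P_scaleC)
    then show "Vector_Spaces.linear (*\<^sub>C) (*\<^sub>C) P"
      by (simp only: Vector_Spaces.linear_iff complex_vector.vector_space_axioms simp_thms)
    show "range P \<subseteq> D" using P_mem by blast
    show "P d = d" if "d \<in> D" for d using Q.P_id[OF mem[OF that]] by (simp add: P_def)
    show "norm (P a) \<le> norm a" for a using Q.norm_P[of "emb a"] by (simp add: QP)
    show "\<exists>d\<in>D. P (star a * a) = star d * d" for a
    proof -
      obtain y where y: "y \<in> unitization_set D" "Q (star (emb a) * emb a) = star y * y"
        using Q.P_square[of "emb a"] by blast
      have eq: "emb (P (star a * a)) = star y * y" using y(2) by (simp only: emb_mult emb_star QP[symmetric])
      have "scal_part (star y * y) = 0" unfolding eq[symmetric] by simp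
      then have "scal_part y = 0" by simp
      then have "P (star a * a) = star (alg_part y) * alg_part y"
        using arg_cong[OF eq, of alg_part] by simp
      then show ?thesis using y(1) by auto
    qed
    show "P (d * a) = d * P a" "P (a * d) = P a * d" if "d \<in> D" for d a
    proof -
      have "emb (P (d * a)) = emb (d * P a)" "emb (P (a * d)) = emb (P a * d)"
        using Q.P_left[OF mem[OF that]] Q.P_right[OF mem[OF that]] by (simp_all only: QP[symmetric] emb_mult)
      then show "P (d * a) = d * P a" "P (a * d) = P a * d" by simp_all
    qed
  qed
  have faithful_P: "faithful P"
    unfolding faithful_def
  proof (intro allI impI)
    fix a assume "P (star a * a) = 0"
    then have "Q (star (emb a) * emb a) = 0" by (simp only: emb_mult[symmetric] emb_star[symmetric] QP emb_zero)
    then have "emb a = 0" by (rule Q.P_faithful)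
    then show "a = 0" by (simp only: emb_zero[symmetric] emb_eq_iff)
  qed
  interpret P: faithful_expectation D P using P faithful_P by unfold_locales
  have "{a. P a = 0} \<subseteq> ?N"
  proof
    fix a assume "a \<in> {a. P a = 0}"
    then have "Q (emb a) = 0" by (simp add: QP emb_zero)
    then have "alg_part (emb a) \<in> ?N" using ker by blast
    then show "a \<in> ?N" by simp
  qed
  then have "?N = {a. P a = 0}" using P.closure_span_free_subset by blast
  then show ?thesis unfolding kumjian_conditions_def using P faithful_P by blast
qed

lemma kumjian_unitization_iff:
  fixes D :: "'a::cstar_algebra set"
  assumes D: "inclusion D"
  shows "kumjian_conditions D \<longleftrightarrow> kumjian_conditions (unitization_set D)"
proof
  assume "kumjian_conditions D"
  then obtain P where P: "conditional_expectation D P" "faithful P"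
    and dense: "closure (complex_vector.span (free_normalizers D)) = {a. P a = 0}"
    unfolding kumjian_conditions_def by blast
  interpret faithful_expectation D P using D P by unfold_locales
  show "kumjian_conditions (unitization_set D)" by (rule kumjian_unitization[OF dense])
qed (rule kumjian_of_unitization[OF D])

theorem proposition2p10:
  fixes D :: "'a::cstar_algebra set"
  assumes "inclusion D"
  shows
    "(unital_algebra TYPE('a) \<longrightarrow>
        (kumjian_conditions D \<longleftrightarrow> cartan_inclusion D \<and> pure_states_extend_uniquely D)) \<and>
     (\<not> unital_algebra TYPE('a) \<longrightarrow>
        (kumjian_conditions D \<longleftrightarrow>
           cartan_inclusion D \<and> pure_states_extend_uniquely D) \<and>
        (kumjian_conditions D \<longleftrightarrow>
           cartan_inclusion D \<and> pure_states_extend_uniquely D \<and>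
           \<not> (\<exists>f :: 'a \<Rightarrow> complex. pure_state_on UNIV f \<and> (\<forall>d\<in>D. f d = 0))) \<and>
        (kumjian_conditions D \<longleftrightarrow>
           cartan_inclusion (unitization_set D) \<and>
           pure_states_extend_uniquely (unitization_set D)) \<and>
        (kumjian_conditions D \<longleftrightarrow> kumjian_conditions (unitization_set D)))"
proof -
  have "\<not> (\<exists>f :: 'a \<Rightarrow> complex. pure_state_on UNIV f \<and> (\<forall>d\<in>D. f d = 0))" if "cartan_inclusion D"
    using cartan_imp_no_annihilating_state[OF that] unfolding pure_state_on_def by blast
  then show ?thesis
    using kumjian_iff_cartan[OF assms] kumjian_unitization_iff[OF assms]
      kumjian_iff_cartan[OF inclusion_unitization_set[OF assms]]
    by blast
qed

end
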